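(* Let $G=(V,E)$ be a rooted directed tree without leaves, with $E=\{e_i\}_{i\in I}$, and let $L(G)$ be the associated directed metric tree. (a) Let $\rho=(\rho_i)_{i\in I}$ be a $1$-admissible weight for $L(G)$. The following assertions are equivalent: (i) the left translation semigroup $\{T_t\}_{t\ge0}$ is hypercyclic on $L^1_\rho(L(G))$; (ii) the left translation semigroup is weakly mixing on $L^1_\rho(L(G))$; (iii) there exists an increasing sequence $(n_h)_{h\in\mathbb{N}}$ of natural numbers such that for all $i\in I$ $$\lim_{h\to\infty}\ \inf_{j\in M_{n_h}(i)}\ \inf_{s\in[0,1)}\rho_j(s)=0.$$ (b) Let $1<p<\infty$ and let $\rho=(\rho_i)_{i\in I}$ be a $p$-admissible weight for $L(G)$. The following assertions are equivalent: (i) the left translation semigroup $\{T_t\}_{t\ge0}$ is hypercyclic on $L^p_\rho(L(G))$; (ii) the left translation semigroup is weakly mixing on $L^p_\rho(L(G))$; (iii) there exists an increasing sequence $(n_h)_{h\in\mathbb{N}}$ of natural numbers such that for all $i\in I$ $$\lim_{h\to\infty}\ \sup_{s\in[0,1)}\left(\sum_{j\in M_{n_h}(i)}\frac{1}{\rho_j(s)^{1/(p-1)}}\right)=\infty.$$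
   Context: **Directed tree.** A directed tree $G=(V,E)$ consists of a countable vertex set $V$ and a set $E\subset (V\times V)\setminus\{(v,v):v\in V\}$ of directed edges such that: the graph is connected (any two distinct vertices are joined by a finite path, ignoring orientation of edges); there are no closed directed cycles; and each vertex $v$ has at most one parent, i.e. at most one $w\in V$ with $(w,v)\in E$ (then $v$ is a child of $w$). For an edge $e=(v,w)$, $v$ is the tail and $w$ the head. A leaf is a vertex without children. The tree is rooted if there is a vertex (the root) that is not the head of any edge, and unrooted otherwise. **Directed metric tree.** $L(G)$ is obtained by identifying each edge with $[0,1)$, with coordinate increasing in the direction of the edge. Write $E=\{e_i\}_{i\in I}$ and let $\mathcal{A}=(\mathcal{A}_{ij})_{i,j\in I}$ be given by $\mathcal{A}_{ij}=1$ if the head of $e_i$ is the tail of $e_j$, and $\mathcal{A}_{ij}=0$ otherwise. Put $M_0(i)=\{i\}$ and, for $n\ge 1$, $M_n(i)=\{j\in I:(\mathcal{A}^n)_{ij}\ne 0\}$, i.e. the set of indices $j$ such that $e_j$ is reached from $e_i$ in $n$ steps along the direction of the edges. (Since each column of $\mathcal{A}$ has at most one nonzero entry, $(\mathcal{A}^n)_{ij}\in\{0,1\}$.) **Spaces.** A weight on $L(G)$ is a family $\rho=(\rho_i)_{i\in I}$ of functions $\rho_i:[0,1)\to\mathbb{R}$ with $\rho_i\in L^1((0,1))$ and $\rho_i>0$ a.e. A function $f$ on $L(G)$ is identified with the family $(f_i)_{i\in I}$ of its restrictions to edges, $f_i:[0,1)\to\mathbb{K}$, $\mathbb{K}=\mathbb{R}$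 or $\mathbb{C}$. For $1\le p<\infty$, $L^p_\rho(L(G))$ is the Banach space of all (a.e. classes of) families $f=(f_i)_{i\in I}$ of measurable functions with $\|f\|_{p,\rho}=\big(\sum_{i\in I}\int_0^1|f_i(s)|^p\rho_i(s)\,ds\big)^{1/p}<\infty$. **Left translation semigroup.** For $s\in[0,1)$, $t\ge0$, let $n(t,s)$ be the integer part of $s+t$. For $f=(f_i)_{i\in I}$, $t\ge 0$, $$(T_tf)_i(s)=\sum_{j\in M_{n(t,s)}(i)}(\mathcal{A}^{n(t,s)})_{ij}\,f_j\big(t+s-n(t,s)\big),\qquad i\in I,\ s\in[0,1).$$ **Admissible weights.** A weight $\rho$ with $\rho_i(s)>0$ for every $i\in I$ and every $s\in[0,1)$ is $p$-admissible for $L(G)$ if there exist $M\ge1$ and $w\in\mathbb{R}$ such that for all $i\in I$, $s\in[0,1)$, $t\ge0$: $$\rho_i(s)\le Me^{wt}\inf_{j\in M_{n(t,s)}(i)}\rho_j(s+t-n(t,s))\quad\text{if }p=1,$$ $$\Big(\sum_{j\in M_{n(t,s)}(i)}\rho_j(s+t-n(t,s))^{-1/(p-1)}\Big)^{p-1}\le M^pe^{pwt}\frac1{\rho_i(s)}\quad\text{if }1<p<\infty.$$ For a $p$-admissible weight, $\{T_t\}_{t\ge0}$ is a strongly continuous semigroup on $L^p_\rho(L(G))$. **Dynamics.** A strongly continuous semigroup $\{T_t\}_{t\ge0}$ on a separable Banach space $X$ is hypercyclic if there is $x\in X$ with $\{T_tx:t\ge0\}$ dense in $X$; it is topologically transitive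 if for all nonempty open $U,V\subset X$ there is $t_0\ge0$ with $T_{t_0}(U)\cap V\ne\emptyset$; it is weakly mixing if $(T_t\oplus T_t)_{t\ge0}$, $(T_t\oplus T_t)(x,y)=(T_tx,T_ty)$, is topologically transitive on $X\times X$. *)

theory Defs
  imports "HOL-Analysis.Analysis"
begin

section \<open>Directed trees\<close>

definition directed_tree :: "'v set \<Rightarrow> ('v \<times> 'v) set \<Rightarrow> bool" where
  "directed_tree V E \<longleftrightarrow>
     countable V \<and> E \<subseteq> V \<times> V \<and> irrefl E \<and>
     (\<forall>v\<in>V. \<forall>w\<in>V. (v, w) \<in> (E \<union> E\<inverse>)\<^sup>*) \<and>
     acyclic E \<and>
     (\<forall>u v w. (u, w) \<in> E \<and> (v, w) \<in> E \<longrightarrow> u = v)"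

definition rooted :: "'v set \<Rightarrow> ('v \<times> 'v) set \<Rightarrow> bool" where
  "rooted V E \<longleftrightarrow> (\<exists>r\<in>V. \<forall>u. (u, r) \<notin> E)"

definition is_leaf :: "'v set \<Rightarrow> ('v \<times> 'v) set \<Rightarrow> 'v \<Rightarrow> bool" where
  "is_leaf V E v \<longleftrightarrow> v \<in> V \<and> (\<forall>w. (v, w) \<notin> E)"

text \<open>The edges serve as their own index set; \<open>(v, w)\<close> has tail \<open>v\<close> and head \<open>w\<close>.\<close>

definition adj :: "('v \<times> 'v) set \<Rightarrow> 'v \<times> 'v \<Rightarrow> 'v \<times> 'v \<Rightarrow> real" where
  "adj E i j = (if i \<in> E \<and> j \<in> E \<and> snd i = fst j then 1 else 0)"

text \<open>Powers of the possibly infinite matrix \<open>adj E\<close>. In a directed tree each column of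
  \<open>adj E\<close> has at most one nonzero entry, so the sum has at most one nonzero term.\<close>

primrec adj_pow :: "('v \<times> 'v) set \<Rightarrow> nat \<Rightarrow> 'v \<times> 'v \<Rightarrow> 'v \<times> 'v \<Rightarrow> real" where
  "adj_pow E 0 i j = (if i = j then 1 else 0)"
| "adj_pow E (Suc n) i j = (\<Sum>\<^sub>\<infinity>k\<in>E. adj_pow E n i k * adj E k j)"

definition reach :: "('v \<times> 'v) set \<Rightarrow> nat \<Rightarrow> 'v \<times> 'v \<Rightarrow> ('v \<times> 'v) set" where
  "reach E n i = {j \<in> E. adj_pow E n i j \<noteq> 0}"


section \<open>Weighted \<open>L\<^sup>p\<close> spaces on the metric tree\<close>

text \<open>A function on the metric tree is the family of its restrictions to the edges, each of
  which is a copy of \<open>[0,1)\<close>. Values at indices outside \<open>E\<close> or at arguments outside \<open>[0,1)\<close>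
  are irrelevant: they disappear on passing to a.e. classes. The scalars range over an
  arbitrary type in the classes \<open>real_normed_field\<close> and \<open>euclidean_space\<close>; up to isomorphism
  these are exactly \<open>real\<close> and \<open>complex\<close>.\<close>

type_synonym ('v, 'k) tree_fun = "'v \<times> 'v \<Rightarrow> real \<Rightarrow> 'k"

definition weight :: "('v \<times> 'v) set \<Rightarrow> ('v, real) tree_fun \<Rightarrow> bool" where
  "weight E \<rho> \<longleftrightarrow>
     (\<forall>i\<in>E. integrable (lebesgue_on {0..<1}) (\<rho> i) \<and>
            (AE s in lebesgue_on {0..<1}. \<rho> i s > 0))"

definition Lp_mass :: "('v \<times> 'v) set \<Rightarrow> ('v, real) tree_fun \<Rightarrow> real \<Rightarrow>
    ('v, 'k::{real_normed_field,euclidean_space}) tree_fun \<Rightarrow> ennreal" where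
  "Lp_mass E \<rho> p f =
     (\<Sum>\<^sub>\<infinity>i\<in>E. \<integral>\<^sup>+ s. ennreal (norm (f i s) powr p * \<rho> i s) \<partial>lebesgue_on {0..<1})"

definition Lp_norm :: "('v \<times> 'v) set \<Rightarrow> ('v, real) tree_fun \<Rightarrow> real \<Rightarrow>
    ('v, 'k::{real_normed_field,euclidean_space}) tree_fun \<Rightarrow> real" where
  "Lp_norm E \<rho> p f = enn2real (Lp_mass E \<rho> p f) powr (1 / p)"

definition Lp_fun :: "('v \<times> 'v) set \<Rightarrow> ('v, real) tree_fun \<Rightarrow> real \<Rightarrow>
    ('v, 'k::{real_normed_field,euclidean_space}) tree_fun set" where
  "Lp_fun E \<rho> p =
     {f. (\<forall>i\<in>E. f i \<in> borel_measurable (lebesgue_on {0..<1})) \<and> Lp_mass E \<rho> p f < \<infinity>}"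

definition Lp_ae :: "('v \<times> 'v) set \<Rightarrow> ('v, real) tree_fun \<Rightarrow> real \<Rightarrow>
    (('v, 'k::{real_normed_field,euclidean_space}) tree_fun \<times> ('v, 'k) tree_fun) set" where
  "Lp_ae E \<rho> p =
     {(f, g). f \<in> Lp_fun E \<rho> p \<and> g \<in> Lp_fun E \<rho> p \<and>
              (\<forall>i\<in>E. AE s in lebesgue_on {0..<1}. f i s = g i s)}"

definition Lp_space :: "('v \<times> 'v) set \<Rightarrow> ('v, real) tree_fun \<Rightarrow> real \<Rightarrow>
    ('v, 'k::{real_normed_field,euclidean_space}) tree_fun set set" where
  "Lp_space E \<rho> p = Lp_fun E \<rho> p // Lp_ae E \<rho> p"

text \<open>The norm distance of two classes, computed on arbitrary representatives.\<close>

definition Lp_dist :: "('v \<times> 'v) set \<Rightarrow> ('v, real) tree_fun \<Rightarrow> real \<Rightarrow>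
    ('v, 'k::{real_normed_field,euclidean_space}) tree_fun set \<Rightarrow> ('v, 'k) tree_fun set \<Rightarrow> real" where
  "Lp_dist E \<rho> p F G =
     Lp_norm E \<rho> p (\<lambda>i s. (SOME f. f \<in> F) i s - (SOME g. g \<in> G) i s)"

definition Lp_topology :: "('v \<times> 'v) set \<Rightarrow> ('v, real) tree_fun \<Rightarrow> real \<Rightarrow>
    ('v, 'k::{real_normed_field,euclidean_space}) tree_fun set topology" where
  "Lp_topology E \<rho> p = Metric_space.mtopology (Lp_space E \<rho> p) (Lp_dist E \<rho> p)"


section \<open>The left translation semigroup and admissible weights\<close>

definition steps :: "real \<Rightarrow> real \<Rightarrow> nat" where
  "steps t s = nat \<lfloor>s + t\<rfloor>"

text \<open>The tree need not be locally finite, so the defining sum may be infinite. For an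
  admissible weight and \<open>f\<close> in \<open>L\<^sup>p\<close> it converges absolutely for almost every \<open>s\<close>.\<close>

definition left_translation :: "('v \<times> 'v) set \<Rightarrow> real \<Rightarrow>
    ('v, 'k::{real_normed_field,euclidean_space}) tree_fun \<Rightarrow> ('v, 'k) tree_fun" where
  "left_translation E t f = (\<lambda>i s.
     \<Sum>\<^sub>\<infinity>j\<in>reach E (steps t s) i.
       adj_pow E (steps t s) i j *\<^sub>R f j (t + s - real (steps t s)))"

text \<open>The operator induced on a.e. classes: a class is sent to the class of the translate of any
  of its members.\<close>

definition translation_semigroup :: "('v \<times> 'v) set \<Rightarrow> ('v, real) tree_fun \<Rightarrow> real \<Rightarrow> real \<Rightarrow>
    ('v, 'k::{real_normed_field,euclidean_space}) tree_fun set \<Rightarrow> ('v, 'k) tree_fun set" where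
  "translation_semigroup E \<rho> p t F = Lp_ae E \<rho> p `` (left_translation E t ` F)"

text \<open>For \<open>p = 1\<close> the infimum is taken in \<open>[0,\<infinity>]\<close>, so that it is \<open>\<infinity>\<close> over the empty set. For
  \<open>p > 1\<close> the right-hand side is finite, so the inequality includes convergence of the sum.\<close>

definition admissible :: "('v \<times> 'v) set \<Rightarrow> real \<Rightarrow> ('v, real) tree_fun \<Rightarrow> bool" where
  "admissible E p \<rho> \<longleftrightarrow>
     weight E \<rho> \<and> (\<forall>i\<in>E. \<forall>s\<in>{0..<1}. \<rho> i s > 0) \<and>
     (\<exists>C\<ge>1. \<exists>w. \<forall>i\<in>E. \<forall>s\<in>{0..<1}. \<forall>t\<ge>0.
        let n = steps t s; r = s + t - real n in
        if p = 1
        then ennreal (\<rho> i s) \<le> ennreal (C * exp (w * t)) * (INF j\<in>reach E n i. ennreal (\<rho> j r))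
        else (\<lambda>j. \<rho> j r powr (- 1 / (p - 1))) summable_on reach E n i \<and>
             (\<Sum>\<^sub>\<infinity>j\<in>reach E n i. \<rho> j r powr (- 1 / (p - 1))) powr (p - 1)
               \<le> C powr p * exp (p * w * t) * (1 / \<rho> i s))"


section \<open>Dynamics of one-parameter families of maps\<close>

definition hypercyclic :: "'a topology \<Rightarrow> (real \<Rightarrow> 'a \<Rightarrow> 'a) \<Rightarrow> bool" where
  "hypercyclic X T \<longleftrightarrow>
     (\<exists>x\<in>topspace X. X closure_of ((\<lambda>t. T t x) ` {0..}) = topspace X)"

definition topologically_transitive :: "'a topology \<Rightarrow> (real \<Rightarrow> 'a \<Rightarrow> 'a) \<Rightarrow> bool" where
  "topologically_transitive X T \<longleftrightarrow>
     (\<forall>U W. openin X U \<and> U \<noteq> {} \<and> openin X W \<and> W \<noteq> {} \<longrightarrow> (\<exists>t\<ge>0. T t ` U \<inter> W \<noteq> {}))"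

definition weakly_mixing :: "'a topology \<Rightarrow> (real \<Rightarrow> 'a \<Rightarrow> 'a) \<Rightarrow> bool" where
  "weakly_mixing X T \<longleftrightarrow>
     topologically_transitive (prod_topology X X) (\<lambda>t. map_prod (T t) (T t))"

end

theory Submission
  imports Defs
begin

text \<open>The weight enters the dynamics only through the cost \<open>\<Sum>\<^sub>j \<rho>\<^sub>j(s) c\<^sub>j\<^sup>p\<close> of distributing a
  unit mass from an edge \<open>i\<close>, in nonnegative portions \<open>c\<^sub>j\<close> with sum 1, over finitely many edges
  \<open>j\<close> that lie \<open>n\<close> generations further. For \<open>p = 1\<close> the least cost is the infimum of the weights;
  for \<open>p > 1\<close> it is, by Hoelder's inequality, the power \<open>1 - p\<close> of the sum of the dual weights
  \<open>\<rho>\<^sub>j powr (- 1 / (p - 1))\<close>. In both cases the condition on the weight therefore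
  says that, for any finite set of edges and arbitrarily late \<open>n\<close>, the cost becomes as small as desired simultaneously for
  all these edges (\<open>escape_iff_INF\<close>, \<open>escape_iff_SUP\<close>, \<open>exists_common_subsequence_iff\<close>).
  Admissibility in turn says that the cost never drops by more than an exponential factor in time
  (\<open>admissible_controlled_weight\<close>), and from here on all \<open>p \<ge> 1\<close> are treated alike.

  The condition on the weight concerns the cost at one point of the edges only. Moving all mass one
  generation back makes the cost small at every point with constant coefficients \<open>c\<^sub>j\<close>
  (\<open>escape_Suc_imp_thin\<close>). A bounded function \<open>w\<close> supported by finitely many edges then has a
  preimage under the translation by \<open>n\<close> of small norm: the function \<open>c\<^sub>j w\<^sub>i\<close> on the edges \<open>j\<close>
  assigned to \<open>i\<close> (\<open>translation_right_inverse\<close>). On the other hand, the tree being rooted, every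
  finitely supported function is annihilated by late translations (\<open>tame_depth\<close>). So if \<open>u\<close> and
  \<open>w\<close> are finitely supported and \<open>x\<close> is such a preimage of \<open>w\<close>, then \<open>u + x\<close> is close to \<open>u\<close>
  and is sent to \<open>w\<close>; weak mixing follows because step functions are dense (\<open>tame_dense\<close>). A
  series of preimages of the members of a dense sequence, taken at rapidly increasing times, is a
  vector with dense orbit (\<open>spreads_imp_hypercyclic\<close>).

  Conversely, hypercyclicity as well as weak mixing provide functions \<open>f\<close> of bounded norm and times
  \<open>t\<close> such that the translate of \<open>f\<close> is close to an arbitrarily large constant on finitely many
  given edges. The \<open>p\<close>-th power of the norm of \<open>f\<close>, divided by the least cost in generation \<open>\<lfloor>t\<rfloor>\<close>,
  bounds the translate, hence the cost must be small; and since translations up to a given time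
  are bounded, \<open>t\<close> must be large (\<open>reaches_large_constants_imp_escape\<close>).\<close>

section \<open>Infinite sums of functions\<close>

lemma ennreal_summable_on [simp]: "f summable_on A" for f :: "'a \<Rightarrow> ennreal"
  by (rule nonneg_summable_on_complete) simp

lemma infsum_ennreal_SUP:
  fixes f :: "'a \<Rightarrow> ennreal"
  shows "infsum f A = (SUP F\<in>{F. finite F \<and> F \<subseteq> A}. sum f F)"
  by (rule nonneg_infsum_complete) simp

lemma infsum_ennreal_cmult:
  fixes f :: "'a \<Rightarrow> ennreal"
  shows "(\<Sum>\<^sub>\<infinity>x\<in>A. c * f x) = c * infsum f A"
  unfolding infsum_ennreal_SUP sum_distrib_left[symmetric]
  by (rule SUP_mult_left_ennreal[symmetric])

lemma infsum_ennreal_mono: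
  fixes f :: "'a \<Rightarrow> ennreal"
  assumes "\<And>x. x \<in> A \<Longrightarrow> f x \<le> g x"
  shows "infsum f A \<le> infsum g A"
  by (rule infsum_mono) (use assms in auto)

lemma infsum_ennreal_subset:
  fixes f :: "'a \<Rightarrow> ennreal"
  assumes "A \<subseteq> B"
  shows "infsum f A \<le> infsum f B"
  unfolding infsum_ennreal_SUP by (rule SUP_subset_mono) (use assms in auto)

lemma sum_le_infsum_ennreal:
  fixes f :: "'a \<Rightarrow> ennreal"
  assumes "finite F" "F \<subseteq> A"
  shows "sum f F \<le> infsum f A"
  unfolding infsum_ennreal_SUP by (rule SUP_upper) (use assms in auto)

lemma member_le_infsum_ennreal:
  fixes f :: "'a \<Rightarrow> ennreal"
  assumes "x \<in> A"
  shows "f x \<le> infsum f A"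
  using sum_le_infsum_ennreal[of "{x}" A f] assms by simp

lemma infsum_ennreal_split:
  fixes f :: "'a \<Rightarrow> ennreal"
  assumes "F \<subseteq> A"
  shows "infsum f A = infsum f F + infsum f (A - F)"
proof -
  have "infsum f (F \<union> (A - F)) = infsum f F + infsum f (A - F)"
    by (rule infsum_Un_disjoint) auto
  with assms show ?thesis by (simp add: Un_absorb1)
qed

text \<open>Finite unions of the disjoint pieces suffice, since an infinite sum in \<open>[0,\<infinity>]\<close> is the
  supremum of its finite partial sums.\<close>

lemma infsum_ennreal_disjoint_family:
  fixes f :: "'a \<Rightarrow> ennreal"
  assumes disj: "\<And>i i'. i \<in> I \<Longrightarrow> i' \<in> I \<Longrightarrow> i \<noteq> i' \<Longrightarrow> S i \<inter> S i' = {}"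
    and sub: "\<And>i. i \<in> I \<Longrightarrow> S i \<subseteq> B"
  shows "(\<Sum>\<^sub>\<infinity>i\<in>I. infsum f (S i)) \<le> infsum f B"
proof (rule infsum_le_finite_sums)
  fix F assume F: "finite F" "F \<subseteq> I"
  then have "(\<Sum>i\<in>F. infsum f (S i)) = infsum f (\<Union>i\<in>F. S i)"
  proof (induction F)
    case (insert a F)
    have "S a \<inter> S i = {}" if "i \<in> F" for i
      by (rule disj) (use insert that in auto)
    then have "S a \<inter> (\<Union>i\<in>F. S i) = {}" by blast
    then have "infsum f (S a \<union> (\<Union>i\<in>F. S i)) = infsum f (S a) + infsum f (\<Union>i\<in>F. S i)"
      by (intro infsum_Un_disjoint ennreal_summable_on)
    moreover have "(\<Sum>i\<in>F. infsum f (S i)) = infsum f (\<Union>i\<in>F. S i)"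
      using insert by blast
    ultimately show ?case using insert(1,2) by simp
  qed simp
  also have "\<dots> \<le> infsum f B"
    by (rule infsum_ennreal_subset) (use F sub in auto)
  finally show "(\<Sum>i\<in>F. infsum f (S i)) \<le> infsum f B" .
qed simp

lemma infsum_ennreal_small_tail:
  fixes f :: "'a \<Rightarrow> ennreal"
  assumes "infsum f A < \<infinity>" and e: "(e::real) > 0"
  obtains F where "finite F" "F \<subseteq> A" "infsum f (A - F) < ennreal e"
proof -
  have "\<exists>F\<in>{F. finite F \<and> F \<subseteq> A}. infsum f A < sum f F + ennreal e"
    by (rule SUP_approx_ennreal[OF e _ infsum_ennreal_SUP]) (use assms in auto)
  then obtain F where F: "finite F" "F \<subseteq> A" "infsum f A < sum f F + ennreal e" by auto
  have "infsum f A = sum f F + infsum f (A - F)"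
    using infsum_ennreal_split[OF F(2), of f] F(1) by simp
  with F(3) have "infsum f (A - F) < ennreal e"
    using ennreal_add_left_cancel_less by metis
  with F show ?thesis by (intro that[of F])
qed

lemma sums_from_nat_into_infsum:
  fixes f :: "'a \<Rightarrow> 'b::{comm_monoid_add,t2_space}"
  assumes "countable A" "infinite A" "f summable_on A"
  shows "(\<lambda>n. f (from_nat_into A n)) sums infsum f A"
proof -
  have b: "bij_betw (from_nat_into A) UNIV A"
    using assms by (simp add: bij_betw_from_nat_into)
  have "(\<lambda>n. f (from_nat_into A n)) summable_on UNIV"
    using summable_on_reindex_bij_betw[OF b, of f] assms by simp
  then show ?thesis
    using infsum_reindex_bij_betw[OF b, of f] by (metis has_sum_imp_sums has_sum_infsum)
qed

lemma borel_measurable_infsum_ennreal: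
  fixes f :: "'a \<Rightarrow> 'b \<Rightarrow> ennreal"
  assumes "countable A" and f: "\<And>x. x \<in> A \<Longrightarrow> f x \<in> borel_measurable M"
  shows "(\<lambda>s. \<Sum>\<^sub>\<infinity>x\<in>A. f x s) \<in> borel_measurable M"
proof (cases "finite A")
  case False
  have "(\<Sum>\<^sub>\<infinity>x\<in>A. f x s) = (\<Sum>n. f (from_nat_into A n) s)" for s
    by (intro sums_unique sums_from_nat_into_infsum assms(1) False ennreal_summable_on)
  moreover have "f (from_nat_into A n) \<in> borel_measurable M" for n
    using False by (intro f from_nat_into) auto
  ultimately show ?thesis by simp
qed (use f in auto)

lemma nn_integral_infsum:
  fixes f :: "'a \<Rightarrow> 'b \<Rightarrow> ennreal"
  assumes "countable A" and f: "\<And>x. x \<in> A \<Longrightarrow> f x \<in> borel_measurable M"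
  shows "(\<integral>\<^sup>+s. (\<Sum>\<^sub>\<infinity>x\<in>A. f x s) \<partial>M) = (\<Sum>\<^sub>\<infinity>x\<in>A. \<integral>\<^sup>+s. f x s \<partial>M)"
proof (cases "finite A")
  case True
  then show ?thesis using f by (simp add: nn_integral_sum)
next
  case False
  have eq: "infsum g A = (\<Sum>n. g (from_nat_into A n))" for g :: "'a \<Rightarrow> ennreal"
    by (intro sums_unique sums_from_nat_into_infsum assms(1) False ennreal_summable_on)
  have "f (from_nat_into A n) \<in> borel_measurable M" for n
    using False by (intro f from_nat_into) auto
  then show ?thesis unfolding eq by (rule nn_integral_suminf)
qed

text \<open>A family that is not summable has sum 0 by convention; the bound still holds, as the empty
  sum forces \<open>B \<ge> 0\<close>.\<close>

lemma norm_infsum_le_finite_sums: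
  fixes x :: "'a \<Rightarrow> 'b::real_normed_vector"
  assumes "\<And>J. finite J \<Longrightarrow> J \<subseteq> M \<Longrightarrow> norm (sum x J) \<le> B"
  shows "norm (infsum x M) \<le> B"
proof (cases "x summable_on M")
  case True
  then have "(sum x \<longlongrightarrow> infsum x M) (finite_subsets_at_top M)" by (rule infsum_tendsto)
  then have "((\<lambda>J. norm (sum x J)) \<longlongrightarrow> norm (infsum x M)) (finite_subsets_at_top M)"
    by (rule tendsto_norm)
  then show ?thesis
    by (rule tendsto_upperbound) (auto intro!: eventually_finite_subsets_at_top_weakI assms)
next
  case False
  have "0 \<le> B" using assms[of "{}"] by simp
  then show ?thesis using False by (simp add: infsum_not_exists)
qed

lemma borel_measurable_lebesgue_on_AE:
  fixes f g :: "real \<Rightarrow> 'b::euclidean_space"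
  assumes "S \<in> sets lebesgue" and f: "f \<in> borel_measurable (lebesgue_on S)"
    and ae: "AE s in lebesgue_on S. f s = g s"
  shows "g \<in> borel_measurable (lebesgue_on S)"
proof -
  have "(\<lambda>x. if x \<in> S then f x else 0) \<in> borel_measurable lebesgue"
    using assms by (simp add: borel_measurable_if)
  moreover have "AE s in lebesgue. (if s \<in> S then f s else 0) = (if s \<in> S then g s else 0)"
    using ae assms(1) by (auto simp: AE_restrict_space_iff elim!: eventually_mono)
  ultimately have "(\<lambda>x. if x \<in> S then g x else 0) \<in> borel_measurable lebesgue"
    by (rule borel_measurable_AE)
  then show ?thesis using assms by (simp add: borel_measurable_if)
qed

text \<open>Almost everywhere the sum is the limit of partial sums along an enumeration of the index set;
  the exceptional null set is harmless because Lebesgue measure is complete.\<close>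

lemma borel_measurable_infsum_AE:
  fixes f :: "'a \<Rightarrow> real \<Rightarrow> 'b::euclidean_space"
  assumes S: "S \<in> sets lebesgue" and A: "countable A"
    and f: "\<And>x. x \<in> A \<Longrightarrow> f x \<in> borel_measurable (lebesgue_on S)"
    and fin: "AE s in lebesgue_on S. (\<lambda>x. f x s) summable_on A"
  shows "(\<lambda>s. \<Sum>\<^sub>\<infinity>x\<in>A. f x s) \<in> borel_measurable (lebesgue_on S)"
proof (cases "finite A")
  case False
  define g where "g = (\<lambda>s. lim (\<lambda>N. \<Sum>n<N. f (from_nat_into A n) s))"
  have m: "f (from_nat_into A n) \<in> borel_measurable (lebesgue_on S)" for n
    using False by (intro f from_nat_into) auto
  have "g \<in> borel_measurable (lebesgue_on S)"
    unfolding g_def by (intro borel_measurable_lim_metric borel_measurable_sum m)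
  moreover have "AE s in lebesgue_on S. g s = (\<Sum>\<^sub>\<infinity>x\<in>A. f x s)"
    using fin
  proof (rule eventually_mono)
    fix s assume "(\<lambda>x. f x s) summable_on A"
    from sums_from_nat_into_infsum[OF A False this]
    show "g s = (\<Sum>\<^sub>\<infinity>x\<in>A. f x s)" unfolding g_def sums_def by (rule limI)
  qed
  ultimately show ?thesis using S by (rule borel_measurable_lebesgue_on_AE[rotated])
qed (use f in auto)

section \<open>Generations of edges in a rooted directed tree\<close>

lemma parent_edge_unique:
  assumes "single_valued (E\<inverse>)" and "k \<in> E" "k' \<in> E" "snd k = snd k'"
  shows "k = k'"
  using assms by (cases k; cases k') (auto simp: single_valued_def)

text \<open>An edge has at most one parent, so the sum that defines the matrix power has at most one
  nonzero term, and the powers record reachability.\<close>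

lemma adj_pow_values:
  assumes up: "single_valued (E\<inverse>)"
  shows "adj_pow E n i j \<in> {0, 1}"
    and "adj_pow E (Suc n) i j \<noteq> 0 \<longleftrightarrow>
      j \<in> E \<and> (\<exists>k\<in>E. adj_pow E n i k \<noteq> 0 \<and> snd k = fst j)"
proof -
  have *: "adj_pow E (Suc n) i j =
      (if j \<in> E \<and> (\<exists>k\<in>E. adj_pow E n i k \<noteq> 0 \<and> snd k = fst j) then 1 else 0)"
    if v: "\<And>k. adj_pow E n i k \<in> {0, 1}" for n j
  proof (cases "j \<in> E \<and> (\<exists>k\<in>E. adj_pow E n i k \<noteq> 0 \<and> snd k = fst j)")
    case True
    then obtain k where k: "k \<in> E" "adj_pow E n i k \<noteq> 0" "snd k = fst j" and j: "j \<in> E" by blast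
    have zero: "adj E k' j = 0" if "k' \<noteq> k" for k'
      using parent_edge_unique[OF up, of k' k] k that by (auto simp: adj_def)
    have "adj_pow E (Suc n) i j = (\<Sum>\<^sub>\<infinity>k'\<in>{k}. adj_pow E n i k' * adj E k' j)"
      unfolding adj_pow.simps
      by (rule infsum_cong_neutral) (use k zero in auto)
    also have "\<dots> = adj_pow E n i k" using k j by (simp add: adj_def)
    also have "\<dots> = 1" using v[of k] k by auto
    finally show ?thesis using True by simp
  next
    case False
    have "adj_pow E (Suc n) i j = 0"
      unfolding adj_pow.simps by (rule infsum_0) (use False in \<open>auto simp: adj_def\<close>)
    with False show ?thesis by simp
  qed
  have v: "adj_pow E n i j \<in> {0, 1}" for n j
  proof (induction n arbitrary: j)
    case (Suc n)
    have "adj_pow E (Suc n) i j \<in> {0, 1}" unfolding *[OF Suc] by simp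
    then show ?case .
  qed simp
  show "adj_pow E n i j \<in> {0, 1}" by (rule v)
  show "adj_pow E (Suc n) i j \<noteq> 0 \<longleftrightarrow>
      j \<in> E \<and> (\<exists>k\<in>E. adj_pow E n i k \<noteq> 0 \<and> snd k = fst j)"
    unfolding *[OF v] by simp
qed

text \<open>The consequences of the tree axioms that the dynamics depends on: an edge is entered by at
  most one edge, and, the tree being rooted, has only finitely many ancestors.\<close>

locale rooted_edges =
  fixes E :: "('v \<times> 'v) set"
  assumes countable_edges: "countable E"
    and unique_parent: "single_valued (E\<inverse>)"
    and finite_depth: "j \<in> E \<Longrightarrow> \<exists>d. \<forall>n i. j \<in> reach E n i \<longrightarrow> i \<in> E \<longrightarrow> n \<le> d"
begin

lemma reach_subset: "reach E n i \<subseteq> E"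
  by (auto simp: reach_def)

lemma countable_reach: "countable (reach E n i)"
  using countable_edges reach_subset by (rule countable_subset[rotated])

lemma reach_0: "i \<in> E \<Longrightarrow> reach E 0 i = {i}"
  by (auto simp: reach_def)

lemma reach_Suc: "j \<in> reach E (Suc n) i \<longleftrightarrow> j \<in> E \<and> (\<exists>k\<in>reach E n i. snd k = fst j)"
  using adj_pow_values(2)[OF unique_parent, of n i j]
  unfolding reach_def mem_Collect_eq by blast

lemma adj_pow_reach: "j \<in> reach E n i \<Longrightarrow> adj_pow E n i j = 1"
  using adj_pow_values(1)[OF unique_parent, of n i j] by (auto simp: reach_def)

lemma reach_unique:
  "i \<in> E \<Longrightarrow> i' \<in> E \<Longrightarrow> j \<in> reach E n i \<Longrightarrow> j \<in> reach E n i' \<Longrightarrow> i = i'"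
proof (induction n arbitrary: j)
  case (Suc n)
  then obtain k k' where k: "k \<in> reach E n i" "k' \<in> reach E n i'" "snd k = fst j" "snd k' = fst j"
    unfolding reach_Suc by blast
  then have "k \<in> E" "k' \<in> E" using reach_subset by blast+
  with k have "k = k'" by (intro parent_edge_unique[OF unique_parent]) auto
  with k Suc show ?case by blast
qed (simp add: reach_0)

lemma left_translation_eq:
  "left_translation E t f i s = (\<Sum>\<^sub>\<infinity>j\<in>reach E (steps t s) i. f j (t + s - real (steps t s)))"
  unfolding left_translation_def by (rule infsum_cong) (simp add: adj_pow_reach)

abbreviation shift :: "nat \<Rightarrow> ('v, 'k::{real_normed_field,euclidean_space}) tree_fun \<Rightarrow> ('v, 'k) tree_fun" where
  "shift n \<equiv> left_translation E (real n)"

lemma steps_nat: "s \<in> {0..<1} \<Longrightarrow> steps (real n) s = n"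
proof -
  assume "s \<in> {0..<1}"
  then have "\<lfloor>s + real n\<rfloor> = int n" by (intro floor_unique) auto
  then show ?thesis by (simp add: steps_def)
qed

lemma left_translation_nat:
  "s \<in> {0..<1} \<Longrightarrow> shift n f i s = (\<Sum>\<^sub>\<infinity>j\<in>reach E n i. f j s)"
  by (simp add: left_translation_eq steps_nat)

lemma finite_set_depth:
  assumes "finite F" "F \<subseteq> E"
  obtains d where "\<And>n i j. i \<in> E \<Longrightarrow> j \<in> F \<Longrightarrow> j \<in> reach E n i \<Longrightarrow> n \<le> d"
proof -
  have "\<forall>j\<in>F. \<exists>d. \<forall>n i. j \<in> reach E n i \<longrightarrow> i \<in> E \<longrightarrow> n \<le> d" using finite_depth assms by blast
  then obtain d where d: "\<And>j n i. j \<in> F \<Longrightarrow> j \<in> reach E n i \<Longrightarrow> i \<in> E \<Longrightarrow> n \<le> d j" by metis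
  show ?thesis
  proof (rule that)
    fix n i j assume "i \<in> E" "j \<in> F" "j \<in> reach E n i"
    then have "n \<le> d j" using d by blast
    also have "\<dots> \<le> Max (d ` F)" using \<open>j \<in> F\<close> assms by simp
    finally show "n \<le> Max (d ` F)" .
  qed
qed

end

text \<open>Connectedness ignores orientation, but every path that starts at the root can be straightened:
  a step against the orientation leads to the unique parent, which is the vertex visited before.
  The depth of an edge is then the length of the directed path from the root to its tail, because
  any other directed path to this tail is a final segment of that path.\<close>

lemma directed_tree_rooted_edges:
  assumes "directed_tree V E" and "rooted V E"
  shows "rooted_edges E"
proof
  have cV: "countable V" and sub: "E \<subseteq> V \<times> V"
    and conn: "\<And>v w. v \<in> V \<Longrightarrow> w \<in> V \<Longrightarrow> (v, w) \<in> (E \<union> E\<inverse>)\<^sup>*"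
    and up: "\<And>u v w. (u, w) \<in> E \<Longrightarrow> (v, w) \<in> E \<Longrightarrow> u = v"
    using assms(1) unfolding directed_tree_def by blast+
  show "countable E" using countable_subset[OF sub] cV by blast
  show sv: "single_valued (E\<inverse>)" using up by (auto intro!: single_valuedI)
  obtain r where r: "r \<in> V" and root: "\<And>u. (u, r) \<notin> E"
    using assms(2) unfolding rooted_def by blast
  have from_root: "(r, v) \<in> E\<^sup>*" if "(r, v) \<in> (E \<union> E\<inverse>)\<^sup>*" for v
    using that
  proof (induction rule: rtrancl_induct)
    case (step v w)
    show ?case
    proof (cases "(v, w) \<in> E")
      case True
      with step show ?thesis by auto
    next
      case False
      with step have wv: "(w, v) \<in> E" by auto
      from step.IH show ?thesis
      proof (cases rule: rtranclE)
        case base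
        with wv root show ?thesis by auto
      next
        case (step u)
        with up[OF wv] show ?thesis by auto
      qed
    qed
  qed simp
  have depth: "n \<le> d" if "(r, v) \<in> E ^^ d" "(u, v) \<in> E ^^ n" for n d u v
    using that
  proof (induction d arbitrary: n v)
    case 0
    show ?case
    proof (cases n)
      case (Suc m)
      with 0 root show ?thesis by auto
    qed simp
  next
    case (Suc d)
    show ?case
    proof (cases n)
      case (Suc m)
      with Suc.prems obtain x y where "(r, x) \<in> E ^^ d" "(x, v) \<in> E" "(u, y) \<in> E ^^ m" "(y, v) \<in> E"
        by auto
      with up[of x v y] Suc.IH[of x m] Suc show ?thesis by auto
    qed simp
  qed
  fix j assume j: "j \<in> E"
  then have "fst j \<in> V" using sub by auto
  with r conn from_root have "(r, fst j) \<in> E\<^sup>*" by blast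
  then obtain d where d: "(r, fst j) \<in> E ^^ d" by (auto simp: rtrancl_power)
  have path: "(fst i, fst j) \<in> E ^^ n" if "adj_pow E n i j \<noteq> 0" for n i j
    using that
  proof (induction n arbitrary: j)
    case (Suc n)
    then obtain k where "k \<in> E" "adj_pow E n i k \<noteq> 0" "snd k = fst j"
      using adj_pow_values(2)[OF sv, of n i j] by blast
    moreover from this have "(fst k, fst j) \<in> E" by (cases k) auto
    ultimately show ?case using Suc.IH[of k] by (intro relpow_Suc_I)
  qed (simp split: if_splits)
  show "\<exists>d. \<forall>n i. j \<in> reach E n i \<longrightarrow> i \<in> E \<longrightarrow> n \<le> d"
    using depth[OF d path] unfolding reach_def by blast
qed

section \<open>The weighted space as a metric space\<close>

abbreviation unit_leb :: "real measure" where
  "unit_leb \<equiv> lebesgue_on {0..<1}"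

lemma AE_unit_leb_all: "(\<And>s. s \<in> {0..<1} \<Longrightarrow> P s) \<Longrightarrow> AE s in unit_leb. P s"
  by (rule AE_I2) simp

text \<open>Convexity extends from the open half-line to the endpoint 0 because \<open>u powr p \<le> u\<close> for
  \<open>0 < u < 1\<close>.\<close>

lemma powr_convex_nonneg:
  assumes "p \<ge> 1"
  shows "convex_on {0..} (\<lambda>x::real. x powr p)"
proof (rule convex_onI)
  fix t x y :: real
  assume t: "0 < t" "t < 1" and xy: "x \<in> {0..}" "y \<in> {0..}"
  have scale: "(u * z) powr p \<le> u * z powr p" if "0 < u" "u < 1" "0 \<le> z" for u z :: real
  proof -
    have "u powr p \<le> u powr 1" using that assms by (intro powr_mono') auto
    then show ?thesis using that by (simp add: powr_mult mult_right_mono)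
  qed
  show "((1 - t) *\<^sub>R x + t *\<^sub>R y) powr p \<le> (1 - t) * x powr p + t * y powr p"
  proof (cases "x = 0 \<or> y = 0")
    case True
    then show ?thesis using scale[of t y] scale[of "1 - t" x] t xy by auto
  next
    case False
    then show ?thesis
      using convex_onD[OF powr_convex[OF assms], of t x y] t xy by simp
  qed
qed simp

text \<open>The bound is linear in \<open>x powr p\<close> and \<open>y powr p\<close>, so that it can be integrated; this is what
  proves Minkowski's inequality below.\<close>

lemma powr_sum_convexity:
  fixes x y a b p :: real
  assumes "p \<ge> 1" "a > 0" "b > 0" "x \<ge> 0" "y \<ge> 0"
  shows "(x + y) powr p \<le>
    (a + b) powr p * (a / (a + b) / a powr p) * x powr p
    + (a + b) powr p * (b / (a + b) / b powr p) * y powr p"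
proof -
  let ?t = "b / (a + b)"
  have t: "0 \<le> ?t" "?t \<le> 1" "1 - ?t = a / (a + b)" using assms by (auto simp: field_simps)
  have "(x + y) = (a + b) * ((1 - ?t) * (x / a) + ?t * (y / b))"
  proof -
    have "(a + b) * ((1 - ?t) * (x / a) + ?t * (y / b)) = ((a + b) * (a / (a + b)) / a) * x + ((a + b) * ?t / b) * y"
      unfolding t(3) by (simp add: distrib_left)
    then show ?thesis using assms by simp
  qed
  then have "(x + y) powr p = (a + b) powr p * ((1 - ?t) * (x / a) + ?t * (y / b)) powr p"
    using assms t by (metis powr_mult)
  also have "\<dots> \<le> (a + b) powr p * ((1 - ?t) * (x / a) powr p + ?t * (y / b) powr p)"
    using convex_onD[OF powr_convex_nonneg[OF assms(1)], of ?t "x / a" "y / b"] assms t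
    by (intro mult_left_mono) auto
  also have "\<dots> = (a + b) powr p * (a / (a + b) / a powr p) * x powr p
    + (a + b) powr p * (b / (a + b) / b powr p) * y powr p"
    unfolding t(3) using assms by (simp add: powr_divide algebra_simps)
  finally show ?thesis .
qed

lemma powr_add_le:
  fixes x y p :: real
  assumes "p \<ge> 1" "x \<ge> 0" "y \<ge> 0"
  shows "(x + y) powr p \<le> 2 powr p * x powr p + 2 powr p * y powr p"
proof -
  have "(x + y) powr p \<le> 2 powr p * (1 / 2) * x powr p + 2 powr p * (1 / 2) * y powr p"
    using powr_sum_convexity[of p 1 1 x y] assms by simp
  also have "\<dots> \<le> 2 powr p * x powr p + 2 powr p * y powr p"
    by (intro add_mono mult_right_mono) auto
  finally show ?thesis .
qed

locale Lp_weight =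
  fixes E :: "('v \<times> 'v) set" and p :: real and \<rho> :: "('v, real) tree_fun"
  assumes count: "countable E" and p_ge_1: "p \<ge> 1"
    and weight_measurable: "i \<in> E \<Longrightarrow> \<rho> i \<in> borel_measurable unit_leb"
    and weight_finite: "i \<in> E \<Longrightarrow> (\<integral>\<^sup>+s. ennreal (\<rho> i s) \<partial>unit_leb) < \<infinity>"
    and weight_pos: "i \<in> E \<Longrightarrow> s \<in> {0..<1} \<Longrightarrow> \<rho> i s > 0"
begin

definition edge_measurable :: "('v, 'k::{real_normed_field,euclidean_space}) tree_fun \<Rightarrow> bool" where
  "edge_measurable f \<longleftrightarrow> (\<forall>i\<in>E. f i \<in> borel_measurable unit_leb)"

abbreviation mass :: "('v, 'k::{real_normed_field,euclidean_space}) tree_fun \<Rightarrow> ennreal" where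
  "mass \<equiv> Lp_mass E \<rho> p"

abbreviation edge_mass :: "(real \<Rightarrow> 'k::{real_normed_field,euclidean_space}) \<Rightarrow> 'v \<times> 'v \<Rightarrow> ennreal" where
  "edge_mass h i \<equiv> \<integral>\<^sup>+ s. ennreal (norm (h s) powr p * \<rho> i s) \<partial>unit_leb"

abbreviation LP :: "('v, 'k::{real_normed_field,euclidean_space}) tree_fun set" where
  "LP \<equiv> Lp_fun E \<rho> p"

lemma p_pos: "p > 0" using p_ge_1 by simp

lemma Lp_fun_iff: "f \<in> LP \<longleftrightarrow> edge_measurable f \<and> mass f < \<infinity>"
  by (simp add: Lp_fun_def edge_measurable_def)

lemma edge_measurableD: "edge_measurable f \<Longrightarrow> i \<in> E \<Longrightarrow> f i \<in> borel_measurable unit_leb"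
  by (simp add: edge_measurable_def)

lemma edge_integrand_measurable:
  assumes "i \<in> E" "f \<in> borel_measurable unit_leb"
  shows "(\<lambda>s. ennreal (norm (f s) powr p * \<rho> i s)) \<in> borel_measurable unit_leb"
  using assms(2) weight_measurable[OF assms(1)] by measurable

lemma integrand_measurable:
  assumes "edge_measurable f" "i \<in> E"
  shows "(\<lambda>s. ennreal (norm (f i s) powr p * \<rho> i s)) \<in> borel_measurable unit_leb"
  by (rule edge_integrand_measurable[OF assms(2) edge_measurableD[OF assms]])

lemma edge_measurable_add:
  "edge_measurable f \<Longrightarrow> edge_measurable g \<Longrightarrow> edge_measurable (\<lambda>i s. f i s + g i s)"
  unfolding edge_measurable_def by (blast intro: borel_measurable_add)

lemma edge_mass_le_combination:
  assumes i: "i \<in> E" and m: "f \<in> borel_measurable unit_leb" "g \<in> borel_measurable unit_leb"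
    and ab: "a \<ge> 0" "b \<ge> 0"
    and le: "\<And>s. s \<in> {0..<1} \<Longrightarrow> norm (h s) powr p \<le> a * norm (f s) powr p + b * norm (g s) powr p"
  shows "edge_mass h i \<le> ennreal a * edge_mass f i + ennreal b * edge_mass g i"
proof -
  have "edge_mass h i \<le>
    (\<integral>\<^sup>+ s. ennreal a * ennreal (norm (f s) powr p * \<rho> i s)
        + ennreal b * ennreal (norm (g s) powr p * \<rho> i s) \<partial>unit_leb)"
  proof (rule nn_integral_mono)
    fix s assume "s \<in> space unit_leb"
    then have s: "s \<in> {0..<1}" by simp
    have r: "\<rho> i s \<ge> 0" using weight_pos[OF i s] by simp
    have "norm (h s) powr p * \<rho> i s \<le>
        a * (norm (f s) powr p * \<rho> i s) + b * (norm (g s) powr p * \<rho> i s)"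
      using mult_right_mono[OF le[OF s] r] by (simp add: algebra_simps)
    then have "ennreal (norm (h s) powr p * \<rho> i s) \<le>
        ennreal (a * (norm (f s) powr p * \<rho> i s) + b * (norm (g s) powr p * \<rho> i s))"
      by (rule ennreal_leI)
    also have "\<dots> = ennreal a * ennreal (norm (f s) powr p * \<rho> i s)
        + ennreal b * ennreal (norm (g s) powr p * \<rho> i s)"
      using ab r by (simp add: ennreal_plus ennreal_mult)
    finally show "ennreal (norm (h s) powr p * \<rho> i s) \<le> \<dots>" .
  qed
  also have "\<dots> = ennreal a * edge_mass f i + ennreal b * edge_mass g i"
    using edge_integrand_measurable[OF i m(1)] edge_integrand_measurable[OF i m(2)]
    by (simp add: nn_integral_add nn_integral_cmult)
  finally show ?thesis .
qed

text \<open>The norm estimates that follow are integrated forms of pointwise inequalities of this shape.\<close>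

lemma mass_le_combination:
  assumes m: "edge_measurable f" "edge_measurable g" and ab: "a \<ge> 0" "b \<ge> 0"
    and le: "\<And>i s. i \<in> E \<Longrightarrow> s \<in> {0..<1} \<Longrightarrow>
      norm (h i s) powr p \<le> a * norm (f i s) powr p + b * norm (g i s) powr p"
  shows "mass h \<le> ennreal a * mass f + ennreal b * mass g"
proof -
  have "mass h \<le> (\<Sum>\<^sub>\<infinity>i\<in>E. ennreal a * edge_mass (f i) i + ennreal b * edge_mass (g i) i)"
    unfolding Lp_mass_def
    by (intro infsum_ennreal_mono edge_mass_le_combination edge_measurableD m ab le)
  also have "\<dots> = ennreal a * mass f + ennreal b * mass g"
    unfolding Lp_mass_def by (simp add: infsum_add infsum_ennreal_cmult)
  finally show ?thesis .
qed

lemma mass_zero [simp]: "mass (\<lambda>i s. 0) = 0"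
  using p_pos by (simp add: Lp_mass_def)

lemma mass_cong_AE:
  assumes "\<And>i. i \<in> E \<Longrightarrow> AE s in unit_leb. f i s = g i s"
  shows "mass f = mass g"
  unfolding Lp_mass_def
proof (intro infsum_cong nn_integral_cong_AE)
  fix i assume "i \<in> E"
  from assms[OF this] show "AE s in unit_leb. ennreal (norm (f i s) powr p * \<rho> i s) =
      ennreal (norm (g i s) powr p * \<rho> i s)" by eventually_elim simp
qed

lemma mass_add_le:
  assumes "edge_measurable f" "edge_measurable g"
  shows "mass (\<lambda>i s. f i s + g i s) \<le> ennreal (2 powr p) * mass f + ennreal (2 powr p) * mass g"
proof (rule mass_le_combination[OF assms])
  fix i s
  have "norm (f i s + g i s) powr p \<le> (norm (f i s) + norm (g i s)) powr p"
    using p_pos by (intro powr_mono2 norm_triangle_ineq) auto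
  also have "\<dots> \<le> 2 powr p * norm (f i s) powr p + 2 powr p * norm (g i s) powr p"
    by (intro powr_add_le p_ge_1) auto
  finally show "norm (f i s + g i s) powr p \<le> 2 powr p * norm (f i s) powr p + 2 powr p * norm (g i s) powr p" .
qed auto

text \<open>Minkowski's inequality. Convexity of \<open>x powr p\<close> is applied to the convex combination of
  \<open>f / a\<close> and \<open>g / b\<close> with weights \<open>a / (a + b)\<close> and \<open>b / (a + b)\<close>.\<close>

lemma mass_minkowski:
  assumes m: "edge_measurable f" "edge_measurable g" and ab: "a > 0" "b > 0"
    and le: "mass f \<le> ennreal (a powr p)" "mass g \<le> ennreal (b powr p)"
  shows "mass (\<lambda>i s. f i s + g i s) \<le> ennreal ((a + b) powr p)"
proof -
  let ?A = "(a + b) powr p * (a / (a + b) / a powr p)"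
  let ?B = "(a + b) powr p * (b / (a + b) / b powr p)"
  have "mass (\<lambda>i s. f i s + g i s) \<le> ennreal ?A * mass f + ennreal ?B * mass g"
  proof (rule mass_le_combination[OF m])
    fix i s
    have "norm (f i s + g i s) powr p \<le> (norm (f i s) + norm (g i s)) powr p"
      using p_pos by (intro powr_mono2 norm_triangle_ineq) auto
    also have "\<dots> \<le> ?A * norm (f i s) powr p + ?B * norm (g i s) powr p"
      by (intro powr_sum_convexity p_ge_1 ab) auto
    finally show "norm (f i s + g i s) powr p \<le> ?A * norm (f i s) powr p + ?B * norm (g i s) powr p" .
  qed (use ab in auto)
  also have "\<dots> \<le> ennreal ?A * ennreal (a powr p) + ennreal ?B * ennreal (b powr p)"
    by (intro add_mono mult_left_mono le) auto
  also have "\<dots> = ennreal (?A * a powr p + ?B * b powr p)"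
    using ab by (subst ennreal_plus) (auto simp: ennreal_mult[symmetric])
  also have "?A * a powr p + ?B * b powr p = (a + b) powr p * (a / (a + b) + b / (a + b))"
    using ab by (simp add: distrib_left)
  also have "\<dots> = (a + b) powr p"
    using ab by (simp add: add_divide_distrib[symmetric])
  finally show ?thesis .
qed

lemma Lp_norm_nonneg: "Lp_norm E \<rho> p f \<ge> 0"
  by (simp add: Lp_norm_def)

lemma mass_eq_norm:
  assumes "mass f < \<infinity>"
  shows "mass f = ennreal (Lp_norm E \<rho> p f powr p)"
proof -
  obtain m where m: "mass f = ennreal m" "m \<ge> 0" using assms by (cases "mass f") auto
  then show ?thesis using p_pos by (simp add: Lp_norm_def powr_powr)
qed

lemma Lp_norm_le:
  assumes "mass f \<le> ennreal (a powr p)" "a \<ge> 0"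
  shows "Lp_norm E \<rho> p f \<le> a"
proof -
  have "mass f < \<infinity>" using assms by (auto intro: le_less_trans)
  then have "Lp_norm E \<rho> p f powr p \<le> a powr p"
    using mass_eq_norm[of f] assms by (metis ennreal_le_iff powr_ge_zero)
  then show ?thesis using assms p_pos by (metis linorder_not_less powr_less_mono2 Lp_norm_nonneg)
qed

lemma mass_le_of_norm:
  assumes "mass f < \<infinity>" "Lp_norm E \<rho> p f \<le> a"
  shows "mass f \<le> ennreal (a powr p)"
  using assms p_pos by (subst mass_eq_norm) (auto intro!: ennreal_leI powr_mono2 Lp_norm_nonneg)

lemma Lp_norm_triangle:
  assumes "f \<in> LP" "g \<in> LP"
  shows "Lp_norm E \<rho> p (\<lambda>i s. f i s + g i s) \<le> Lp_norm E \<rho> p f + Lp_norm E \<rho> p g"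
proof (rule field_le_epsilon)
  fix e :: real assume e: "e > 0"
  \<comment> \<open>The slack keeps the two radii positive even if a norm vanishes.\<close>
  let ?a = "Lp_norm E \<rho> p f + e / 2" and ?b = "Lp_norm E \<rho> p g + e / 2"
  have "?a > 0" "?b > 0" using e Lp_norm_nonneg[of f] Lp_norm_nonneg[of g] by linarith+
  then have "mass (\<lambda>i s. f i s + g i s) \<le> ennreal ((?a + ?b) powr p)"
    using assms e by (intro mass_minkowski mass_le_of_norm) (auto simp: Lp_fun_iff)
  then have "Lp_norm E \<rho> p (\<lambda>i s. f i s + g i s) \<le> ?a + ?b"
    using \<open>?a > 0\<close> \<open>?b > 0\<close> by (intro Lp_norm_le) auto
  then show "Lp_norm E \<rho> p (\<lambda>i s. f i s + g i s) \<le> Lp_norm E \<rho> p f + Lp_norm E \<rho> p g + e" by simp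
qed

lemma Lp_fun_add:
  assumes "f \<in> LP" "g \<in> LP"
  shows "(\<lambda>i s. f i s + g i s) \<in> LP"
proof -
  have "mass (\<lambda>i s. f i s + g i s) \<le> ennreal (2 powr p) * mass f + ennreal (2 powr p) * mass g"
    using assms by (intro mass_add_le) (auto simp: Lp_fun_iff)
  also have "\<dots> < \<infinity>" using assms by (auto simp: Lp_fun_iff ennreal_mult_less_top)
  finally show ?thesis using assms by (auto simp: Lp_fun_iff edge_measurable_add)
qed

lemma mass_uminus: "mass (\<lambda>i s. - f i s) = mass f"
  by (simp add: Lp_mass_def)

lemma Lp_fun_diff:
  assumes "f \<in> LP" "g \<in> LP"
  shows "(\<lambda>i s. f i s - g i s) \<in> LP"
proof -
  have "(\<lambda>i s. - g i s) \<in> LP"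
    using assms(2) by (simp add: Lp_fun_iff mass_uminus edge_measurable_def)
  from Lp_fun_add[OF assms(1) this] show ?thesis by simp
qed

lemma Lp_fun_cong_AE:
  assumes "f \<in> LP" and ae: "\<And>i. i \<in> E \<Longrightarrow> AE s in unit_leb. f i s = g i s"
  shows "g \<in> LP"
proof -
  have "g i \<in> borel_measurable unit_leb" if "i \<in> E" for i
    using assms that by (intro borel_measurable_lebesgue_on_AE[OF _ _ ae]) (auto simp: Lp_fun_def)
  then show ?thesis
    using assms(1) mass_cong_AE[of f g] ae by (auto simp: Lp_fun_def)
qed

lemma mass_eq_0_iff:
  assumes m: "edge_measurable f"
  shows "mass f = 0 \<longleftrightarrow> (\<forall>i\<in>E. AE s in unit_leb. f i s = 0)"
proof -
  have edge: "edge_mass (f i) i = 0 \<longleftrightarrow>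
      (AE s in unit_leb. f i s = 0)" if i: "i \<in> E" for i
  proof -
    have "ennreal (norm (f i s) powr p * \<rho> i s) = 0 \<longleftrightarrow> f i s = 0" if "s \<in> {0..<1}" for s
    proof -
      have "ennreal (norm (f i s) powr p * \<rho> i s) = 0 \<longleftrightarrow> norm (f i s) powr p * \<rho> i s \<le> 0"
        by (rule ennreal_eq_0_iff)
      also have "\<dots> \<longleftrightarrow> f i s = 0"
        using weight_pos[OF i that] by (auto simp: mult_le_0_iff not_le)
      finally show ?thesis .
    qed
    then show ?thesis
      using integrand_measurable[OF m i]
      by (subst nn_integral_0_iff_AE) (auto intro!: AE_cong)
  qed
  show ?thesis
  proof
    assume "mass f = 0"
    then have "edge_mass (f i) i = 0" if "i \<in> E" for i
      using member_le_infsum_ennreal[OF that, of "\<lambda>i. edge_mass (f i) i"]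
      by (simp add: Lp_mass_def)
    then show "\<forall>i\<in>E. AE s in unit_leb. f i s = 0" using edge by blast
  next
    assume "\<forall>i\<in>E. AE s in unit_leb. f i s = 0"
    then show "mass f = 0" unfolding Lp_mass_def using edge by (intro infsum_0) blast
  qed
qed

lemma equiv_Lp_ae: "equiv (LP) (Lp_ae E \<rho> p)"
proof (rule equivI)
  show "Lp_ae E \<rho> p \<subseteq> LP \<times> LP" by (auto simp: Lp_ae_def)
  show "refl_on (LP) (Lp_ae E \<rho> p)" by (auto simp: refl_on_def Lp_ae_def)
  show "sym (Lp_ae E \<rho> p)" by (auto simp: sym_def Lp_ae_def eq_commute)
  show "trans (Lp_ae E \<rho> p)"
  proof (rule transI)
    fix f g h assume "(f, g) \<in> Lp_ae E \<rho> p" "(g, h) \<in> Lp_ae E \<rho> p"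
    then have fgh: "f \<in> LP" "h \<in> LP"
      and ae: "\<And>i. i \<in> E \<Longrightarrow> AE s in unit_leb. f i s = g i s"
        "\<And>i. i \<in> E \<Longrightarrow> AE s in unit_leb. g i s = h i s"
      by (auto simp: Lp_ae_def)
    have "AE s in unit_leb. f i s = h i s" if "i \<in> E" for i
      using ae(1)[OF that] ae(2)[OF that] by eventually_elim simp
    with fgh show "(f, h) \<in> Lp_ae E \<rho> p" by (auto simp: Lp_ae_def)
  qed
qed

abbreviation Lp_ball ::
  "('v, 'k::{real_normed_field,euclidean_space}) tree_fun set \<Rightarrow> real \<Rightarrow> ('v, 'k) tree_fun set set" where
  "Lp_ball \<equiv> Metric_space.mball (Lp_space E \<rho> p) (Lp_dist E \<rho> p)"

definition cls :: "('v, 'k::{real_normed_field,euclidean_space}) tree_fun \<Rightarrow> ('v, 'k) tree_fun set" where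
  "cls f = Lp_ae E \<rho> p `` {f}"

lemma cls_in_space: "f \<in> LP \<Longrightarrow> cls f \<in> Lp_space E \<rho> p"
  unfolding cls_def Lp_space_def by (rule quotientI)

lemma space_cls:
  assumes "F \<in> Lp_space E \<rho> p" obtains f where "f \<in> LP" "F = cls f"
  using assms unfolding Lp_space_def cls_def by (elim quotientE)

lemma in_cls_iff:
  "g \<in> cls f \<longleftrightarrow> f \<in> LP \<and> g \<in> LP \<and> (\<forall>i\<in>E. AE s in unit_leb. f i s = g i s)"
  by (auto simp: cls_def Lp_ae_def)

lemma cls_eq_iff:
  assumes "f \<in> LP" "g \<in> LP"
  shows "cls f = cls g \<longleftrightarrow> (\<forall>i\<in>E. AE s in unit_leb. f i s = g i s)"
  unfolding cls_def using eq_equiv_class_iff[OF equiv_Lp_ae assms] assms by (auto simp: Lp_ae_def)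

lemma Lp_dist_cls:
  assumes "f \<in> LP" "g \<in> LP"
  shows "Lp_dist E \<rho> p (cls f) (cls g) = Lp_norm E \<rho> p (\<lambda>i s. f i s - g i s)"
proof -
  have "f \<in> cls f" "g \<in> cls g" using assms by (auto simp: in_cls_iff)
  then have "(SOME f'. f' \<in> cls f) \<in> cls f" "(SOME g'. g' \<in> cls g) \<in> cls g"
    by (metis someI)+
  then have ae: "AE s in unit_leb. f i s = (SOME f'. f' \<in> cls f) i s"
      "AE s in unit_leb. g i s = (SOME g'. g' \<in> cls g) i s" if "i \<in> E" for i
    using that unfolding in_cls_iff by blast+
  have "mass (\<lambda>i s. f i s - g i s) = mass (\<lambda>i s. (SOME f'. f' \<in> cls f) i s - (SOME g'. g' \<in> cls g) i s)"
  proof (rule mass_cong_AE)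
    fix i assume "i \<in> E"
    from ae(1)[OF this] ae(2)[OF this]
    show "AE s in unit_leb. f i s - g i s = (SOME f'. f' \<in> cls f) i s - (SOME g'. g' \<in> cls g) i s"
      by eventually_elim simp
  qed
  then show ?thesis by (simp add: Lp_dist_def Lp_norm_def)
qed

lemma Metric_space_Lp:
  "Metric_space (Lp_space E \<rho> p :: ('v, 'k::{real_normed_field,euclidean_space}) tree_fun set set) (Lp_dist E \<rho> p)"
proof
  show "0 \<le> Lp_dist E \<rho> p F G" for F G :: "('v, 'k) tree_fun set"
    by (simp add: Lp_dist_def Lp_norm_nonneg)
  show "Lp_dist E \<rho> p F G = Lp_dist E \<rho> p G F" for F G :: "('v, 'k) tree_fun set"
    by (simp add: Lp_dist_def Lp_norm_def Lp_mass_def norm_minus_commute)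
  fix F G H :: "('v, 'k) tree_fun set"
  assume "F \<in> Lp_space E \<rho> p" "G \<in> Lp_space E \<rho> p"
  then obtain f g where fg: "f \<in> LP" "F = cls f" "g \<in> LP" "G = cls g"
    by (metis space_cls)
  have d: "(\<lambda>i s. f i s - g i s) \<in> LP" using fg by (intro Lp_fun_diff)
  have "Lp_dist E \<rho> p F G = 0 \<longleftrightarrow> mass (\<lambda>i s. f i s - g i s) = 0"
    using fg mass_eq_norm[of "\<lambda>i s. f i s - g i s"] d p_pos
    by (auto simp: Lp_dist_cls Lp_fun_iff Lp_norm_def)
  also have "\<dots> \<longleftrightarrow> (\<forall>i\<in>E. AE s in unit_leb. f i s = g i s)"
    using mass_eq_0_iff[of "\<lambda>i s. f i s - g i s"] d by (simp add: Lp_fun_iff)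
  also have "\<dots> \<longleftrightarrow> F = G" using fg by (simp add: cls_eq_iff)
  finally show "Lp_dist E \<rho> p F G = 0 \<longleftrightarrow> F = G" .
  assume "H \<in> Lp_space E \<rho> p"
  then obtain h where h: "h \<in> LP" "H = cls h" by (metis space_cls)
  show "Lp_dist E \<rho> p F H \<le> Lp_dist E \<rho> p F G + Lp_dist E \<rho> p G H"
    using Lp_norm_triangle[OF Lp_fun_diff[OF fg(1,3)] Lp_fun_diff[OF fg(3) h(1)]] fg h
    by (simp add: Lp_dist_cls)
qed

lemma Lp_dist_less_iff:
  assumes "f \<in> LP" "g \<in> LP" "e > 0"
  shows "Lp_dist E \<rho> p (cls f) (cls g) < e \<longleftrightarrow> mass (\<lambda>i s. f i s - g i s) < ennreal (e powr p)"
proof -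
  have "mass (\<lambda>i s. f i s - g i s) = ennreal (Lp_norm E \<rho> p (\<lambda>i s. f i s - g i s) powr p)"
    using Lp_fun_diff[OF assms(1,2)] by (intro mass_eq_norm) (simp add: Lp_fun_iff)
  moreover have "x powr p < e powr p \<longleftrightarrow> x < e" if "x \<ge> 0" for x
    using powr_less_mono2[of p x e] powr_mono2[of p e x] that assms(3) p_pos
    by (cases "x < e") auto
  ultimately show ?thesis
    using assms Lp_norm_nonneg[of "\<lambda>i s. f i s - g i s"]
    by (simp add: Lp_dist_cls ennreal_less_iff)
qed

end

section \<open>Density of finitely supported step functions\<close>

definition step_fun :: "nat \<Rightarrow> 'k::zero list \<Rightarrow> real \<Rightarrow> 'k" where
  "step_fun N c s = (let k = nat \<lfloor>real N * s\<rfloor> in if k < length c then c ! k else 0)"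

text \<open>For a countable set of values this is a countable family, since the grid is indexed by a single
  natural number.\<close>

definition step_funs :: "'k::zero set \<Rightarrow> (real \<Rightarrow> 'k) set" where
  "step_funs Q = (\<lambda>(N, c). step_fun N c) ` (UNIV \<times> lists Q)"

lemma step_funsI: "c \<in> lists Q \<Longrightarrow> step_fun N c \<in> step_funs Q"
  unfolding step_funs_def by (rule image_eqI[of _ _ "(N, c)"]) auto

lemma countable_step_funs: "countable Q \<Longrightarrow> countable (step_funs Q)"
  unfolding step_funs_def by (intro countable_image countable_SIGMA countable_lists) auto

lemma step_funs_measurable:
  fixes h :: "real \<Rightarrow> 'k::euclidean_space"
  assumes "h \<in> step_funs Q"
  shows "h \<in> borel_measurable unit_leb"
proof -
  obtain N c where h: "h = step_fun N c" using assms by (auto simp: step_funs_def)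
  have "(\<lambda>s. (\<lambda>k. if k < length c then c ! k else 0) (nat \<lfloor>real N * s\<rfloor>)) \<in> borel_measurable borel"
    by measurable
  then have "h \<in> borel_measurable borel" unfolding h step_fun_def Let_def .
  then have "h \<in> borel_measurable lebesgue"
    by (intro measurable_completion) simp
  then show ?thesis by (rule measurable_restrict_space1)
qed

lemma step_fun_range: "step_fun N c s \<in> insert 0 (set c)"
  by (auto simp: step_fun_def Let_def)

lemma step_funs_bounded:
  fixes h :: "real \<Rightarrow> 'k::real_normed_vector"
  assumes "h \<in> step_funs Q"
  obtains B where "\<And>s. norm (h s) \<le> B"
proof -
  obtain N c where h: "h = step_fun N c" using assms by (auto simp: step_funs_def)
  show ?thesis
  proof (rule that)
    fix s show "norm (h s) \<le> Max (norm ` insert 0 (set c))"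
      unfolding h by (rule Max_ge) (use step_fun_range in auto)
  qed
qed

text \<open>Cutting off large values stays within the family. Hence approximants of a bounded function may
  be taken uniformly bounded, which dominated convergence requires.\<close>

lemma step_funs_cutoff:
  fixes h :: "real \<Rightarrow> 'k::real_normed_vector"
  assumes "h \<in> step_funs Q" "0 \<in> Q"
  shows "(\<lambda>s. if norm (h s) \<le> B then h s else 0) \<in> step_funs Q"
proof -
  obtain N c where h: "h = step_fun N c" "c \<in> lists Q" using assms by (auto simp: step_funs_def)
  let ?c = "map (\<lambda>q. if norm q \<le> B then q else 0) c"
  have "(\<lambda>s. if norm (h s) \<le> B then h s else 0) = step_fun N ?c"
    unfolding h(1) by (auto simp: step_fun_def Let_def fun_eq_iff)
  moreover have "?c \<in> lists Q" using h assms(2) by auto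
  ultimately show ?thesis by (auto simp: step_funs_def)
qed

lemma continuous_step_approximation:
  fixes g :: "real \<Rightarrow> 'k::real_normed_vector"
  assumes g: "continuous_on UNIV g" and Q: "closure Q = UNIV"
    and e: "e > 0"
  obtains h where "h \<in> step_funs Q" "\<And>s. s \<in> {0..<1} \<Longrightarrow> dist (h s) (g s) < e"
proof -
  have "uniformly_continuous_on {0..1} g"
    by (rule compact_uniformly_continuous) (use g in \<open>auto intro: continuous_on_subset\<close>)
  then obtain d where d: "d > 0"
    "\<And>x y. x \<in> {0..1} \<Longrightarrow> y \<in> {0..1} \<Longrightarrow> dist y x < d \<Longrightarrow> dist (g y) (g x) < e / 2"
    unfolding uniformly_continuous_on_def using e half_gt_zero by metis
  obtain N where N: "N > 0" "1 / real N < d"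
    using d(1) by (metis inverse_eq_divide reals_Archimedean of_nat_0_less_iff zero_less_Suc)
  have "\<exists>q\<in>Q. dist q (g (real k / real N)) < e / 2" for k
    using closure_approachable[of "g (real k / real N)" Q] Q half_gt_zero[OF e] by blast
  then obtain q where q: "\<And>k. q k \<in> Q" "\<And>k. dist (q k) (g (real k / real N)) < e / 2"
    by metis
  show ?thesis
  proof (rule that)
    show "step_fun N (map q [0..<N]) \<in> step_funs Q" using q by (intro step_funsI) auto
    fix s :: real assume s: "s \<in> {0..<1}"
    define k where "k = nat \<lfloor>real N * s\<rfloor>"
    have Ns: "0 \<le> real N * s" "real N * s < real N" using s N by auto
    then have kN: "k < N" unfolding k_def by (simp add: nat_less_iff floor_less_iff)
    have k: "real k \<le> real N * s" "real N * s < real k + 1"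
      unfolding k_def using Ns by auto
    then have "real k / real N \<le> s" "s < real k / real N + 1 / real N"
      using N by (auto simp: field_simps)
    then have "dist (real k / real N) s < d" using N by (auto simp: dist_real_def)
    then have "dist (g (real k / real N)) (g s) < e / 2"
      using kN s by (intro d) auto
    moreover have "step_fun N (map q [0..<N]) s = q k"
      using kN by (simp add: step_fun_def Let_def k_def)
    ultimately show "dist (step_fun N (map q [0..<N]) s) (g s) < e"
      using q(2)[of k] dist_triangle[of "q k" "g s" "g (real k / real N)"] by simp
  qed
qed

text \<open>A Lebesgue measurable function is almost everywhere a limit of continuous functions, and each
  of these is uniformly close to a step function on the unit interval.\<close>

lemma measurable_AE_limit_of_steps:
  fixes f :: "real \<Rightarrow> 'k::euclidean_space"
  assumes f: "f \<in> borel_measurable unit_leb"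
    and Q: "closure Q = UNIV"
  obtains h where "\<And>n. h n \<in> step_funs Q" "AE s in unit_leb. (\<lambda>n::nat. h n s) \<longlonglongrightarrow> f s"
proof -
  have "f measurable_on {0..<1}" using f by (simp add: measurable_on_iff_borel_measurable)
  then obtain N g where N: "negligible N" and g: "\<And>n::nat. continuous_on UNIV (g n)"
    and lim: "\<And>x. x \<notin> N \<Longrightarrow> (\<lambda>n. g n x) \<longlonglongrightarrow> (if x \<in> {0..<1} then f x else 0)"
    unfolding measurable_on_def by blast
  have "\<exists>h\<in>step_funs Q. \<forall>s\<in>{0..<1}. dist (h s) (g n s) < inverse (real (Suc n))" for n
    by (rule continuous_step_approximation[OF g[of n] Q, of "inverse (real (Suc n))"])
       (simp, blast)
  then obtain h where h: "\<And>n. h n \<in> step_funs Q"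
    "\<And>n s. s \<in> {0..<1} \<Longrightarrow> dist (h n s) (g n s) < inverse (real (Suc n))"
    by metis
  have conv: "(\<lambda>n. h n s) \<longlonglongrightarrow> f s" if s: "s \<in> {0..<1}" "s \<notin> N" for s
  proof -
    have "(\<lambda>n. dist (h n s) (g n s)) \<longlonglongrightarrow> 0"
      by (rule tendsto_sandwich[OF _ _ tendsto_const LIMSEQ_inverse_real_of_nat])
         (use h(2)[OF s(1)] in \<open>auto intro!: always_eventually less_imp_le\<close>)
    moreover have "(\<lambda>n. g n s) \<longlonglongrightarrow> f s" using lim[OF s(2)] s(1) by simp
    ultimately show ?thesis using tendsto_add[of "\<lambda>n. h n s - g n s" 0 _ "\<lambda>n. g n s" "f s"]
      by (simp add: dist_norm tendsto_norm_zero_iff)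
  qed
  have "N \<inter> {0..<1} \<in> null_sets unit_leb"
    using N negligible_Int[of N "{0..<1}"]
    by (simp add: null_sets_restrict_space negligible_iff_null_sets[symmetric])
  then have "AE s in unit_leb. (\<lambda>n. h n s) \<longlonglongrightarrow> f s"
    by (rule AE_I') (use conv in auto)
  with h(1) that show ?thesis by blast
qed

context Lp_weight
begin

lemma edge_mass_triangle_le:
  fixes f g h :: "real \<Rightarrow> 'k::{real_normed_field,euclidean_space}"
  assumes "i \<in> E" and m: "f \<in> borel_measurable unit_leb" "g \<in> borel_measurable unit_leb" "h \<in> borel_measurable unit_leb"
  shows "edge_mass (\<lambda>s. f s - h s) i \<le>
    ennreal (2 powr p) * edge_mass (\<lambda>s. f s - g s) i
    + ennreal (2 powr p) * edge_mass (\<lambda>s. g s - h s) i"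
proof (rule edge_mass_le_combination[OF assms(1) borel_measurable_diff[OF m(1,2)] borel_measurable_diff[OF m(2,3)]])
  fix s
  have "norm (f s - h s) powr p \<le> (norm (f s - g s) + norm (g s - h s)) powr p"
    using p_pos norm_triangle_ineq[of "f s - g s" "g s - h s"] by (intro powr_mono2) auto
  also have "\<dots> \<le> 2 powr p * norm (f s - g s) powr p + 2 powr p * norm (g s - h s) powr p"
    by (intro powr_add_le p_ge_1) auto
  finally show "norm (f s - h s) powr p \<le> \<dots>" .
qed auto

text \<open>Dominated convergence is used twice: to truncate \<open>f\<close>, with \<open>f\<close> itself as majorant, and to
  approximate the truncation by step functions, with a constant as majorant.\<close>

lemma edge_step_approximation:
  fixes f :: "real \<Rightarrow> 'k::{real_normed_field,euclidean_space}"
  assumes i: "i \<in> E" and f: "f \<in> borel_measurable unit_leb"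
    and fin: "edge_mass f i < \<infinity>"
    and Q: "closure Q = UNIV" "0 \<in> Q" and e: "(e::real) > 0"
  obtains h where "h \<in> step_funs Q"
    "edge_mass (\<lambda>s. f s - h s) i < ennreal e"
proof -
  define d where "d = e / (2 powr p * 2)"
  have d: "d > 0" "2 powr p * d + 2 powr p * d = e" using e by (simp_all add: d_def)
  note [measurable] = f weight_measurable[OF i]
  define g where "g = (\<lambda>(n::nat) s. if norm (f s) \<le> real n then f s else 0)"
  have g_meas[measurable]: "g n \<in> borel_measurable unit_leb" for n
    unfolding g_def by measurable
  have "(\<lambda>n. edge_mass (\<lambda>s. f s - g n s) i)
      \<longlonglongrightarrow> (\<integral>\<^sup>+ s. 0 \<partial>unit_leb)"
  proof (rule nn_integral_dominated_convergence[where w = "\<lambda>s. ennreal (norm (f s) powr p * \<rho> i s)"])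
    show "AE s in unit_leb. ennreal (norm (f s - g n s) powr p * \<rho> i s) \<le> ennreal (norm (f s) powr p * \<rho> i s)" for n
    proof (rule AE_unit_leb_all)
      fix s :: real assume "s \<in> {0..<1}"
      then have "\<rho> i s \<ge> 0" using weight_pos[OF i, of s] by simp
      then show "ennreal (norm (f s - g n s) powr p * \<rho> i s) \<le> ennreal (norm (f s) powr p * \<rho> i s)"
        using p_pos by (intro ennreal_leI mult_right_mono powr_mono2) (auto simp: g_def)
    qed
    show "AE s in unit_leb. (\<lambda>n. ennreal (norm (f s - g n s) powr p * \<rho> i s)) \<longlonglongrightarrow> 0"
    proof (rule AE_unit_leb_all)
      fix s :: real
      obtain m :: nat where m: "norm (f s) \<le> real m" using real_arch_simple by blast
      have "eventually (\<lambda>n. ennreal (norm (f s - g n s) powr p * \<rho> i s) = 0) sequentially"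
        unfolding eventually_sequentially
        by (rule exI[of _ m]) (use m p_pos in \<open>auto simp: g_def\<close>)
      then show "(\<lambda>n. ennreal (norm (f s - g n s) powr p * \<rho> i s)) \<longlonglongrightarrow> 0"
        by (rule tendsto_eventually)
    qed
  qed (use fin in measurable)
  then have "eventually (\<lambda>n. edge_mass (\<lambda>s. f s - g n s) i < ennreal d) sequentially"
    by (rule order_tendstoD) (use d in simp)
  then obtain n where n: "edge_mass (\<lambda>s. f s - g n s) i < ennreal d"
    by (auto simp: eventually_sequentially)
  obtain h where h: "\<And>k. h k \<in> step_funs Q" "AE s in unit_leb. (\<lambda>k::nat. h k s) \<longlonglongrightarrow> g n s"
    by (rule measurable_AE_limit_of_steps[OF g_meas Q(1)]) blast
  define B where "B = real n + 1"
  define h' where "h' = (\<lambda>k s. if norm (h k s) \<le> B then h k s else 0)"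
  have h'_step: "h' k \<in> step_funs Q" for k
    unfolding h'_def by (rule step_funs_cutoff[OF h(1) Q(2)])
  then have [measurable]: "h' k \<in> borel_measurable unit_leb" for k
    by (rule step_funs_measurable)
  have "(\<lambda>k. edge_mass (\<lambda>s. g n s - h' k s) i)
      \<longlonglongrightarrow> (\<integral>\<^sup>+ s. 0 \<partial>unit_leb)"
  proof (rule nn_integral_dominated_convergence[where w = "\<lambda>s. ennreal ((2 * B) powr p) * ennreal (\<rho> i s)"])
    show "AE s in unit_leb. ennreal (norm (g n s - h' k s) powr p * \<rho> i s) \<le> ennreal ((2 * B) powr p) * ennreal (\<rho> i s)" for k
    proof (rule AE_unit_leb_all)
      fix s :: real assume "s \<in> {0..<1}"
      then have r: "\<rho> i s \<ge> 0" using weight_pos[OF i, of s] by simp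
      have "norm (g n s) \<le> B" "norm (h' k s) \<le> B" by (auto simp: g_def h'_def B_def)
      then have "norm (g n s - h' k s) \<le> 2 * B" using norm_triangle_ineq4[of "g n s" "h' k s"] by simp
      then have "norm (g n s - h' k s) powr p * \<rho> i s \<le> (2 * B) powr p * \<rho> i s"
        using r p_pos by (intro mult_right_mono powr_mono2) auto
      then show "ennreal (norm (g n s - h' k s) powr p * \<rho> i s) \<le> ennreal ((2 * B) powr p) * ennreal (\<rho> i s)"
        using r by (simp add: ennreal_mult[symmetric] ennreal_leI)
    qed
    show "AE s in unit_leb. (\<lambda>k. ennreal (norm (g n s - h' k s) powr p * \<rho> i s)) \<longlonglongrightarrow> 0"
      using h(2)
    proof (rule eventually_mono)
      fix s assume lim: "(\<lambda>k. h k s) \<longlonglongrightarrow> g n s"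
      have "norm (g n s) < B" by (auto simp: g_def B_def)
      with tendsto_norm[OF lim] have "eventually (\<lambda>k. norm (h k s) < B) sequentially"
        by (rule order_tendstoD)
      then have "eventually (\<lambda>k. h' k s = h k s) sequentially"
        by eventually_elim (simp add: h'_def)
      then have "(\<lambda>k. h' k s) \<longlonglongrightarrow> g n s"
        using lim by (simp add: tendsto_cong)
      then have "(\<lambda>k. norm (g n s - h' k s)) \<longlonglongrightarrow> norm (g n s - g n s)"
        by (intro tendsto_intros)
      then have "(\<lambda>k. norm (g n s - h' k s)) \<longlonglongrightarrow> 0" by simp
      then have "(\<lambda>k. norm (g n s - h' k s) powr p) \<longlonglongrightarrow> 0"
        using p_pos by (intro tendsto_zero_powrI[where b = p]) auto
      then have "(\<lambda>k. norm (g n s - h' k s) powr p * \<rho> i s) \<longlonglongrightarrow> 0"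
        by (rule tendsto_mult_left_zero)
      then show "(\<lambda>k. ennreal (norm (g n s - h' k s) powr p * \<rho> i s)) \<longlonglongrightarrow> 0"
        using tendsto_ennrealI by fastforce
    qed
    show "(\<integral>\<^sup>+ s. ennreal ((2 * B) powr p) * ennreal (\<rho> i s) \<partial>unit_leb) < \<infinity>"
      using weight_finite[OF i] by (simp add: nn_integral_cmult ennreal_mult_less_top)
  qed measurable
  then have "eventually (\<lambda>k. edge_mass (\<lambda>s. g n s - h' k s) i < ennreal d) sequentially"
    by (rule order_tendstoD) (use d in simp)
  then obtain k where k: "edge_mass (\<lambda>s. g n s - h' k s) i < ennreal d"
    by (auto simp: eventually_sequentially)
  show ?thesis
  proof (rule that[OF h'_step[of k]])
    let ?x = "edge_mass (\<lambda>s. f s - g n s) i"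
    let ?y = "edge_mass (\<lambda>s. g n s - h' k s) i"
    have "edge_mass (\<lambda>s. f s - h' k s) i \<le>
        ennreal (2 powr p) * ?x + ennreal (2 powr p) * ?y"
      by (rule edge_mass_triangle_le[OF i]) measurable
    also have "\<dots> < ennreal (2 powr p) * ennreal d + ennreal (2 powr p) * ennreal d"
      using n k by (intro add_strict_mono ennreal_mult_strict_left_mono) auto
    also have "\<dots> = ennreal e"
      using d by (simp add: ennreal_mult[symmetric] ennreal_plus[symmetric] del: ennreal_plus)
    finally show "edge_mass (\<lambda>s. f s - h' k s) i < ennreal e" .
  qed
qed

text \<open>For these functions all sums over the tree are finite, so that translations can be computed
  without regard to convergence.\<close>

definition tame :: "('v, 'k::{real_normed_field,euclidean_space}) tree_fun \<Rightarrow> bool" where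
  "tame y \<longleftrightarrow> edge_measurable y \<and> (\<exists>B. \<forall>i s. norm (y i s) \<le> B) \<and>
    (\<exists>F. finite F \<and> F \<subseteq> E \<and> (\<forall>i s. i \<notin> F \<longrightarrow> y i s = 0))"

text \<open>The mass outside a suitable finite set of edges is negligible, and on each of the remaining
  edges a step function is chosen.\<close>

lemma tame_dense:
  "\<exists>D :: ('v, 'k::{real_normed_field,euclidean_space}) tree_fun set.
    countable D \<and> (\<forall>y\<in>D. tame y) \<and>
    (\<forall>f\<in>LP. \<forall>e>0. \<exists>y\<in>D. mass (\<lambda>i s. f i s - y i s) < ennreal e)"
proof -
  obtain Q0 :: "'k set" where Q0: "countable Q0" "\<And>U. open U \<Longrightarrow> U \<noteq> {} \<Longrightarrow> \<exists>q\<in>Q0. q \<in> U"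
    using countable_dense_setE by metis
  define Q where "Q = insert 0 Q0"
  have "x \<in> closure Q" for x
    unfolding closure_approachable
  proof (intro allI impI)
    fix e :: real assume "e > 0"
    then show "\<exists>y\<in>Q. dist y x < e"
      using Q0(2)[of "ball x e"] by (auto simp: Q_def dist_commute)
  qed
  then have Q: "countable Q" "closure Q = UNIV" "0 \<in> Q" using Q0(1) by (auto simp: Q_def)
  define D :: "('v, 'k) tree_fun set" where
    "D = (\<lambda>l i. case map_of l i of Some h \<Rightarrow> h | None \<Rightarrow> (\<lambda>_. 0)) ` lists (E \<times> step_funs Q)"
  have "countable D"
    unfolding D_def by (intro countable_image countable_lists countable_SIGMA count countable_step_funs Q)
  moreover have "tame y" if "y \<in> D" for y
  proof -
    from that obtain l where l: "l \<in> lists (E \<times> step_funs Q)"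
      and y_eq: "y = (\<lambda>i. case map_of l i of Some h \<Rightarrow> h | None \<Rightarrow> (\<lambda>_. 0))"
      unfolding D_def by (rule imageE)
    have y: "y i = (case map_of l i of Some h \<Rightarrow> h | None \<Rightarrow> (\<lambda>_. 0))" for i
      by (simp add: y_eq)
    have st: "h \<in> step_funs Q" "i \<in> E" if "map_of l i = Some h" for i h
      using map_of_SomeD[OF that] l by auto
    have "edge_measurable y"
      unfolding edge_measurable_def
      by (auto simp: y split: option.splits intro: step_funs_measurable st)
    moreover have "\<exists>B. \<forall>i s. norm (y i s) \<le> B"
    proof -
      have "\<forall>h\<in>snd ` set l. \<exists>B. \<forall>s. norm (h s) \<le> B"
      proof
        fix h assume "h \<in> snd ` set l"
        then have "h \<in> step_funs Q" using l by auto
        then show "\<exists>B. \<forall>s. norm (h s) \<le> B" using step_funs_bounded by metis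
      qed
      then obtain B where B: "\<And>h s. h \<in> snd ` set l \<Longrightarrow> norm (h s) \<le> B h" by metis
      have "norm (y i s) \<le> (\<Sum>h\<in>snd ` set l. \<bar>B h\<bar>)" for i s
      proof (cases "map_of l i")
        case None
        then show ?thesis by (simp add: y sum_nonneg)
      next
        case (Some h)
        then have h: "h \<in> snd ` set l" using map_of_SomeD by force
        have "norm (y i s) \<le> \<bar>B h\<bar>" using B[OF h, of s] Some by (simp add: y)
        also have "\<dots> \<le> (\<Sum>h\<in>snd ` set l. \<bar>B h\<bar>)" using h by (intro member_le_sum) auto
        finally show ?thesis .
      qed
      then show ?thesis by blast
    qed
    moreover have "\<exists>F. finite F \<and> F \<subseteq> E \<and> (\<forall>i s. i \<notin> F \<longrightarrow> y i s = 0)"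
    proof (intro exI[of _ "dom (map_of l)"] conjI allI impI)
      show "dom (map_of l) \<subseteq> E" using st by auto
      show "y i s = 0" if "i \<notin> dom (map_of l)" for i s using that by (simp add: y domIff)
    qed (rule finite_dom_map_of)
    ultimately show ?thesis by (simp add: tame_def)
  qed
  moreover have "\<exists>y\<in>D. mass (\<lambda>i s. f i s - y i s) < ennreal e"
    if f: "f \<in> LP" and e: "e > 0" for f :: "('v, 'k) tree_fun" and e
  proof -
    define w where "w = (\<lambda>i. edge_mass (f i) i)"
    have wE: "infsum w E < \<infinity>" using f by (simp add: Lp_fun_iff Lp_mass_def w_def)
    obtain F where F: "finite F" "F \<subseteq> E" "infsum w (E - F) < ennreal (e / 2)"
      using infsum_ennreal_small_tail[OF wE, of "e / 2"] e by auto
    define d where "d = e / 2 / (real (card F) + 1)"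
    have d: "d > 0" "real (card F) * d \<le> e / 2" using e by (auto simp: d_def field_simps)
    have "\<exists>h\<in>step_funs Q. edge_mass (\<lambda>s. f i s - h s) i < ennreal d"
      if i: "i \<in> F" for i
    proof -
      have iE: "i \<in> E" using F i by auto
      have "w i < \<infinity>" using member_le_infsum_ennreal[OF iE, of w] wE by (auto intro: le_less_trans)
      then have fin: "edge_mass (f i) i < \<infinity>"
        by (simp add: w_def)
      have fi: "f i \<in> borel_measurable unit_leb"
        using f iE by (simp add: Lp_fun_iff edge_measurable_def)
      obtain h where "h \<in> step_funs Q"
        "edge_mass (\<lambda>s. f i s - h s) i < ennreal d"
        by (rule edge_step_approximation[OF iE fi fin Q(2,3) d(1)])
      then show ?thesis by blast
    qed
    then obtain h where h: "\<And>i. i \<in> F \<Longrightarrow> h i \<in> step_funs Q"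
      "\<And>i. i \<in> F \<Longrightarrow> edge_mass (\<lambda>s. f i s - h i s) i < ennreal d"
      by metis
    obtain fs where fs: "set fs = F" using F(1) finite_list by blast
    define y where "y = (\<lambda>i. case map_of (map (\<lambda>i. (i, h i)) fs) i of Some h \<Rightarrow> h | None \<Rightarrow> (\<lambda>_. 0))"
    have y: "y i = (if i \<in> F then h i else (\<lambda>_. 0))" for i
      by (simp add: y_def map_of_map_restrict fs restrict_map_def o_def)
    have "y \<in> D" unfolding D_def y_def using h(1) fs F by (intro imageI) auto
    moreover have "mass (\<lambda>i s. f i s - y i s) < ennreal e"
    proof -
      let ?v = "\<lambda>i. edge_mass (\<lambda>s. f i s - y i s) i"
      have "mass (\<lambda>i s. f i s - y i s) = sum ?v F + infsum ?v (E - F)"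
        unfolding Lp_mass_def using infsum_ennreal_split[OF F(2), of ?v] F(1) by simp
      also have "sum ?v F \<le> (\<Sum>i\<in>F. ennreal d)"
        using h(2) by (intro sum_mono) (auto simp: y less_imp_le)
      also have "\<dots> \<le> ennreal (e / 2)"
        using d by (simp add: ennreal_of_nat_eq_real_of_nat ennreal_mult[symmetric] ennreal_leI)
      also have "infsum ?v (E - F) = infsum w (E - F)"
        by (rule infsum_cong) (simp add: y w_def)
      also have "ennreal (e / 2) + infsum w (E - F) < ennreal (e / 2) + ennreal (e / 2)"
        using F(3) by (simp add: ennreal_add_left_cancel_less)
      also have "\<dots> = ennreal e" using e by (simp add: ennreal_plus[symmetric] del: ennreal_plus)
      finally show ?thesis by (simp add: add_right_mono)
    qed
    ultimately show ?thesis by blast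
  qed
  ultimately show ?thesis by blast
qed

end

section \<open>Weights controlled along the flow\<close>

text \<open>If the right-hand side is finite, the hypothesis bounds all finite sums of norms at once, which
  yields both the estimate and absolute summability.\<close>

lemma powr_infsum_le:
  fixes x :: "'a \<Rightarrow> 'b::banach" and w :: "'a \<Rightarrow> real"
  assumes p: "p > 0" and u: "u > 0" and A: "A \<ge> 0" and w: "\<And>j. j \<in> M \<Longrightarrow> w j \<ge> 0"
    and le: "\<And>J. finite J \<Longrightarrow> J \<subseteq> M \<Longrightarrow>
      u * (\<Sum>j\<in>J. norm (x j)) powr p \<le> A * (\<Sum>j\<in>J. w j * norm (x j) powr p)"
  shows "ennreal (u * norm (\<Sum>\<^sub>\<infinity>j\<in>M. x j) powr p) \<le>
      ennreal A * (\<Sum>\<^sub>\<infinity>j\<in>M. ennreal (norm (x j) powr p * w j))"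
    and "(\<Sum>\<^sub>\<infinity>j\<in>M. ennreal (norm (x j) powr p * w j)) < \<infinity> \<Longrightarrow> x summable_on M"
proof -
  let ?R = "\<Sum>\<^sub>\<infinity>j\<in>M. ennreal (norm (x j) powr p * w j)"
  have bound: "(\<Sum>j\<in>J. norm (x j)) \<le> (r / u) powr (1 / p)"
    if r: "ennreal A * ?R = ennreal r" "r \<ge> 0" and J: "finite J" "J \<subseteq> M" for r J
  proof -
    have nn: "(\<Sum>j\<in>J. w j * norm (x j) powr p) \<ge> 0"
      using w J by (intro sum_nonneg mult_nonneg_nonneg) auto
    have "ennreal (\<Sum>j\<in>J. w j * norm (x j) powr p) = (\<Sum>j\<in>J. ennreal (norm (x j) powr p * w j))"
      using w J by (subst sum_ennreal) (auto simp: mult.commute intro!: mult_nonneg_nonneg)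
    also have "\<dots> \<le> ?R" using J by (rule sum_le_infsum_ennreal)
    finally have "ennreal A * ennreal (\<Sum>j\<in>J. w j * norm (x j) powr p) \<le> ennreal r"
      unfolding r(1)[symmetric] by (rule mult_left_mono) simp
    then have "A * (\<Sum>j\<in>J. w j * norm (x j) powr p) \<le> r"
      using A nn r(2) by (simp add: ennreal_mult[symmetric])
    with le[OF J] have "u * (\<Sum>j\<in>J. norm (x j)) powr p \<le> r" by linarith
    then have "(\<Sum>j\<in>J. norm (x j)) powr p \<le> r / u" using u by (simp add: field_simps)
    then have "((\<Sum>j\<in>J. norm (x j)) powr p) powr (1 / p) \<le> (r / u) powr (1 / p)"
      using p by (intro powr_mono2) auto
    then show ?thesis using p by (simp add: powr_powr sum_nonneg)
  qed
  show "ennreal (u * norm (\<Sum>\<^sub>\<infinity>j\<in>M. x j) powr p) \<le> ennreal A * ?R"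
  proof (cases "ennreal A * ?R")
    case (real r)
    have "norm (\<Sum>\<^sub>\<infinity>j\<in>M. x j) \<le> (r / u) powr (1 / p)"
      by (rule norm_infsum_le_finite_sums) (rule order_trans[OF norm_sum bound[OF real(2,1)]])
    then have "norm (\<Sum>\<^sub>\<infinity>j\<in>M. x j) powr p \<le> ((r / u) powr (1 / p)) powr p"
      using p by (intro powr_mono2) auto
    also have "\<dots> = r / u" using p u real by (simp add: powr_powr)
    finally have "u * norm (\<Sum>\<^sub>\<infinity>j\<in>M. x j) powr p \<le> r" using u by (simp add: field_simps)
    then show ?thesis unfolding real(2) by (rule ennreal_leI)
  qed simp
  assume "?R < \<infinity>"
  then have "ennreal A * ?R < \<infinity>" by (simp add: ennreal_mult_less_top)
  then obtain r where r: "ennreal A * ?R = ennreal r" "r \<ge> 0" by (cases "ennreal A * ?R") auto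
  have "bdd_above (sum (\<lambda>j. norm (x j)) ` {J. J \<subseteq> M \<and> finite J})"
    by (rule bdd_aboveI2[of _ _ "(r / u) powr (1 / p)"]) (use bound[OF r] in auto)
  then show "x summable_on M"
    by (rule abs_summable_summable[OF abs_summable_iff_bdd_above[THEN iffD2]])
qed

text \<open>The common form of admissibility for all \<open>p \<ge> 1\<close>, with \<open>K t\<close> in the role of
  \<open>C powr p * exp (p * w * t)\<close>: distributing mass over a later generation costs at least \<open>1 / K t\<close>
  times what it costs on the original edge.\<close>

locale controlled_weight = rooted_edges E + Lp_weight E p \<rho>
  for E :: "('v \<times> 'v) set" and p :: real and \<rho> :: "('v, real) tree_fun" +
  fixes K :: "real \<Rightarrow> real"
  assumes K_pos: "K t > 0" and K_mono: "0 \<le> t \<Longrightarrow> t \<le> t' \<Longrightarrow> K t \<le> K t'"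
    and control: "i \<in> E \<Longrightarrow> s \<in> {0..<1} \<Longrightarrow> t \<ge> 0 \<Longrightarrow> finite J \<Longrightarrow> J \<subseteq> reach E (steps t s) i \<Longrightarrow>
      \<forall>j\<in>J. c j \<ge> 0 \<Longrightarrow>
      \<rho> i s * (\<Sum>j\<in>J. c j) powr p \<le> K t * (\<Sum>j\<in>J. \<rho> j (s + t - real (steps t s)) * c j powr p)"
begin

lemma control_nat:
  assumes "i \<in> E" "s \<in> {0..<1}" "finite J" "J \<subseteq> reach E n i" "\<forall>j\<in>J. c j \<ge> 0"
  shows "\<rho> i s * (\<Sum>j\<in>J. c j) powr p \<le> K (real n) * (\<Sum>j\<in>J. \<rho> j s * c j powr p)"
  using control[of i s "real n" J c] assms by (simp add: steps_nat)

lemma reachD: "j \<in> reach E n i \<Longrightarrow> j \<in> E"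
  using reach_subset by blast

lemma reach_disjoint: "i \<in> E \<Longrightarrow> i' \<in> E \<Longrightarrow> i \<noteq> i' \<Longrightarrow> reach E n i \<inter> reach E n i' = {}"
  using reach_unique by blast

lemma weight_nonneg_reach: "s \<in> {0..<1} \<Longrightarrow> j \<in> reach E n i \<Longrightarrow> \<rho> j s \<ge> 0"
  using weight_pos[OF reachD] less_imp_le by blast

abbreviation branch_density ::
  "nat \<Rightarrow> 'v \<times> 'v \<Rightarrow> ('v, 'k::{real_normed_field,euclidean_space}) tree_fun \<Rightarrow> real \<Rightarrow> ennreal" where
  "branch_density n i f s \<equiv> \<Sum>\<^sub>\<infinity>j\<in>reach E n i. ennreal (norm (f j s) powr p * \<rho> j s)"

lemma branch_density_measurable:
  assumes "edge_measurable f"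
  shows "branch_density n i f \<in> borel_measurable unit_leb"
  by (rule borel_measurable_infsum_ennreal[OF countable_reach])
     (rule integrand_measurable[OF assms reachD])

lemma branch_density_integral:
  assumes "edge_measurable f"
  shows "(\<integral>\<^sup>+ s. branch_density n i f s \<partial>unit_leb) =
    (\<Sum>\<^sub>\<infinity>j\<in>reach E n i. edge_mass (f j) j)"
  by (rule nn_integral_infsum[OF countable_reach]) (rule integrand_measurable[OF assms reachD])

lemma branch_density_integral_le:
  assumes "edge_measurable f"
  shows "(\<integral>\<^sup>+ s. branch_density n i f s \<partial>unit_leb) \<le> mass f"
  unfolding branch_density_integral[OF assms] Lp_mass_def
  by (rule infsum_ennreal_subset) (rule reach_subset)

text \<open>The density of the mass of \<open>f\<close> in generation \<open>n\<close> is integrable, hence finite almost everywhere,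
  and where it is finite the control of the weight makes the sum absolutely convergent.\<close>

lemma AE_summable_on_reach:
  assumes f: "f \<in> LP" and i: "i \<in> E"
  shows "AE s in unit_leb. (\<lambda>j. f j s) summable_on reach E n i"
proof -
  have m: "edge_measurable f" using f by (simp add: Lp_fun_iff)
  have "(\<integral>\<^sup>+ s. branch_density n i f s \<partial>unit_leb) \<noteq> \<infinity>"
    using branch_density_integral_le[OF m, of n i] f
    by (auto simp: Lp_fun_iff top_unique)
  then have "AE s in unit_leb. branch_density n i f s \<noteq> \<infinity>"
    using branch_density_measurable[OF m] by (intro nn_integral_noteq_infinite)
  moreover have "AE s in unit_leb. s \<in> {0..<1}" by (rule AE_unit_leb_all)
  ultimately show ?thesis
  proof eventually_elim
    fix s :: real assume fin: "branch_density n i f s \<noteq> \<infinity>" and s: "s \<in> {0..<1}"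
    show "(\<lambda>j. f j s) summable_on reach E n i"
    proof (rule powr_infsum_le(2)[where u = "\<rho> i s" and A = "K (real n)" and w = "\<lambda>j. \<rho> j s"])
      show "\<rho> i s * (\<Sum>j\<in>J. norm (f j s)) powr p \<le> K (real n) * (\<Sum>j\<in>J. \<rho> j s * norm (f j s) powr p)"
        if "finite J" "J \<subseteq> reach E n i" for J
        using control_nat[OF i s that, of "\<lambda>j. norm (f j s)"] by simp
      show "branch_density n i f s < \<infinity>" using fin by (simp add: top.not_eq_extremum)
    qed (rule p_pos weight_pos[OF i s] weight_nonneg_reach[OF s] K_pos[THEN less_imp_le] | assumption)+
  qed
qed

lemma left_translation_measurable:
  assumes f: "f \<in> LP"
  shows "edge_measurable (shift n f)"
  unfolding edge_measurable_def
proof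
  fix i assume i: "i \<in> E"
  have "(\<lambda>s. \<Sum>\<^sub>\<infinity>j\<in>reach E n i. f j s) \<in> borel_measurable unit_leb"
  proof (intro borel_measurable_infsum_AE countable_reach AE_summable_on_reach[OF f i])
    show "f j \<in> borel_measurable unit_leb" if "j \<in> reach E n i" for j
      using f reachD[OF that] unfolding Lp_fun_def by blast
  qed simp
  then show "shift n f i \<in> borel_measurable unit_leb"
    by (subst measurable_cong[where g = "\<lambda>s. \<Sum>\<^sub>\<infinity>j\<in>reach E n i. f j s"]) (auto simp: left_translation_nat)
qed

text \<open>Boundedness of the translation by \<open>n\<close>: edges reached in \<open>n\<close> steps from distinct edges are
  distinct, so the local estimates add up.\<close>

lemma mass_left_translation_le:
  assumes m: "edge_measurable f"
  shows "mass (shift n f) \<le> ennreal (K (real n)) * mass f"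
proof -
  have "(\<integral>\<^sup>+ s. ennreal (norm (shift n f i s) powr p * \<rho> i s) \<partial>unit_leb) \<le>
      ennreal (K (real n)) * (\<Sum>\<^sub>\<infinity>j\<in>reach E n i. edge_mass (f j) j)"
    if i: "i \<in> E" for i
  proof -
    have "(\<integral>\<^sup>+ s. ennreal (norm (shift n f i s) powr p * \<rho> i s) \<partial>unit_leb) \<le>
        (\<integral>\<^sup>+ s. ennreal (K (real n)) * branch_density n i f s \<partial>unit_leb)"
    proof (rule nn_integral_mono)
      fix s assume "s \<in> space unit_leb"
      then have s: "s \<in> {0..<1}" by simp
      have "ennreal (\<rho> i s * norm (\<Sum>\<^sub>\<infinity>j\<in>reach E n i. f j s) powr p) \<le>
          ennreal (K (real n)) * branch_density n i f s"
      proof (rule powr_infsum_le(1))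
        show "\<rho> i s * (\<Sum>j\<in>J. norm (f j s)) powr p \<le> K (real n) * (\<Sum>j\<in>J. \<rho> j s * norm (f j s) powr p)"
          if "finite J" "J \<subseteq> reach E n i" for J
          using control_nat[OF i s that, of "\<lambda>j. norm (f j s)"] by simp
      qed (rule p_pos weight_pos[OF i s] weight_nonneg_reach[OF s] K_pos[THEN less_imp_le] | assumption)+
      then show "ennreal (norm (shift n f i s) powr p * \<rho> i s) \<le>
          ennreal (K (real n)) * branch_density n i f s"
        by (simp add: left_translation_nat[OF s] mult.commute)
    qed
    also have "\<dots> = ennreal (K (real n)) * (\<integral>\<^sup>+ s. branch_density n i f s \<partial>unit_leb)"
      using branch_density_measurable[OF m] by (rule nn_integral_cmult)
    finally show ?thesis unfolding branch_density_integral[OF m] .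
  qed
  then have "mass (shift n f) \<le> (\<Sum>\<^sub>\<infinity>i\<in>E. ennreal (K (real n)) *
      (\<Sum>\<^sub>\<infinity>j\<in>reach E n i. edge_mass (f j) j))"
    unfolding Lp_mass_def by (rule infsum_ennreal_mono)
  also have "\<dots> = ennreal (K (real n)) *
      (\<Sum>\<^sub>\<infinity>i\<in>E. \<Sum>\<^sub>\<infinity>j\<in>reach E n i. edge_mass (f j) j)"
    by (rule infsum_ennreal_cmult)
  also have "\<dots> \<le> ennreal (K (real n)) * mass f"
    unfolding Lp_mass_def
    by (intro mult_left_mono infsum_ennreal_disjoint_family reach_subset reach_disjoint zero_le)
  finally show ?thesis .
qed

lemma left_translation_Lp_fun:
  assumes "f \<in> LP"
  shows "shift n f \<in> LP"
proof -
  have "mass (shift n f) \<le> ennreal (K (real n)) * mass f"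
    using assms by (intro mass_left_translation_le) (simp add: Lp_fun_iff)
  also have "\<dots> < \<infinity>" using assms by (simp add: Lp_fun_iff ennreal_mult_less_top)
  finally show ?thesis using left_translation_measurable[OF assms] by (simp add: Lp_fun_iff)
qed

text \<open>At a real time the translate reads values of generation \<open>\<lfloor>t\<rfloor>\<close> on an initial part of the edge
  and of the next generation on the rest. Each of the two parts contributes at most \<open>A\<close> times the
  mass of \<open>f\<close>.\<close>

lemma translation_edge_bound:
  assumes m: "edge_measurable f" and i: "i \<in> E" and t: "t \<ge> 0" and A: "A \<ge> 0"
    and le: "\<And>s J c. s \<in> {0..<1} \<Longrightarrow> finite J \<Longrightarrow> J \<subseteq> reach E (steps t s) i \<Longrightarrow> \<forall>j\<in>J. c j \<ge> 0 \<Longrightarrow>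
      (\<Sum>j\<in>J. c j) powr p \<le> A * (\<Sum>j\<in>J. \<rho> j (s + t - real (steps t s)) * c j powr p)"
  shows "(\<integral>\<^sup>+ s. ennreal (norm (left_translation E t f i s) powr p) \<partial>unit_leb) \<le> ennreal (2 * A) * mass f"
proof -
  define n where "n = nat \<lfloor>t\<rfloor>"
  define a where "a = t - real n"
  have a: "0 \<le> a" "a < 1" using t unfolding a_def n_def by linarith+
  define G where "G = (\<lambda>k x. branch_density k i f x * indicator {0..<1} x)"
  have G_meas: "G k \<in> borel_measurable lebesgue" for k
    unfolding G_def using branch_density_measurable[OF m, of k i]
    by (subst (asm) borel_measurable_restrict_space_iff_ennreal) (auto simp: sets.Int)
  have G_int: "(\<integral>\<^sup>+ x. G k x \<partial>lebesgue) \<le> mass f" for k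
    using branch_density_integral_le[OF m, of k i]
    by (simp add: G_def nn_integral_restrict_space)
  have G_shift: "(\<integral>\<^sup>+ x. G k (b + x) \<partial>lebesgue) = (\<integral>\<^sup>+ x. G k x \<partial>lebesgue)" for k b
    using nn_integral_real_affine_lebesgue[OF G_meas[of k], of 1 b] by simp
  have G_shift_meas: "(\<lambda>x. G k (b + x)) \<in> borel_measurable lebesgue" for k b
    using measurable_compose[OF lebesgue_affine_measurable[of "\<lambda>_. 1" b] G_meas[of k]]
    by simp
  have "(\<integral>\<^sup>+ s. ennreal (norm (left_translation E t f i s) powr p) \<partial>unit_leb) \<le>
      (\<integral>\<^sup>+ s. ennreal A * (G n (a + s) + G (Suc n) ((a - 1) + s)) \<partial>unit_leb)"
  proof (rule nn_integral_mono)
    fix s assume "s \<in> space unit_leb"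
    then have s: "s \<in> {0..<1}" by simp
    let ?k = "steps t s" and ?r = "s + t - real (steps t s)"
    have "real ?k = of_int \<lfloor>s + t\<rfloor>" using s t by (simp add: steps_def)
    then have r: "?r \<in> {0..<1}" unfolding atLeastLessThan_iff by linarith
    have "ennreal (1 * norm (\<Sum>\<^sub>\<infinity>j\<in>reach E ?k i. f j ?r) powr p) \<le>
        ennreal A * (\<Sum>\<^sub>\<infinity>j\<in>reach E ?k i. ennreal (norm (f j ?r) powr p * \<rho> j ?r))"
    proof (rule powr_infsum_le(1))
      show "1 * (\<Sum>j\<in>J. norm (f j ?r)) powr p \<le> A * (\<Sum>j\<in>J. \<rho> j ?r * norm (f j ?r) powr p)"
        if "finite J" "J \<subseteq> reach E ?k i" for J
        using le[OF s that, of "\<lambda>j. norm (f j ?r)"] by simp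
    qed (rule p_pos zero_less_one A weight_nonneg_reach[OF r] | assumption)+
    then have 1: "ennreal (norm (left_translation E t f i s) powr p) \<le> ennreal A * G ?k ?r"
      using r by (simp add: left_translation_eq G_def add.commute)
    have "G ?k ?r \<le> G n (a + s) + G (Suc n) ((a - 1) + s)"
    proof (cases "s + a < 1")
      case True
      then have "\<lfloor>s + t\<rfloor> = int n" using s a by (intro floor_unique) (auto simp: a_def)
      then have "?k = n" by (simp add: steps_def)
      moreover from this have "?r = a + s" by (simp add: a_def)
      ultimately show ?thesis by (simp only: add_increasing2 zero_le order_refl)
    next
      case False
      then have "\<lfloor>s + t\<rfloor> = int (Suc n)" using s a by (intro floor_unique) (auto simp: a_def)
      then have "?k = Suc n" by (simp add: steps_def)
      moreover from this have "?r = (a - 1) + s" by (simp add: a_def)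
      ultimately show ?thesis by (simp only: add_increasing zero_le order_refl)
    qed
    with 1 show "ennreal (norm (left_translation E t f i s) powr p) \<le>
        ennreal A * (G n (a + s) + G (Suc n) ((a - 1) + s))"
      by (meson mult_left_mono order_trans zero_le)
  qed
  also have "\<dots> \<le> (\<integral>\<^sup>+ s. ennreal A * (G n (a + s) + G (Suc n) ((a - 1) + s)) \<partial>lebesgue)"
    by (subst nn_integral_restrict_space) (auto intro!: nn_integral_mono simp: indicator_def)
  also have "\<dots> = ennreal A * ((\<integral>\<^sup>+ x. G n x \<partial>lebesgue) + (\<integral>\<^sup>+ x. G (Suc n) x \<partial>lebesgue))"
    using G_shift_meas by (simp add: nn_integral_cmult nn_integral_add G_shift)
  also have "\<dots> \<le> ennreal A * (mass f + mass f)"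
    by (intro mult_left_mono add_mono G_int) simp
  also have "\<dots> = ennreal (2 * A) * mass f"
  proof -
    have "ennreal (2 * A) = ennreal A + ennreal A" using A by (simp flip: ennreal_plus)
    then show ?thesis by (simp only: distrib_left distrib_right)
  qed
  finally show ?thesis .
qed

end

section \<open>Distributing mass at small cost\<close>

context controlled_weight
begin

definition distribution :: "nat \<Rightarrow> 'v \<times> 'v \<Rightarrow> ('v \<times> 'v) set \<Rightarrow> ('v \<times> 'v \<Rightarrow> real) \<Rightarrow> bool" where
  "distribution n i J c \<longleftrightarrow> finite J \<and> J \<subseteq> reach E n i \<and> (\<forall>j\<in>J. c j \<ge> 0) \<and> sum c J = 1"

text \<open>The infimum and the supremum over \<open>s\<close> in the theorem amount to \<open>escape\<close>. The construction of
  preimages uses \<open>thin\<close>, where one distribution serves all points of the edges.\<close>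

definition escape :: "nat \<Rightarrow> 'v \<times> 'v \<Rightarrow> real \<Rightarrow> bool" where
  "escape n i \<epsilon> \<longleftrightarrow>
    (\<exists>s\<in>{0..<1}. \<exists>J c. distribution n i J c \<and> (\<Sum>j\<in>J. \<rho> j s * c j powr p) < \<epsilon>)"

definition thin :: "nat \<Rightarrow> 'v \<times> 'v \<Rightarrow> real \<Rightarrow> bool" where
  "thin n i \<epsilon> \<longleftrightarrow>
    (\<exists>J c. distribution n i J c \<and> (\<forall>s\<in>{0..<1}. (\<Sum>j\<in>J. \<rho> j s * c j powr p) < \<epsilon>))"

lemma cost_nonneg:
  assumes "s \<in> {0..<1}" "J \<subseteq> reach E n i"
  shows "0 \<le> (\<Sum>j\<in>J. \<rho> j s * c j powr p)"
proof (intro sum_nonneg mult_nonneg_nonneg)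
  fix j assume "j \<in> J"
  with assms(2) have "j \<in> reach E n i" by blast
  then show "0 \<le> \<rho> j s" by (rule weight_nonneg_reach[OF assms(1)])
qed simp

lemma thin_imp_escape: "thin n i \<epsilon> \<Longrightarrow> escape n i \<epsilon>"
proof -
  have "(0::real) \<in> {0..<1}" by simp
  then show "thin n i \<epsilon> \<Longrightarrow> escape n i \<epsilon>" unfolding thin_def escape_def by blast
qed

lemma escape_mono: "escape n i \<epsilon> \<Longrightarrow> \<epsilon> \<le> \<epsilon>' \<Longrightarrow> escape n i \<epsilon>'"
  unfolding escape_def using order_less_le_trans by blast

text \<open>Moving the mass of every edge of generation \<open>n + 1\<close> to its parent turns a bound at one point
  into a bound at all points: admissibility controls the weight at any point of the parent by the
  weight at the given point of the child, at a time distance of at most 2.\<close>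

lemma escape_Suc_imp_thin:
  assumes i: "i \<in> E" and esc: "escape (Suc n) i \<epsilon>"
  shows "thin n i (K 2 * \<epsilon>)"
proof -
  obtain s0 J c where s0: "s0 \<in> {0..<1}" and J: "finite J" "J \<subseteq> reach E (Suc n) i"
    and c: "\<forall>j\<in>J. c j \<ge> (0::real)" "sum c J = 1" and small: "(\<Sum>j\<in>J. \<rho> j s0 * c j powr p) < \<epsilon>"
    using esc unfolding escape_def distribution_def by blast
  have "\<forall>j\<in>J. \<exists>k. k \<in> reach E n i \<and> snd k = fst j" using J(2) reach_Suc by blast
  then obtain par where par: "\<And>j. j \<in> J \<Longrightarrow> par j \<in> reach E n i" "\<And>j. j \<in> J \<Longrightarrow> snd (par j) = fst j"
    by metis
  define J' where "J' = par ` J"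
  define d where "d k = (\<Sum>j\<in>{j \<in> J. par j = k}. c j)" for k
  have J': "finite J'" "J' \<subseteq> reach E n i" using J par by (auto simp: J'_def)
  have group: "(\<Sum>k\<in>J'. \<Sum>j\<in>{j \<in> J. par j = k}. g j) = sum g J" for g :: "'v \<times> 'v \<Rightarrow> real"
    unfolding J'_def by (rule sum.image_gen[symmetric, OF J(1)])
  have "(\<Sum>k\<in>J'. \<rho> k s * d k powr p) < K 2 * \<epsilon>" if s: "s \<in> {0..<1}" for s
  proof -
    have "\<rho> k s * d k powr p \<le> K 2 * (\<Sum>j\<in>{j \<in> J. par j = k}. \<rho> j s0 * c j powr p)" if k: "k \<in> J'" for k
    proof -
      let ?t = "1 + s0 - s"
      have kE: "k \<in> E" using J'(2) k reachD by blast
      have t: "0 \<le> ?t" "?t \<le> 2" using s s0 by auto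
      have "\<lfloor>s + ?t\<rfloor> = 1" using s0 by (intro floor_unique) auto
      then have st: "steps ?t s = 1" by (simp add: steps_def)
      have "{j \<in> J. par j = k} \<subseteq> reach E (Suc 0) k"
        using J(2) par(2) reachD unfolding subset_iff reach_Suc reach_0[OF kE] by blast
      then have "\<rho> k s * d k powr p \<le> K ?t * (\<Sum>j\<in>{j \<in> J. par j = k}. \<rho> j (s + ?t - real (steps ?t s)) * c j powr p)"
        unfolding d_def using J(1) c(1) st by (intro control[OF kE s t(1)]) auto
      also have "\<dots> = K ?t * (\<Sum>j\<in>{j \<in> J. par j = k}. \<rho> j s0 * c j powr p)"
        by (simp add: st)
      also have "\<dots> \<le> K 2 * (\<Sum>j\<in>{j \<in> J. par j = k}. \<rho> j s0 * c j powr p)"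
        using J(2) by (intro mult_right_mono K_mono t cost_nonneg[OF s0, of _ "Suc n" i]) blast
      finally show ?thesis .
    qed
    then have "(\<Sum>k\<in>J'. \<rho> k s * d k powr p) \<le> (\<Sum>k\<in>J'. K 2 * (\<Sum>j\<in>{j \<in> J. par j = k}. \<rho> j s0 * c j powr p))"
      by (rule sum_mono)
    also have "\<dots> = K 2 * (\<Sum>j\<in>J. \<rho> j s0 * c j powr p)"
      by (simp only: sum_distrib_left[symmetric] group)
    also have "\<dots> < K 2 * \<epsilon>" using small K_pos by (intro mult_strict_left_mono) auto
    finally show ?thesis .
  qed
  moreover have "sum d J' = 1" unfolding d_def group by (rule c(2))
  moreover have "\<forall>k\<in>J'. d k \<ge> 0" unfolding d_def using c(1) by (auto intro!: sum_nonneg)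
  ultimately show ?thesis unfolding thin_def distribution_def using J' by blast
qed

text \<open>Rescaling \<open>c\<close> to total mass 1 turns the failure of \<open>escape\<close> into a homogeneous inequality of
  the kind that \<open>translation_edge_bound\<close> asks for.\<close>

lemma not_escape_bound:
  assumes ne: "\<not> escape n i \<epsilon>" and s: "s \<in> {0..<1}" and J: "finite J" "J \<subseteq> reach E n i"
    and c: "\<forall>j\<in>J. c j \<ge> (0::real)"
  shows "\<epsilon> * (sum c J) powr p \<le> (\<Sum>j\<in>J. \<rho> j s * c j powr p)"
proof (cases "sum c J = 0")
  case True
  have "0 \<le> (\<Sum>j\<in>J. \<rho> j s * c j powr p)"
    by (rule cost_nonneg[OF s J(2)])
  then show ?thesis using True by simp
next
  case False
  define S where "S = sum c J"
  have S: "S > 0" using False sum_nonneg[of J c] c by (auto simp: S_def order_less_le)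
  have "\<not> (\<Sum>j\<in>J. \<rho> j s * (c j / S) powr p) < \<epsilon>"
  proof
    assume "(\<Sum>j\<in>J. \<rho> j s * (c j / S) powr p) < \<epsilon>"
    moreover have "(\<Sum>j\<in>J. c j / S) = 1" using S by (simp add: sum_divide_distrib[symmetric] S_def)
    moreover have "\<forall>j\<in>J. c j / S \<ge> 0" using c S by simp
    ultimately have "escape n i \<epsilon>" unfolding escape_def distribution_def using s J
      by (intro bexI[of _ s] exI[of _ J] exI[of _ "\<lambda>j. c j / S"] conjI)
    with ne show False by blast
  qed
  then have "\<epsilon> \<le> (\<Sum>j\<in>J. \<rho> j s * (c j / S) powr p)" by simp
  also have "\<dots> = (\<Sum>j\<in>J. \<rho> j s * c j powr p) / S powr p"
    unfolding sum_divide_distrib using c S by (intro sum.cong) (auto simp: powr_divide)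
  finally show ?thesis using S by (simp add: field_simps S_def)
qed

section \<open>Approximation of large constants\<close>

text \<open>Control at times below 1 compares points of the same edge.\<close>

lemma weight_lower_bound:
  assumes i: "i \<in> E"
  obtains l where "l > 0" "\<And>s. s \<in> {0..<1} \<Longrightarrow> \<rho> i s \<ge> l"
proof
  show "\<rho> i 0 / K 1 > 0" using weight_pos[OF i, of 0] K_pos by simp
  fix s :: real assume s: "s \<in> {0..<1}"
  have "\<lfloor>0 + s\<rfloor> = 0" using s by (intro floor_unique) auto
  then have st: "steps s 0 = 0" by (simp add: steps_def)
  have "\<rho> i 0 * (\<Sum>j\<in>{i}. 1) powr p \<le> K s * (\<Sum>j\<in>{i}. \<rho> j (0 + s - real (steps s 0)) * 1 powr p)"
    using s i by (intro control) (auto simp: st reach_0)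
  then have "\<rho> i 0 \<le> K s * \<rho> i s" by (simp add: st)
  also have "\<dots> \<le> K 1 * \<rho> i s"
    using s weight_pos[OF i s] by (intro mult_right_mono K_mono) auto
  finally show "\<rho> i 0 / K 1 \<le> \<rho> i s" using K_pos[of 1] by (simp add: field_simps)
qed

text \<open>On edge \<open>i\<close> the constant \<open>r\<close> is the sum of the translate of \<open>f\<close>, bounded by the local estimate
  with constant \<open>A\<close>, and of a function of mass at most 1; the lower bound \<open>l\<close> removes the weight
  from the latter.\<close>

lemma constant_bound:
  assumes m: "edge_measurable f" "edge_measurable (left_translation E t f)"
    and F: "F \<subseteq> E" and i: "i \<in> F" and t: "t \<ge> 0" and A: "A \<ge> 0" and R: "R \<ge> 0" and r: "r \<ge> 0"
    and le: "\<And>s J c. s \<in> {0..<1} \<Longrightarrow> finite J \<Longrightarrow> J \<subseteq> reach E (steps t s) i \<Longrightarrow> \<forall>j\<in>J. c j \<ge> 0 \<Longrightarrow>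
      (\<Sum>j\<in>J. c j) powr p \<le> A * (\<Sum>j\<in>J. \<rho> j (s + t - real (steps t s)) * c j powr p)"
    and l: "l > 0" "\<And>s. s \<in> {0..<1} \<Longrightarrow> \<rho> i s \<ge> l"
    and mass: "mass f \<le> ennreal R"
    and near: "mass (\<lambda>i s. left_translation E t f i s - (if i \<in> F then of_real r else 0)) \<le> 1"
  shows "r powr p \<le> 2 powr p * (2 * A * R + 1 / l)"
proof -
  let ?g = "left_translation E t f i"
  have iE: "i \<in> E" using F i by blast
  have meas: "?g \<in> borel_measurable unit_leb" using edge_measurableD[OF m(2) iE] .
  have "(\<integral>\<^sup>+ s. ennreal (norm (?g s - of_real r) powr p) \<partial>unit_leb) \<le>
      (\<integral>\<^sup>+ s. ennreal (1 / l) * ennreal (norm (?g s - of_real r) powr p * \<rho> i s) \<partial>unit_leb)"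
  proof (rule nn_integral_mono)
    fix s assume "s \<in> space unit_leb"
    then have s: "s \<in> {0..<1}" by simp
    have "norm (?g s - of_real r) powr p \<le> 1 / l * (norm (?g s - of_real r) powr p * \<rho> i s)"
      using mult_left_mono[OF l(2)[OF s], of "norm (?g s - of_real r) powr p"] l(1)
      by (simp add: field_simps)
    then show "ennreal (norm (?g s - of_real r) powr p) \<le>
        ennreal (1 / l) * ennreal (norm (?g s - of_real r) powr p * \<rho> i s)"
      using l(1) by (subst ennreal_mult'[symmetric]) (auto intro: ennreal_leI)
  qed
  also have "\<dots> = ennreal (1 / l) * edge_mass (\<lambda>s. ?g s - of_real r) i"
    using meas weight_measurable[OF iE] by (intro nn_integral_cmult) measurable
  also have "\<dots> \<le> ennreal (1 / l) * 1"
  proof (rule mult_left_mono)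
    have "edge_mass (\<lambda>s. ?g s - of_real r) i \<le>
        mass (\<lambda>i s. left_translation E t f i s - (if i \<in> F then of_real r else 0))"
      unfolding Lp_mass_def using i
      by (intro order_trans[OF _ member_le_infsum_ennreal[OF iE]]) simp
    with near show "edge_mass (\<lambda>s. ?g s - of_real r) i \<le> 1"
      by (rule order_trans[rotated])
  qed simp
  finally have 1: "(\<integral>\<^sup>+ s. ennreal (norm (?g s - of_real r) powr p) \<partial>unit_leb) \<le> ennreal (1 / l)"
    by simp
  have "(\<integral>\<^sup>+ s. ennreal (norm (?g s) powr p) \<partial>unit_leb) \<le> ennreal (2 * A) * mass f"
    by (rule translation_edge_bound[OF m(1) iE t A le])
  also have "\<dots> \<le> ennreal (2 * A) * ennreal R" by (intro mult_left_mono mass) simp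
  also have "\<dots> = ennreal (2 * A * R)" using A R by (simp add: ennreal_mult)
  finally have 2: "(\<integral>\<^sup>+ s. ennreal (norm (?g s) powr p) \<partial>unit_leb) \<le> ennreal (2 * A * R)" .
  have unit: "emeasure unit_leb {0..<1} = 1"
    by (simp add: emeasure_restrict_space)
  have "ennreal (r powr p) = (\<integral>\<^sup>+ s. ennreal (r powr p) \<partial>unit_leb)"
    using unit by simp
  also have "\<dots> \<le> (\<integral>\<^sup>+ s. ennreal (2 powr p) * ennreal (norm (?g s) powr p)
      + ennreal (2 powr p) * ennreal (norm (?g s - of_real r) powr p) \<partial>unit_leb)"
  proof (rule nn_integral_mono)
    fix s
    have "r = norm (?g s - (?g s - of_real r))" using r by simp
    also have "\<dots> \<le> norm (?g s) + norm (?g s - of_real r)" by (rule norm_triangle_ineq4)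
    finally have "r powr p \<le> (norm (?g s) + norm (?g s - of_real r)) powr p"
      using p_pos r by (intro powr_mono2) auto
    also have "\<dots> \<le> 2 powr p * norm (?g s) powr p + 2 powr p * norm (?g s - of_real r) powr p"
      by (intro powr_add_le p_ge_1) auto
    finally have "ennreal (r powr p) \<le>
        ennreal (2 powr p * norm (?g s) powr p + 2 powr p * norm (?g s - of_real r) powr p)"
      by (rule ennreal_leI)
    then show "ennreal (r powr p) \<le> ennreal (2 powr p) * ennreal (norm (?g s) powr p)
      + ennreal (2 powr p) * ennreal (norm (?g s - of_real r) powr p)"
      by (simp add: ennreal_plus ennreal_mult)
  qed
  also have "\<dots> = ennreal (2 powr p) * (\<integral>\<^sup>+ s. ennreal (norm (?g s) powr p) \<partial>unit_leb)
      + ennreal (2 powr p) * (\<integral>\<^sup>+ s. ennreal (norm (?g s - of_real r) powr p) \<partial>unit_leb)"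
    using meas by (simp add: nn_integral_add nn_integral_cmult)
  also have "\<dots> \<le> ennreal (2 powr p) * ennreal (2 * A * R) + ennreal (2 powr p) * ennreal (1 / l)"
    by (intro add_mono mult_left_mono 1 2) auto
  also have "\<dots> = ennreal (2 powr p * (2 * A * R + 1 / l))"
    using A R l(1) by (simp add: ennreal_mult[symmetric] ennreal_plus[symmetric] distrib_left del: ennreal_plus)
  finally show ?thesis
    using A R l(1) by (subst (asm) ennreal_le_iff) auto
qed

text \<open>This consequence is common to hypercyclicity and weak mixing. The first argument only fixes the
  type of scalars.\<close>

definition reaches_large_constants :: "'k::{real_normed_field,euclidean_space} itself \<Rightarrow> real \<Rightarrow> bool" where
  "reaches_large_constants _ R \<longleftrightarrow> (\<forall>F r. finite F \<and> F \<subseteq> E \<and> r > 0 \<longrightarrow>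
     (\<exists>(f :: ('v, 'k) tree_fun) t. t \<ge> 0 \<and> edge_measurable f \<and> edge_measurable (left_translation E t f) \<and>
        mass f \<le> ennreal R \<and>
        mass (\<lambda>i s. left_translation E t f i s - (if i \<in> F then of_real r else 0)) \<le> 1))"

text \<open>Suppose that the constant \<open>r\<close> is approximated at time \<open>t\<close>. If \<open>t\<close> were at most \<open>N\<close>, the control of
  the weight would bound \<open>r\<close> in terms of \<open>K N\<close>; if \<open>escape\<close> failed in generation \<open>\<lfloor>t\<rfloor>\<close> for an edge
  in \<open>F\<close>, it would bound \<open>r\<close> in terms of \<open>\<epsilon>\<close>. The translate also reads the generation \<open>\<lfloor>t\<rfloor> + 1\<close>,
  but there \<open>escape\<close> fails as well, by \<open>escape_Suc_imp_thin\<close> and with \<open>\<epsilon> / K 2\<close> in place of \<open>\<epsilon>\<close>.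
  So \<open>r\<close> is chosen beyond all these bounds.\<close>

lemma reaches_large_constants_imp_escape:
  assumes large: "reaches_large_constants TYPE('k::{real_normed_field,euclidean_space}) R"
    and R: "R \<ge> 0" and F: "finite F" "F \<subseteq> E" and eps: "\<epsilon> > 0"
  shows "\<exists>n\<ge>N. \<forall>i\<in>F. escape n i \<epsilon>"
proof -
  have "\<forall>i\<in>F. \<exists>l>0. \<forall>s\<in>{0..<1}. \<rho> i s \<ge> l"
  proof
    fix i assume "i \<in> F"
    then have "i \<in> E" using F(2) by blast
    then obtain l where "l > 0" "\<And>s. s \<in> {0..<1} \<Longrightarrow> \<rho> i s \<ge> l"
      by (rule weight_lower_bound) blast
    then show "\<exists>l>0. \<forall>s\<in>{0..<1}. \<rho> i s \<ge> l" by blast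
  qed
  then obtain l where l: "\<And>i. i \<in> F \<Longrightarrow> l i > 0" "\<And>i s. i \<in> F \<Longrightarrow> s \<in> {0..<1} \<Longrightarrow> \<rho> i s \<ge> l i"
    by metis
  \<comment> \<open>\<open>A1\<close> is the local constant that would apply at times up to \<open>N\<close>, \<open>A2\<close> the one that would apply
    without \<open>escape\<close>; \<open>Z\<close> dominates the resulting bounds for the power of \<open>r\<close>.\<close>
  define A1 where "A1 i = K (real N) / l i" for i
  define A2 where "A2 = (1 + K 2) / \<epsilon>"
  define Z where "Z i = 2 powr p * (2 * A1 i * R + 1 / l i) + 2 powr p * (2 * A2 * R + 1 / l i)" for i
  define r where "r = (1 + sum Z F) powr (1 / p)"
  have A: "A1 i \<ge> 0" if "i \<in> F" for i using l(1)[OF that] K_pos[of "real N"] by (simp add: A1_def)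
  have A2: "A2 \<ge> 0" using K_pos[of 2] eps by (simp add: A2_def)
  have terms: "0 \<le> 2 powr p * (2 * A1 i * R + 1 / l i)" "0 \<le> 2 powr p * (2 * A2 * R + 1 / l i)"
    if "i \<in> F" for i
    using A[OF that] A2 R l(1)[OF that] by (auto intro!: mult_nonneg_nonneg add_nonneg_nonneg)
  have Z: "Z i \<ge> 0" if "i \<in> F" for i using terms[OF that] by (simp add: Z_def)
  have Zsum: "sum Z F \<ge> 0" using Z by (rule sum_nonneg)
  have r: "r > 0" "r powr p = 1 + sum Z F" using Zsum p_pos by (auto simp: r_def powr_powr)
  have r1: "\<not> r powr p \<le> 2 powr p * (2 * A1 i * R + 1 / l i)"
    and r2: "\<not> r powr p \<le> 2 powr p * (2 * A2 * R + 1 / l i)" if "i \<in> F" for i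
  proof -
    have "Z i \<le> sum Z F" using that Z F(1) by (intro member_le_sum) auto
    then show "\<not> r powr p \<le> 2 powr p * (2 * A1 i * R + 1 / l i)"
      "\<not> r powr p \<le> 2 powr p * (2 * A2 * R + 1 / l i)"
      using terms[OF that] unfolding r(2) Z_def by linarith+
  qed
  obtain f :: "('v, 'k) tree_fun" and t where t: "t \<ge> 0"
    and m: "edge_measurable f" "edge_measurable (left_translation E t f)" and mass: "mass f \<le> ennreal R"
    and near: "mass (\<lambda>i s. left_translation E t f i s - (if i \<in> F then of_real r else 0)) \<le> 1"
    using large F r(1) unfolding reaches_large_constants_def by blast
  define n where "n = nat \<lfloor>t\<rfloor>"
  have steps: "steps t s = n \<or> steps t s = Suc n" "s + t - real (steps t s) \<in> {0..<1}"
    if "s \<in> {0..<1}" for s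
  proof -
    have "real (steps t s) = of_int \<lfloor>s + t\<rfloor>" using that t by (simp add: steps_def)
    then show "s + t - real (steps t s) \<in> {0..<1}" unfolding atLeastLessThan_iff by linarith
    have "\<lfloor>s + t\<rfloor> = \<lfloor>t\<rfloor> \<or> \<lfloor>s + t\<rfloor> = \<lfloor>t\<rfloor> + 1" using that unfolding atLeastLessThan_iff by linarith
    then show "steps t s = n \<or> steps t s = Suc n"
      unfolding steps_def n_def using t by (auto simp: nat_add_distrib)
  qed
  have escape: "escape n i \<epsilon>" if i: "i \<in> F" for i
  proof (rule ccontr)
    assume ne: "\<not> escape n i \<epsilon>"
    have iE: "i \<in> E" using F i by blast
    have ne': "\<not> escape (Suc n) i (\<epsilon> / K 2)"
      using escape_Suc_imp_thin[OF iE, of n "\<epsilon> / K 2"] thin_imp_escape[of n i \<epsilon>] ne K_pos[of 2]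
      by auto
    have bound: "(\<Sum>j\<in>J. c j) powr p \<le> A2 * (\<Sum>j\<in>J. \<rho> j (s + t - real (steps t s)) * c j powr p)"
      if s: "s \<in> {0..<1}" and J: "finite J" "J \<subseteq> reach E (steps t s) i" and c: "\<forall>j\<in>J. c j \<ge> 0" for s J c
    proof -
      define T where "T = (\<Sum>j\<in>J. \<rho> j (s + t - real (steps t s)) * c j powr p)"
      have T: "T \<ge> 0"
        unfolding T_def by (rule cost_nonneg[OF steps(2)[OF s] J(2)])
      have "\<epsilon> * sum c J powr p \<le> (1 + K 2) * T"
        using steps(1)[OF s]
      proof
        assume st: "steps t s = n"
        have "\<epsilon> * sum c J powr p \<le> T"
          unfolding T_def using not_escape_bound[OF ne steps(2)[OF s] J(1) _ c] J(2) st by simp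
        moreover have "0 \<le> K 2 * T" using T K_pos[of 2] by simp
        ultimately show ?thesis by (simp add: distrib_right)
      next
        assume st: "steps t s = Suc n"
        have "\<epsilon> / K 2 * sum c J powr p \<le> T"
          unfolding T_def using not_escape_bound[OF ne' steps(2)[OF s] J(1) _ c] J(2) st by simp
        then have "\<epsilon> * sum c J powr p \<le> K 2 * T" using K_pos[of 2] by (simp add: field_simps)
        then show ?thesis using T by (simp add: distrib_right)
      qed
      then show ?thesis using eps unfolding A2_def T_def[symmetric] by (simp add: field_simps)
    qed
    show False
      using constant_bound[OF m F(2) i t A2 R less_imp_le[OF r(1)] bound l(1)[OF i] l(2)[OF i] mass near] r2[OF i] by blast
  qed
  show ?thesis
  proof (cases "F = {}")
    case True
    then show ?thesis by blast
  next
    case False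
    then obtain i where i: "i \<in> F" by blast
    then have iE: "i \<in> E" using F by blast
    have "n \<ge> N"
    proof (rule ccontr)
      assume "\<not> n \<ge> N"
      then have tN: "t \<le> real N" unfolding n_def using t by linarith
      have bound: "(\<Sum>j\<in>J. c j) powr p \<le> A1 i * (\<Sum>j\<in>J. \<rho> j (s + t - real (steps t s)) * c j powr p)"
        if s: "s \<in> {0..<1}" and J: "finite J" "J \<subseteq> reach E (steps t s) i" and c: "\<forall>j\<in>J. c j \<ge> 0" for s J c
      proof -
        have "l i * (\<Sum>j\<in>J. c j) powr p \<le> \<rho> i s * (\<Sum>j\<in>J. c j) powr p"
          using l(2)[OF i s] by (rule mult_right_mono) simp
        also have "\<dots> \<le> K t * (\<Sum>j\<in>J. \<rho> j (s + t - real (steps t s)) * c j powr p)"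
          by (rule control[OF iE s t J c])
        also have "\<dots> \<le> K (real N) * (\<Sum>j\<in>J. \<rho> j (s + t - real (steps t s)) * c j powr p)"
          by (intro mult_right_mono K_mono t tN cost_nonneg[OF steps(2)[OF s] J(2)])
        finally show ?thesis using l(1)[OF i] by (simp add: A1_def field_simps)
      qed
      show False
        using constant_bound[OF m F(2) i t A[OF i] R less_imp_le[OF r(1)] bound l(1)[OF i] l(2)[OF i] mass near] r1[OF i] by blast
    qed
    with escape show ?thesis by blast
  qed
qed

end

section \<open>Small preimages and weak mixing\<close>

context controlled_weight
begin

lemma tame_Lp_fun:
  assumes y: "tame y"
  shows "y \<in> LP"
proof -
  obtain B F where B: "\<And>i s. norm (y i s) \<le> B" and F: "finite F" "F \<subseteq> E" "\<And>i s. i \<notin> F \<Longrightarrow> y i s = 0"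
    and m: "edge_measurable y"
    using y unfolding tame_def by blast
  have "edge_mass (y i) i < \<infinity>" if i: "i \<in> E" for i
  proof -
    have "edge_mass (y i) i \<le>
        (\<integral>\<^sup>+ s. ennreal (B powr p) * ennreal (\<rho> i s) \<partial>unit_leb)"
    proof (rule nn_integral_mono)
      fix s assume "s \<in> space unit_leb"
      then have r: "\<rho> i s \<ge> 0" using weight_pos[OF i, of s] by simp
      have "norm (y i s) powr p * \<rho> i s \<le> B powr p * \<rho> i s"
        using B r p_pos by (intro mult_right_mono powr_mono2) auto
      then show "ennreal (norm (y i s) powr p * \<rho> i s) \<le> ennreal (B powr p) * ennreal (\<rho> i s)"
        by (subst ennreal_mult'[symmetric]) (auto intro: ennreal_leI)
    qed
    also have "\<dots> = ennreal (B powr p) * (\<integral>\<^sup>+ s. ennreal (\<rho> i s) \<partial>unit_leb)"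
      using weight_measurable[OF i] by (intro nn_integral_cmult) measurable
    also have "\<dots> < \<infinity>" using weight_finite[OF i] by (simp add: ennreal_mult_less_top)
    finally show ?thesis .
  qed
  then have "\<forall>i\<in>F. edge_mass (y i) i < \<infinity>"
    using F(2) by blast
  then have "(\<Sum>i\<in>F. edge_mass (y i) i) < \<infinity>"
    using F(1) by simp
  moreover have "mass y = (\<Sum>\<^sub>\<infinity>i\<in>F. edge_mass (y i) i)"
    unfolding Lp_mass_def by (rule infsum_cong_neutral) (use F p_pos in auto)
  ultimately show ?thesis using m F(1) by (simp add: Lp_fun_iff)
qed

lemma tame_add:
  assumes "tame x" "tame y"
  shows "tame (\<lambda>i s. x i s + y i s)"
proof -
  obtain B F where x: "\<And>i s. norm (x i s) \<le> B" "finite F" "F \<subseteq> E" "\<And>i s. i \<notin> F \<Longrightarrow> x i s = 0"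
    "edge_measurable x"
    using assms(1) unfolding tame_def by blast
  obtain B' F' where y: "\<And>i s. norm (y i s) \<le> B'" "finite F'" "F' \<subseteq> E" "\<And>i s. i \<notin> F' \<Longrightarrow> y i s = 0"
    "edge_measurable y"
    using assms(2) unfolding tame_def by blast
  have "norm (x i s + y i s) \<le> B + B'" for i s
    using norm_triangle_ineq[of "x i s" "y i s"] x(1)[of i s] y(1)[of i s] by linarith
  moreover have "finite (F \<union> F')" "F \<union> F' \<subseteq> E" "\<And>i s. i \<notin> F \<union> F' \<Longrightarrow> x i s + y i s = 0"
    using x y by auto
  ultimately show ?thesis unfolding tame_def using edge_measurable_add[OF x(5) y(5)] by blast
qed

lemma tame_finite_support:
  assumes "tame x"
  shows "finite {j. \<exists>s. x j s \<noteq> 0}" "{j. \<exists>s. x j s \<noteq> 0} \<subseteq> E"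
proof -
  obtain F where F: "finite F" "F \<subseteq> E" "\<And>i s. i \<notin> F \<Longrightarrow> x i s = 0"
    using assms unfolding tame_def by blast
  then have "{j. \<exists>s. x j s \<noteq> 0} \<subseteq> F" by blast
  with F show "finite {j. \<exists>s. x j s \<noteq> 0}" "{j. \<exists>s. x j s \<noteq> 0} \<subseteq> E"
    using finite_subset by blast+
qed

lemma tame_summable_on:
  assumes "tame x"
  shows "(\<lambda>j. x j s) summable_on M"
  by (rule finite_nonzero_values_imp_summable_on)
     (rule finite_subset[OF _ tame_finite_support(1)[OF assms]], blast)

text \<open>A finitely supported function is annihilated by all late translations, since an edge of a
  rooted tree has only finitely many ancestors.\<close>

lemma tame_depth:
  assumes "tame x"
  obtains d where "\<And>n i j s. d < n \<Longrightarrow> i \<in> E \<Longrightarrow> j \<in> reach E n i \<Longrightarrow> x j s = 0"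
proof -
  obtain d where d: "\<And>n i j. i \<in> E \<Longrightarrow> j \<in> {j. \<exists>s. x j s \<noteq> 0} \<Longrightarrow> j \<in> reach E n i \<Longrightarrow> n \<le> d"
    using finite_set_depth[OF tame_finite_support[OF assms]] by blast
  show ?thesis
  proof (rule that)
    fix n i j s assume "d < n" "i \<in> E" "j \<in> reach E n i"
    then show "x j s = 0" using d[of i j n] by fastforce
  qed
qed

text \<open>The values of \<open>w\<close> on edge \<open>i\<close> are distributed over generation \<open>n\<close> with the coefficients provided
  by \<open>thin\<close>. These do not depend on the point and sum up to 1, so the translation recovers \<open>w\<close>, and
  the mass is bounded by the cost.\<close>

lemma translation_right_inverse:
  fixes w :: "('v, 'k::{real_normed_field,euclidean_space}) tree_fun"
  assumes m: "edge_measurable w" and B: "\<And>i s. norm (w i s) \<le> B" and B0: "B \<ge> 0"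
    and F: "finite F" "F \<subseteq> E" "\<And>i s. i \<notin> F \<Longrightarrow> w i s = 0"
    and thin: "\<forall>i\<in>F. thin n i \<epsilon>" and eps: "\<epsilon> > 0"
  shows "\<exists>x :: ('v, 'k) tree_fun. tame x \<and> mass x \<le> ennreal (real (card F) * (B powr p * \<epsilon>)) \<and>
    (\<forall>i\<in>E. \<forall>s\<in>{0..<1}. shift n x i s = w i s) \<and>
    (\<forall>j s. x j s \<noteq> 0 \<longrightarrow> (\<exists>i\<in>E. j \<in> reach E n i))"
proof -
  have "\<forall>i\<in>F. \<exists>J c. distribution n i J c \<and> (\<forall>s\<in>{0..<1}. (\<Sum>j\<in>J. \<rho> j s * c j powr p) < \<epsilon>)"
    using thin unfolding thin_def .
  from bchoice[OF this] obtain J where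
    "\<forall>i\<in>F. \<exists>c. distribution n i (J i) c \<and> (\<forall>s\<in>{0..<1}. (\<Sum>j\<in>J i. \<rho> j s * c j powr p) < \<epsilon>)" ..
  from bchoice[OF this] obtain c where
    "\<forall>i\<in>F. distribution n i (J i) (c i) \<and> (\<forall>s\<in>{0..<1}. (\<Sum>j\<in>J i. \<rho> j s * c i j powr p) < \<epsilon>)" ..
  then have J: "finite (J i)" "J i \<subseteq> reach E n i" and c: "\<forall>j\<in>J i. c i j \<ge> 0" "sum (c i) (J i) = 1"
    and small: "\<forall>s\<in>{0..<1}. (\<Sum>j\<in>J i. \<rho> j s * c i j powr p) < \<epsilon>" if "i \<in> F" for i
    using that unfolding distribution_def by blast+
  have disj: "j \<notin> J i'" if "i \<in> F" "i' \<in> E" "i \<noteq> i'" "j \<in> reach E n i" "i' \<in> F" for i i' j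
    using reach_disjoint[of i i' n] J(2)[of i'] that F(2) by blast
  define x :: "('v, 'k) tree_fun" where
    "x j s = (\<Sum>i\<in>F. if j \<in> J i then c i j *\<^sub>R w i s else 0)" for j s
  have x_eq: "x j s = (if j \<in> J i then c i j *\<^sub>R w i s else 0)" if i: "i \<in> F" and j: "j \<in> reach E n i" for i j s
  proof -
    have "x j s = (\<Sum>i'\<in>F. if i' = i then (if j \<in> J i then c i j *\<^sub>R w i s else 0) else 0)"
      unfolding x_def by (rule sum.cong) (use disj[OF i _ _ j] F in auto)
    also have "\<dots> = (if j \<in> J i then c i j *\<^sub>R w i s else 0)" using i F(1) by simp
    finally show ?thesis .
  qed
  have x_supp: "\<exists>i\<in>F. j \<in> J i" if "x j s \<noteq> 0" for j s
  proof (rule ccontr)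
    assume "\<not> (\<exists>i\<in>F. j \<in> J i)"
    then have "x j s = 0" unfolding x_def by (intro sum.neutral) auto
    with that show False by simp
  qed
  define U where "U = (\<Union>i\<in>F. J i)"
  have U: "finite U" "U \<subseteq> E" using J F(1) reach_subset unfolding U_def by blast+
  have x_meas: "edge_measurable x"
    unfolding edge_measurable_def
  proof
    fix j
    have "w i \<in> borel_measurable unit_leb" if "i \<in> F" for i
      using that F(2) by (intro edge_measurableD[OF m]) blast
    then have "(\<lambda>s. \<Sum>i\<in>F. if j \<in> J i then c i j *\<^sub>R w i s else 0) \<in> borel_measurable unit_leb"
      by (intro borel_measurable_sum) auto
    then show "x j \<in> borel_measurable unit_leb" by (simp add: x_def[abs_def])
  qed
  have x_norm: "norm (x j s) = c i j * norm (w i s)" if "i \<in> F" "j \<in> J i" for i j s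
  proof -
    have "j \<in> reach E n i" "c i j \<ge> 0" using that J(2)[of i] c(1)[of i] by blast+
    then show ?thesis using x_eq[of i j s] that by simp
  qed
  have x_bound: "norm (x j s) powr p = c i j powr p * norm (w i s) powr p" if "i \<in> F" "j \<in> J i" for i j s
    using x_norm[OF that] c(1)[OF that(1)] that(2) by (simp add: powr_mult)
  have "norm (x j s) \<le> (\<Sum>i\<in>F. \<Sum>j\<in>J i. c i j * B)" for j s
  proof (cases "\<exists>i\<in>F. j \<in> J i")
    case True
    then obtain i where i: "i \<in> F" "j \<in> J i" by blast
    then have "norm (x j s) \<le> c i j * B"
      using x_norm[OF i] c(1)[OF i(1)] i(2) B[of i s] by (simp add: mult_left_mono)
    also have "\<dots> \<le> (\<Sum>j\<in>J i. c i j * B)"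
      using i J(1)[OF i(1)] c(1)[OF i(1)] B0 by (intro member_le_sum) auto
    also have "\<dots> \<le> (\<Sum>i\<in>F. \<Sum>j\<in>J i. c i j * B)"
      using i(1) F(1) c(1) B0 by (intro member_le_sum[where f = "\<lambda>i. \<Sum>j\<in>J i. c i j * B"] sum_nonneg) auto
    finally show ?thesis .
  next
    case False
    then have "x j s = 0" using x_supp by blast
    then show ?thesis using c(1) B0 by (auto intro!: sum_nonneg)
  qed
  moreover have "\<And>j s. j \<notin> U \<Longrightarrow> x j s = 0" using x_supp unfolding U_def by blast
  ultimately have tame: "tame x" unfolding tame_def using x_meas U by blast
  have edge: "(\<Sum>j\<in>J i. edge_mass (x j) j) \<le> ennreal (B powr p * \<epsilon>)"
    if i: "i \<in> F" for i
  proof -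
    have "(\<Sum>j\<in>J i. edge_mass (x j) j) =
        (\<integral>\<^sup>+ s. (\<Sum>j\<in>J i. ennreal (norm (x j s) powr p * \<rho> j s)) \<partial>unit_leb)"
      using J(2)[OF i] reach_subset by (intro nn_integral_sum[symmetric] integrand_measurable[OF x_meas]) blast
    also have "\<dots> \<le> (\<integral>\<^sup>+ s. ennreal (B powr p * \<epsilon>) \<partial>unit_leb)"
    proof (rule nn_integral_mono)
      fix s assume "s \<in> space unit_leb"
      then have s: "s \<in> {0..<1}" by simp
      have r: "\<rho> j s \<ge> 0" if "j \<in> J i" for j
        using J(2)[OF i] that by (intro weight_nonneg_reach[OF s]) blast
      have "(\<Sum>j\<in>J i. ennreal (norm (x j s) powr p * \<rho> j s)) = ennreal (\<Sum>j\<in>J i. norm (x j s) powr p * \<rho> j s)"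
        using r by (intro sum_ennreal) auto
      also have "(\<Sum>j\<in>J i. norm (x j s) powr p * \<rho> j s) = norm (w i s) powr p * (\<Sum>j\<in>J i. \<rho> j s * c i j powr p)"
        unfolding sum_distrib_left using x_bound[OF i] by (intro sum.cong) auto
      also have "ennreal \<dots> \<le> ennreal (B powr p * \<epsilon>)"
        using small[OF i] s B p_pos cost_nonneg[OF s J(2)[OF i]]
        by (intro ennreal_leI mult_mono powr_mono2) (auto intro: less_imp_le)
      finally show "(\<Sum>j\<in>J i. ennreal (norm (x j s) powr p * \<rho> j s)) \<le> ennreal (B powr p * \<epsilon>)" .
    qed
    also have "\<dots> = ennreal (B powr p * \<epsilon>)" by (simp add: emeasure_restrict_space)
    finally show ?thesis .
  qed
  have "mass x = (\<Sum>\<^sub>\<infinity>j\<in>U. edge_mass (x j) j)"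
    unfolding Lp_mass_def
  proof (rule infsum_cong_neutral)
    fix j assume "j \<in> E - U"
    then have "x j s = 0" for s using x_supp unfolding U_def by blast
    then show "edge_mass (x j) j = 0" using p_pos by simp
  qed (use U in auto)
  also have "\<dots> = (\<Sum>j\<in>U. edge_mass (x j) j)" using U(1) by simp
  also have "\<dots> = (\<Sum>i\<in>F. \<Sum>j\<in>J i. edge_mass (x j) j)"
    unfolding U_def
  proof (rule sum.UNION_disjoint)
    show "\<forall>i\<in>F. \<forall>i'\<in>F. i \<noteq> i' \<longrightarrow> J i \<inter> J i' = {}"
      using disj J(2) F(2) by blast
  qed (use F J in auto)
  also have "\<dots> \<le> (\<Sum>i\<in>F. ennreal (B powr p * \<epsilon>))" using edge by (rule sum_mono)
  also have "\<dots> = ennreal (real (card F) * (B powr p * \<epsilon>))"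
    using eps by (simp add: ennreal_of_nat_eq_real_of_nat ennreal_mult[symmetric])
  finally have mass: "mass x \<le> ennreal (real (card F) * (B powr p * \<epsilon>))" .
  have inv: "shift n x i s = w i s" if i: "i \<in> E" and s: "s \<in> {0..<1}" for i s
  proof (cases "i \<in> F")
    case True
    have "shift n x i s = (\<Sum>\<^sub>\<infinity>j\<in>reach E n i. x j s)"
      using s by (rule left_translation_nat)
    also have "\<dots> = (\<Sum>\<^sub>\<infinity>j\<in>J i. c i j *\<^sub>R w i s)"
      by (rule infsum_cong_neutral) (use J(2)[OF True] x_eq[OF True] in auto)
    also have "\<dots> = (\<Sum>j\<in>J i. c i j) *\<^sub>R w i s"
      using J(1)[OF True] by (simp add: scaleR_sum_left)
    finally show ?thesis using c(2)[OF True] by simp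
  next
    case False
    have zero: "x j s = 0" if "j \<in> reach E n i" for j
    proof (rule ccontr)
      assume "x j s \<noteq> 0"
      then obtain i' where i': "i' \<in> F" "j \<in> J i'" using x_supp by blast
      then have "j \<in> reach E n i'" using J(2) by blast
      with reach_unique[OF i, of i' j n] that i' F(2) False show False by blast
    qed
    have "shift n x i s = (\<Sum>\<^sub>\<infinity>j\<in>reach E n i. x j s)"
      using s by (rule left_translation_nat)
    also have "\<dots> = 0" using zero by (rule infsum_0)
    finally show ?thesis using F(3)[OF False] by simp
  qed
  have "\<exists>i\<in>E. j \<in> reach E n i" if "x j s \<noteq> 0" for j s
    using x_supp[OF that] J(2) F(2) by blast
  with tame mass inv show ?thesis by blast
qed

text \<open>This is the condition on the weight after the passage from one point to all points of the
  edges.\<close>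

definition spreads :: bool where
  "spreads \<longleftrightarrow> (\<forall>F \<epsilon> N. finite F \<and> F \<subseteq> E \<and> \<epsilon> > 0 \<longrightarrow> (\<exists>n\<ge>N. \<forall>i\<in>F. thin n i \<epsilon>))"

text \<open>Both targets are handled at a common time, as weak mixing requires.\<close>

lemma translation_right_inverses:
  fixes w w' :: "('v, 'k::{real_normed_field,euclidean_space}) tree_fun"
  assumes sp: spreads and w: "tame w" "tame w'" and e: "e > 0"
  shows "\<exists>n\<ge>N. \<forall>v\<in>{w, w'}. \<exists>x. tame x \<and> mass x < ennreal e \<and>
    (\<forall>i\<in>E. \<forall>s\<in>{0..<1}. shift n x i s = v i s) \<and>
    (\<forall>j s. x j s \<noteq> 0 \<longrightarrow> (\<exists>i\<in>E. j \<in> reach E n i))"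
proof -
  obtain B F where 1: "\<And>i s. norm (w i s) \<le> B" "finite F" "F \<subseteq> E" "\<And>i s. i \<notin> F \<Longrightarrow> w i s = 0"
    "edge_measurable w"
    using w(1) unfolding tame_def by blast
  obtain B' F' where 2: "\<And>i s. norm (w' i s) \<le> B'" "finite F'" "F' \<subseteq> E" "\<And>i s. i \<notin> F' \<Longrightarrow> w' i s = 0"
    "edge_measurable w'"
    using w(2) unfolding tame_def by blast
  define C where "C = \<bar>B\<bar> + \<bar>B'\<bar>"
  define G where "G = F \<union> F'"
  define D where "D = real (card G) * C powr p"
  have D: "D \<ge> 0" by (simp add: D_def)
  define \<epsilon> where "\<epsilon> = e / (D + 1)"
  have eps: "\<epsilon> > 0" using e D by (simp add: \<epsilon>_def)
  have "real (card G) * (C powr p * \<epsilon>) = D * e / (D + 1)" by (simp add: D_def \<epsilon>_def)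
  also have "\<dots> < e" using D e by (simp add: field_simps)
  finally have small: "real (card G) * (C powr p * \<epsilon>) < e" .
  have G: "finite G" "G \<subseteq> E" using 1 2 by (auto simp: G_def)
  obtain n where n: "n \<ge> N" "\<forall>i\<in>G. thin n i \<epsilon>"
    using sp G eps unfolding spreads_def by blast
  have C: "C \<ge> 0" by (simp add: C_def)
  have "\<exists>x. tame x \<and> mass x < ennreal e \<and>
    (\<forall>i\<in>E. \<forall>s\<in>{0..<1}. shift n x i s = v i s) \<and>
    (\<forall>j s. x j s \<noteq> 0 \<longrightarrow> (\<exists>i\<in>E. j \<in> reach E n i))" if v: "v \<in> {w, w'}" for v
  proof -
    have vm: "edge_measurable v" using v 1 2 by auto
    have vB: "norm (v i s) \<le> C" for i s
      using v 1(1)[of i s] 2(1)[of i s] unfolding C_def by auto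
    have v0: "v i s = 0" if "i \<notin> G" for i s
      using v 1(4)[of i s] 2(4)[of i s] that unfolding G_def by auto
    obtain x :: "('v, 'k) tree_fun" where x: "tame x" "mass x \<le> ennreal (real (card G) * (C powr p * \<epsilon>))"
      "\<forall>i\<in>E. \<forall>s\<in>{0..<1}. shift n x i s = v i s"
      "\<forall>j s. x j s \<noteq> 0 \<longrightarrow> (\<exists>i\<in>E. j \<in> reach E n i)"
      using translation_right_inverse[OF vm vB C G v0 n(2) eps] by blast
    have "mass x < ennreal e"
      using x(2) small e by (auto intro: le_less_trans simp: ennreal_lessI)
    with x show ?thesis by blast
  qed
  with n(1) show ?thesis by blast
qed

lemma left_translation_add:
  assumes "s \<in> {0..<1}" "(\<lambda>j. f j s) summable_on reach E n i" "(\<lambda>j. g j s) summable_on reach E n i"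
  shows "shift n (\<lambda>j s. f j s + g j s) i s =
    shift n f i s + shift n g i s"
  unfolding left_translation_nat[OF assms(1)] by (rule infsum_add[OF assms(2,3)])

abbreviation flow ::
  "real \<Rightarrow> ('v, 'k::{real_normed_field,euclidean_space}) tree_fun set \<Rightarrow> ('v, 'k) tree_fun set" where
  "flow \<equiv> translation_semigroup E \<rho> p"

text \<open>A translate depends on the values on countably many edges only, so it respects equality almost
  everywhere.\<close>

lemma flow_cls:
  assumes f: "f \<in> LP"
  shows "flow (real n) (cls f) = cls (shift n f)"
proof -
  have tf: "shift n f \<in> LP" by (rule left_translation_Lp_fun[OF f])
  have same: "(shift n f, shift n g) \<in> Lp_ae E \<rho> p" if g: "g \<in> cls f" for g
  proof -
    have gL: "g \<in> LP" and ae: "\<And>j. j \<in> E \<Longrightarrow> AE s in unit_leb. f j s = g j s"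
      using g by (auto simp: in_cls_iff)
    have "AE s in unit_leb. \<forall>j\<in>E. f j s = g j s" using ae count by (simp add: AE_ball_countable)
    moreover have "AE s in unit_leb. s \<in> {0..<1}" by (rule AE_unit_leb_all)
    ultimately have "AE s in unit_leb. shift n f i s = shift n g i s" for i
    proof eventually_elim
      fix s :: real assume eq: "\<forall>j\<in>E. f j s = g j s" and s: "s \<in> {0..<1}"
      show "shift n f i s = shift n g i s"
        unfolding left_translation_nat[OF s] using eq reachD by (intro infsum_cong) blast
    qed
    then show ?thesis using tf left_translation_Lp_fun[OF gL, of n] by (simp add: Lp_ae_def)
  qed
  have "f \<in> cls f" using f by (simp add: in_cls_iff)
  then show ?thesis
    unfolding translation_semigroup_def cls_def[of "shift n f"]
    using same equiv_class_eq[OF equiv_Lp_ae] by (auto simp: Image_def)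
qed

lemma cls_eq_of_eq:
  assumes "f \<in> LP" "\<And>i s. i \<in> E \<Longrightarrow> s \<in> {0..<1} \<Longrightarrow> f i s = g i s"
  shows "cls f = cls g"
proof -
  have ae: "AE s in unit_leb. f i s = g i s" if "i \<in> E" for i
    using assms(2)[OF that] by (rule AE_unit_leb_all)
  then have "g \<in> LP" by (rule Lp_fun_cong_AE[OF assms(1)])
  with assms(1) ae show ?thesis by (simp add: cls_eq_iff)
qed

abbreviation Xtop :: "('v, 'k::{real_normed_field,euclidean_space}) tree_fun set topology" where
  "Xtop \<equiv> Lp_topology E \<rho> p"

lemma topspace_Xtop:
  "topspace (Xtop :: ('v, 'k::{real_normed_field,euclidean_space}) tree_fun set topology) = Lp_space E \<rho> p"
  unfolding Lp_topology_def by (rule Metric_space.topspace_mtopology[OF Metric_space_Lp])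

lemma openin_Xtop_ball:
  fixes f :: "('v, 'k::{real_normed_field,euclidean_space}) tree_fun"
  assumes U: "openin Xtop U" and f: "f \<in> LP" "cls f \<in> U"
  obtains e where "e > 0" "\<And>g. g \<in> LP \<Longrightarrow> mass (\<lambda>i s. f i s - g i s) < ennreal e \<Longrightarrow> cls g \<in> U"
proof -
  obtain r where r: "r > 0" "Lp_ball (cls f) r \<subseteq> U"
    using U f(2) unfolding Lp_topology_def Metric_space.openin_mtopology[OF Metric_space_Lp] by blast
  show ?thesis
  proof (rule that)
    show "r powr p > 0" using r by simp
    fix g :: "('v, 'k) tree_fun" assume g: "g \<in> LP" "mass (\<lambda>i s. f i s - g i s) < ennreal (r powr p)"
    then have "cls g \<in> Lp_ball (cls f) r"
      using f(1) r(1) by (simp add: Metric_space.in_mball[OF Metric_space_Lp] cls_in_space Lp_dist_less_iff)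
    with r(2) show "cls g \<in> U" by blast
  qed
qed

lemma openin_Xtop_tame:
  fixes U :: "('v, 'k::{real_normed_field,euclidean_space}) tree_fun set set"
  assumes U: "openin Xtop U" "F \<in> U"
  obtains y where "tame y" "cls y \<in> U"
proof -
  have "F \<in> Lp_space E \<rho> p" using openin_subset[OF U(1)] U(2) topspace_Xtop by blast
  then obtain f where f: "f \<in> LP" "F = cls f" by (rule space_cls)
  obtain e where e: "e > 0" "\<And>g. g \<in> LP \<Longrightarrow> mass (\<lambda>i s. f i s - g i s) < ennreal e \<Longrightarrow> cls g \<in> U"
    by (rule openin_Xtop_ball[OF U(1) f(1) U(2)[unfolded f(2)]]) blast
  obtain y where "tame y" "mass (\<lambda>i s. f i s - y i s) < ennreal e"
    using tame_dense[where 'k = 'k] f(1) e(1) by blast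
  with e(2) tame_Lp_fun that show ?thesis by blast
qed

text \<open>If \<open>u\<close> represents a point of the first open set and \<open>w\<close> one of the second, then \<open>u + x\<close> with a
  small preimage \<open>x\<close> of \<open>w\<close> stays in the first set and is sent to \<open>w\<close>, since a late translation
  annihilates \<open>u\<close>.\<close>

lemma spreads_imp_weakly_mixing:
  assumes sp: spreads
  shows "weakly_mixing (Xtop :: ('v, 'k::{real_normed_field,euclidean_space}) tree_fun set topology)
    (flow)"
  unfolding weakly_mixing_def topologically_transitive_def
proof (intro allI impI)
  fix U W :: "(('v, 'k) tree_fun set \<times> ('v, 'k) tree_fun set) set"
  assume "openin (prod_topology Xtop Xtop) U \<and> U \<noteq> {} \<and> openin (prod_topology Xtop Xtop) W \<and> W \<noteq> {}"
  then have U: "openin (prod_topology Xtop Xtop) U" "U \<noteq> {}"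
    and W: "openin (prod_topology Xtop Xtop) W" "W \<noteq> {}" by auto
  have rect: "\<exists>A A'. openin Xtop A \<and> openin Xtop A' \<and> A \<noteq> {} \<and> A' \<noteq> {} \<and> A \<times> A' \<subseteq> S"
    if "openin (prod_topology Xtop Xtop) S" "S \<noteq> {}"
    for S :: "(('v, 'k) tree_fun set \<times> ('v, 'k) tree_fun set) set"
  proof -
    from that(2) obtain a b where ab: "(a, b) \<in> S" by auto
    from that(1)[unfolded openin_prod_topology_alt, rule_format, OF ab]
    obtain A A' where "openin Xtop A" "openin Xtop A'" "a \<in> A" "b \<in> A'" "A \<times> A' \<subseteq> S"
      by (elim exE conjE)
    moreover from this have "A \<noteq> {}" "A' \<noteq> {}" by auto
    ultimately show ?thesis by (intro exI[of _ A] exI[of _ A'] conjI)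
  qed
  obtain U1 U2 where U12: "openin Xtop U1" "openin Xtop U2" "U1 \<noteq> {}" "U2 \<noteq> {}" "U1 \<times> U2 \<subseteq> U"
    using rect[OF U] by blast
  obtain W1 W2 where W12: "openin Xtop W1" "openin Xtop W2" "W1 \<noteq> {}" "W2 \<noteq> {}" "W1 \<times> W2 \<subseteq> W"
    using rect[OF W] by blast
  have pick: "\<exists>y. tame y \<and> cls y \<in> A" if "openin Xtop A" "A \<noteq> {}" for A :: "('v, 'k) tree_fun set set"
    using that openin_Xtop_tame[OF that(1)] by blast
  obtain u1 where u1: "tame u1" "cls u1 \<in> U1" using pick[OF U12(1,3)] by blast
  obtain u2 where u2: "tame u2" "cls u2 \<in> U2" using pick[OF U12(2,4)] by blast
  obtain w1 where w1: "tame w1" "cls w1 \<in> W1" using pick[OF W12(1,3)] by blast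
  obtain w2 where w2: "tame w2" "cls w2 \<in> W2" using pick[OF W12(2,4)] by blast
  obtain e1 where e1: "e1 > 0" "\<And>g. g \<in> LP \<Longrightarrow> mass (\<lambda>i s. u1 i s - g i s) < ennreal e1 \<Longrightarrow> cls g \<in> U1"
    by (rule openin_Xtop_ball[OF U12(1) tame_Lp_fun[OF u1(1)] u1(2)]) blast
  obtain e2 where e2: "e2 > 0" "\<And>g. g \<in> LP \<Longrightarrow> mass (\<lambda>i s. u2 i s - g i s) < ennreal e2 \<Longrightarrow> cls g \<in> U2"
    by (rule openin_Xtop_ball[OF U12(2) tame_Lp_fun[OF u2(1)] u2(2)]) blast
  obtain d1 where d1: "\<And>n i j s. d1 < n \<Longrightarrow> i \<in> E \<Longrightarrow> j \<in> reach E n i \<Longrightarrow> u1 j s = 0"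
    by (rule tame_depth[OF u1(1)]) blast
  obtain d2 where d2: "\<And>n i j s. d2 < n \<Longrightarrow> i \<in> E \<Longrightarrow> j \<in> reach E n i \<Longrightarrow> u2 j s = 0"
    by (rule tame_depth[OF u2(1)]) blast
  have e: "min e1 e2 > 0" using e1(1) e2(1) by simp
  from translation_right_inverses[OF sp w1(1) w2(1) e, of "Suc (max d1 d2)"]
  obtain n where n: "n \<ge> Suc (max d1 d2)" and inv: "\<forall>v\<in>{w1, w2}. \<exists>x. tame x \<and> mass x < ennreal (min e1 e2) \<and>
    (\<forall>i\<in>E. \<forall>s\<in>{0..<1}. shift n x i s = v i s) \<and>
    (\<forall>j s. x j s \<noteq> 0 \<longrightarrow> (\<exists>i\<in>E. j \<in> reach E n i))"
    by (elim exE conjE)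
  have orbit: "\<exists>F\<in>A. flow (real n) F = cls w"
    if u: "tame u" and x: "tame x" "mass x < ennreal e" "\<And>i s. i \<in> E \<Longrightarrow> s \<in> {0..<1} \<Longrightarrow> shift n x i s = w i s"
      and A: "\<And>g. g \<in> LP \<Longrightarrow> mass (\<lambda>i s. u i s - g i s) < ennreal e \<Longrightarrow> cls g \<in> A"
      and d: "\<And>i j s. i \<in> E \<Longrightarrow> j \<in> reach E n i \<Longrightarrow> u j s = 0"
    for u x w :: "('v, 'k) tree_fun" and e :: real and A
  proof -
    define g where "g = (\<lambda>j s. u j s + x j s)"
    have g: "g \<in> LP" unfolding g_def by (rule tame_Lp_fun[OF tame_add[OF u x(1)]])
    have "mass (\<lambda>i s. u i s - g i s) < ennreal e" using x(2) mass_uminus[of x] by (simp add: g_def)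
    then have "cls g \<in> A" by (rule A[OF g])
    moreover have "flow (real n) (cls g) = cls w"
      unfolding flow_cls[OF g]
    proof (rule cls_eq_of_eq[OF left_translation_Lp_fun[OF g]])
      fix i s assume i: "i \<in> E" and s: "s \<in> {0..<1::real}"
      have "shift n u i s = 0"
        unfolding left_translation_nat[OF s] using d[OF i] by (rule infsum_0)
      then show "shift n g i s = w i s"
        unfolding g_def using left_translation_add[OF s tame_summable_on[OF u] tame_summable_on[OF x(1)]] x(3)[OF i s]
        by simp
    qed
    ultimately show ?thesis by blast
  qed
  have less: "mass x < ennreal e1" "mass x < ennreal e2" if "mass x < ennreal (min e1 e2)" for x :: "('v, 'k) tree_fun"
    using that e1(1) e2(1) by (auto intro: less_le_trans ennreal_leI)
  obtain x1 where x1: "tame x1" "mass x1 < ennreal (min e1 e2)"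
    "\<And>i s. i \<in> E \<Longrightarrow> s \<in> {0..<1} \<Longrightarrow> shift n x1 i s = w1 i s"
    using inv by blast
  obtain x2 where x2: "tame x2" "mass x2 < ennreal (min e1 e2)"
    "\<And>i s. i \<in> E \<Longrightarrow> s \<in> {0..<1} \<Longrightarrow> shift n x2 i s = w2 i s"
    using inv by blast
  have image1: "\<exists>F\<in>U1. flow (real n) F = cls w1"
  proof (rule orbit[OF u1(1) x1(1) less(1)[OF x1(2)]])
    show "shift n x1 i s = w1 i s" if "i \<in> E" "s \<in> {0..<1}" for i s
      using that by (rule x1(3))
    show "cls g \<in> U1" if "g \<in> LP" "mass (\<lambda>i s. u1 i s - g i s) < ennreal e1" for g
      using that by (rule e1(2))
    show "u1 j s = 0" if "i \<in> E" "j \<in> reach E n i" for i j s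
      using n that by (intro d1) auto
  qed
  obtain F1 where F1: "F1 \<in> U1" "flow (real n) F1 = cls w1"
    using image1 by blast
  have image2: "\<exists>F\<in>U2. flow (real n) F = cls w2"
  proof (rule orbit[OF u2(1) x2(1) less(2)[OF x2(2)]])
    show "shift n x2 i s = w2 i s" if "i \<in> E" "s \<in> {0..<1}" for i s
      using that by (rule x2(3))
    show "cls g \<in> U2" if "g \<in> LP" "mass (\<lambda>i s. u2 i s - g i s) < ennreal e2" for g
      using that by (rule e2(2))
    show "u2 j s = 0" if "i \<in> E" "j \<in> reach E n i" for i j s
      using n that by (intro d2) auto
  qed
  obtain F2 where F2: "F2 \<in> U2" "flow (real n) F2 = cls w2"
    using image2 by blast
  have "(F1, F2) \<in> U" using F1 F2 U12(5) by blast
  moreover have "map_prod (flow (real n)) (flow (real n)) (F1, F2) \<in> W"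
    using F1 F2 w1(2) w2(2) W12(5) by auto
  ultimately have "map_prod (flow (real n)) (flow (real n)) ` U \<inter> W \<noteq> {}"
    by blast
  then show "\<exists>t\<ge>0. map_prod (flow t) (flow t) ` U \<inter> W \<noteq> {}"
    by (intro exI[of _ "real n"]) simp
qed

end

section \<open>A vector with dense orbit\<close>

lemma sum_half_powers_le:
  assumes "finite L" "L \<subseteq> {k<..}"
  shows "(\<Sum>l\<in>L. (1 / 2 :: real) ^ l) \<le> (1 / 2) ^ k"
proof -
  have tel: "(\<Sum>l\<in>{Suc k..<Suc k + m}. (1 / 2 :: real) ^ l) + (1 / 2) ^ (k + m) = (1 / 2) ^ k" for m
    by (induction m) (simp_all add: field_simps)
  obtain M where M: "\<And>l. l \<in> L \<Longrightarrow> l < M" using finite_nat_bounded[OF assms(1)] by auto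
  have "L \<subseteq> {Suc k..<Suc k + M}" using M assms(2) by fastforce
  then have "(\<Sum>l\<in>L. (1 / 2 :: real) ^ l) \<le> (\<Sum>l\<in>{Suc k..<Suc k + M}. (1 / 2) ^ l)"
    by (intro sum_mono2) auto
  also have "\<dots> \<le> (1 / 2) ^ k"
    using tel[of M] zero_le_power[of "1 / 2 :: real" "k + M"] by linarith
  finally show ?thesis .
qed

context controlled_weight
begin

text \<open>The vector is \<open>f = \<Sum>\<^sub>l x\<^sub>l\<close> with preimages \<open>x\<^sub>l\<close> of the targets \<open>y\<^sub>l\<close> at times \<open>n\<^sub>l\<close>. Each \<open>n\<^sub>l\<close>
  exceeds the depth of all earlier terms, so these are annihilated by the translation by \<open>n\<^sub>l\<close>, and
  the supports of the terms are disjoint. Each later term is so small that even after the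
  translation by \<open>n\<^sub>l\<close> the tail has mass at most \<open>(1 / 2) ^ l\<close>. Thus the translate of \<open>f\<close> by \<open>n\<^sub>l\<close>
  is \<open>y\<^sub>l\<close> up to a small error.\<close>

lemma spreads_imp_hypercyclic:
  assumes sp: spreads
  shows "hypercyclic (Xtop :: ('v, 'k::{real_normed_field,euclidean_space}) tree_fun set topology)
    (flow)"
proof -
  obtain D :: "('v, 'k) tree_fun set" where D: "countable D" "\<forall>y\<in>D. tame y"
    and dense: "\<forall>f\<in>LP. \<forall>e>0. \<exists>y\<in>D. mass (\<lambda>i s. f i s - y i s) < ennreal e"
    using tame_dense[where 'k = 'k] by (elim exE conjE)
  have "(\<lambda>i s. 0) \<in> (LP :: ('v, 'k) tree_fun set)"
    by (simp add: Lp_fun_iff edge_measurable_def)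
  then have "D \<noteq> {}" using dense zero_less_one by blast
  \<comment> \<open>Every target occurs infinitely often, so that it is met with arbitrarily small error.\<close>
  define y where "y l = from_nat_into D (fst (prod_decode l))" for l
  have y: "tame (y l)" for l unfolding y_def using from_nat_into[OF \<open>D \<noteq> {}\<close>] D(2) by blast
  \<comment> \<open>A state consists of a time \<open>n\<close>, a bound \<open>d\<close> for the depth of the terms so far, and a term \<open>x\<close>.\<close>
  define good where "good l st \<longleftrightarrow> (case st of (n, d, x) \<Rightarrow> tame x \<and>
      (\<forall>i\<in>E. \<forall>s\<in>{0..<1}. shift n x i s = y l i s) \<and>
      (\<forall>j s. x j s \<noteq> 0 \<longrightarrow> (\<exists>i\<in>E. j \<in> reach E n i)) \<and>
      (\<forall>m i j s. d < m \<longrightarrow> i \<in> E \<longrightarrow> j \<in> reach E m i \<longrightarrow> x j s = 0))"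
    for l and st :: "nat \<times> nat \<times> ('v, 'k) tree_fun"
  define successor where "successor l st st' \<longleftrightarrow> (case st of (n, d, x) \<Rightarrow> case st' of (n', d', x') \<Rightarrow>
      n < n' \<and> d < n' \<and> d \<le> d' \<and> mass x' < ennreal ((1 / 2) ^ Suc l / K (real n)))"
    for l and st st' :: "nat \<times> nat \<times> ('v, 'k) tree_fun"
  have extend: "\<exists>n d x. N \<le> n \<and> N \<le> d \<and> good l (n, d, x) \<and> mass x < ennreal e" if "e > 0" for N l e
  proof -
    from translation_right_inverses[OF sp y y \<open>e > 0\<close>, of N l l]
    obtain n where n: "N \<le> n" and "\<forall>v\<in>{y l, y l}. \<exists>x. tame x \<and> mass x < ennreal e \<and>
      (\<forall>i\<in>E. \<forall>s\<in>{0..<1}. shift n x i s = v i s) \<and>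
      (\<forall>j s. x j s \<noteq> 0 \<longrightarrow> (\<exists>i\<in>E. j \<in> reach E n i))" by (elim exE conjE)
    then obtain x where x: "tame x" "mass x < ennreal e"
      "\<forall>i\<in>E. \<forall>s\<in>{0..<1}. shift n x i s = y l i s"
      "\<forall>j s. x j s \<noteq> 0 \<longrightarrow> (\<exists>i\<in>E. j \<in> reach E n i)" by auto
    obtain d where d: "\<And>n i j s. d < n \<Longrightarrow> i \<in> E \<Longrightarrow> j \<in> reach E n i \<Longrightarrow> x j s = 0"
      by (rule tame_depth[OF x(1)]) blast
    have "good l (n, max N d, x)" unfolding good_def using x d by auto
    with n x(2) show ?thesis by (meson max.cobounded1)
  qed
  have "\<exists>st. \<forall>l. good l (st l) \<and> successor l (st l) (st (Suc l))"
  proof (rule dependent_nat_choice)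
    show "\<exists>st. good 0 st" using extend[OF zero_less_one, of 0 0] by blast
    fix st l assume "good l st"
    obtain n d x where st: "st = (n, d, x)" by (cases st)
    have "(1 / 2) ^ Suc l / K (real n) > 0" using K_pos by simp
    from extend[OF this, of "Suc (max n d)" "Suc l"]
    obtain n' d' x' where "Suc (max n d) \<le> n'" "Suc (max n d) \<le> d'" "good (Suc l) (n', d', x')"
      "mass x' < ennreal ((1 / 2) ^ Suc l / K (real n))" by (elim exE conjE)
    then have "good (Suc l) (n', d', x') \<and> successor l st (n', d', x')"
      unfolding successor_def st by auto
    then show "\<exists>st'. good (Suc l) st' \<and> successor l st st'" by blast
  qed
  then obtain st where st: "\<And>l. good l (st l)" "\<And>l. successor l (st l) (st (Suc l))" by blast
  define n where "n l = fst (st l)" for l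
  define d where "d l = fst (snd (st l))" for l
  define x where "x l = snd (snd (st l))" for l
  have st_eq: "st l = (n l, d l, x l)" for l by (simp add: n_def d_def x_def)
  have x_tame: "tame (x l)" and x_inv: "\<And>i s. i \<in> E \<Longrightarrow> s \<in> {0..<1} \<Longrightarrow> shift (n l) (x l) i s = y l i s"
    and x_supp: "\<And>j s. x l j s \<noteq> 0 \<Longrightarrow> \<exists>i\<in>E. j \<in> reach E (n l) i"
    and x_deep: "\<And>m i j s. d l < m \<Longrightarrow> i \<in> E \<Longrightarrow> j \<in> reach E m i \<Longrightarrow> x l j s = 0" for l
    using st(1)[of l] unfolding st_eq good_def prod.case by blast+
  have n_step: "n l < n (Suc l)" and d_n: "d l < n (Suc l)" and d_step: "d l \<le> d (Suc l)"
    and x_mass: "mass (x (Suc l)) < ennreal ((1 / 2) ^ Suc l / K (real (n l)))" for l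
    using st(2)[of l] unfolding st_eq successor_def prod.case by blast+
  have n_mono: "n l \<le> n k" if "l \<le> k" for l k
    by (rule lift_Suc_mono_le[of n]) (use n_step that in \<open>auto intro: less_imp_le\<close>)
  have d_mono: "d l \<le> d k" if "l \<le> k" for l k
    by (rule lift_Suc_mono_le[of d]) (use d_step that in auto)
  have early_zero: "x l j s = 0" if lk: "l < k" and ij: "i \<in> E" "j \<in> reach E (n k) i" for l k i j s
  proof -
    obtain k' where k': "k = Suc k'" using lk by (cases k) auto
    then have "d l < n k" using d_mono[of l k'] d_n[of k'] lk by simp
    then show ?thesis using x_deep ij by blast
  qed
  have unique: "l = k" if "x l j s \<noteq> 0" "x k j s' \<noteq> 0" for l k j s s'
  proof -
    have "\<not> l < k" using early_zero[of l k _ j s] x_supp[OF that(2)] that(1) by blast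
    moreover have "\<not> k < l" using early_zero[of k l _ j s'] x_supp[OF that(1)] that(2) by blast
    ultimately show ?thesis by simp
  qed
  \<comment> \<open>The index of the only term that may be nonzero on edge \<open>j\<close>, which makes the series a pointwise
    defined function.\<close>
  define lev where "lev j = (SOME l. \<exists>s. x l j s \<noteq> 0)" for j
  have lev: "lev j = l" if "x l j s \<noteq> 0" for j l s
  proof -
    have "\<exists>s. x (lev j) j s \<noteq> 0" unfolding lev_def by (rule someI[of _ l]) (use that in blast)
    then show ?thesis using unique that by blast
  qed
  define f where "f j s = x (lev j) j s" for j s
  define r where "r k j s = (if k < lev j then f j s else 0)" for k j s
  have x_meas: "edge_measurable (x l)" for l using x_tame[of l] by (simp add: tame_def)
  have r_meas: "edge_measurable (r k)" for k
    unfolding edge_measurable_def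
  proof
    fix j assume j: "j \<in> E"
    have "r k j = (if k < lev j then x (lev j) j else (\<lambda>_. 0))" by (simp add: r_def f_def fun_eq_iff)
    then show "r k j \<in> borel_measurable unit_leb" using edge_measurableD[OF x_meas j] by auto
  qed
  have tail: "mass (r k) \<le> ennreal ((1 / 2) ^ k / K (real (n k)))" for k
  proof -
    define w where "w l j = edge_mass (x l j) j" for l j
    have x_small: "mass (x l) \<le> ennreal ((1 / 2) ^ l / K (real (n k)))" if kl: "k < l" for l
    proof -
      obtain l' where l': "l = Suc l'" using kl by (cases l) auto
      have "K (real (n k)) \<le> K (real (n l'))" using kl l' by (intro K_mono) (auto intro: n_mono)
      then have "(1 / 2) ^ l / K (real (n l')) \<le> (1 / 2) ^ l / K (real (n k))"
        using K_pos by (intro divide_left_mono mult_pos_pos) auto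
      then show ?thesis using x_mass[of l'] unfolding l' by (meson ennreal_leI less_imp_le order_trans)
    qed
    show ?thesis
      unfolding Lp_mass_def
    proof (rule infsum_le_finite_sums)
      fix F assume F: "finite F" "F \<subseteq> E"
      define F' where "F' = {j \<in> F. k < lev j}"
      have F': "finite F'" "F' \<subseteq> F" using F by (auto simp: F'_def)
      have "(\<Sum>j\<in>F. edge_mass (r k j) j) = (\<Sum>j\<in>F'. w (lev j) j)"
        by (rule sum.mono_neutral_cong_right[OF F(1) F'(2)])
           (use p_pos in \<open>auto simp: F'_def r_def f_def w_def\<close>)
      also have "\<dots> = (\<Sum>l\<in>lev ` F'. \<Sum>j\<in>{j \<in> F'. lev j = l}. w (lev j) j)"
        by (rule sum.image_gen[OF F'(1)])
      also have "\<dots> \<le> (\<Sum>l\<in>lev ` F'. ennreal ((1 / 2) ^ l / K (real (n k))))"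
      proof (rule sum_mono)
        fix l assume l: "l \<in> lev ` F'"
        have "(\<Sum>j\<in>{j \<in> F'. lev j = l}. w (lev j) j) = (\<Sum>j\<in>{j \<in> F'. lev j = l}. w l j)"
          by (rule sum.cong) auto
        also have "\<dots> \<le> mass (x l)"
          unfolding Lp_mass_def w_def by (rule sum_le_infsum_ennreal) (use F F' in auto)
        also have "\<dots> \<le> ennreal ((1 / 2) ^ l / K (real (n k)))"
          by (rule x_small) (use l in \<open>auto simp: F'_def\<close>)
        finally show "(\<Sum>j\<in>{j \<in> F'. lev j = l}. w (lev j) j) \<le> ennreal ((1 / 2) ^ l / K (real (n k)))" .
      qed
      also have "\<dots> = ennreal (\<Sum>l\<in>lev ` F'. (1 / 2) ^ l / K (real (n k)))"
        using K_pos[of "real (n k)"] by (intro sum_ennreal) auto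
      also have "\<dots> \<le> ennreal ((1 / 2) ^ k / K (real (n k)))"
        unfolding sum_divide_distrib[symmetric]
        by (intro ennreal_leI divide_right_mono sum_half_powers_le)
           (use F' K_pos[of "real (n k)"] in \<open>auto simp: F'_def\<close>)
      finally show "(\<Sum>j\<in>F. edge_mass (r k j) j) \<le>
        ennreal ((1 / 2) ^ k / K (real (n k)))" .
    qed simp
  qed
  have r_Lp: "r k \<in> LP" for k
    using r_meas tail[of k] by (auto simp: Lp_fun_iff intro: le_less_trans)
  have x_other: "x l j s = 0" if "l \<noteq> lev j" for l j s using lev that by blast
  have f_split: "f = (\<lambda>j s. x 0 j s + r 0 j s)"
  proof (intro ext)
    fix j s show "f j s = x 0 j s + r 0 j s"
      using x_other[of 0 j s] by (cases "lev j = 0") (auto simp: f_def r_def)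
  qed
  have f: "f \<in> LP"
    unfolding f_split by (rule Lp_fun_add[OF tame_Lp_fun[OF x_tame] r_Lp])
  have orbit: "mass (\<lambda>i s. shift (n k) f i s - y k i s) \<le> ennreal ((1 / 2) ^ k)" for k
  proof -
    have "AE s in unit_leb. shift (n k) f i s - y k i s = shift (n k) (r k) i s"
      if i: "i \<in> E" for i
    proof -
      have "AE s in unit_leb. s \<in> {0..<1}" by (rule AE_unit_leb_all)
      with AE_summable_on_reach[OF r_Lp i] show ?thesis
      proof eventually_elim
        fix s :: real assume sum: "(\<lambda>j. r k j s) summable_on reach E (n k) i" and s: "s \<in> {0..<1}"
        have "f j s = x k j s + r k j s" if j: "j \<in> reach E (n k) i" for j
        proof (cases "lev j" k rule: linorder_cases)
          case less
          then show ?thesis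
            using early_zero[OF less i j, of s] x_other[of k j s] by (simp add: f_def r_def)
        next
          case equal
          then show ?thesis by (simp add: f_def r_def)
        next
          case greater
          then show ?thesis using x_other[of k j s] by (simp add: r_def)
        qed
        then have "shift (n k) f i s =
            shift (n k) (\<lambda>j s. x k j s + r k j s) i s"
          unfolding left_translation_nat[OF s] by (rule infsum_cong)
        also have "\<dots> = shift (n k) (x k) i s + shift (n k) (r k) i s"
          using s tame_summable_on[OF x_tame] sum by (rule left_translation_add)
        finally show "shift (n k) f i s - y k i s = shift (n k) (r k) i s"
          using x_inv[OF i s] by simp
      qed
    qed
    then have "mass (\<lambda>i s. shift (n k) f i s - y k i s) = mass (shift (n k) (r k))"
      by (rule mass_cong_AE)
    also have "\<dots> \<le> ennreal (K (real (n k))) * mass (r k)" by (rule mass_left_translation_le[OF r_meas])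
    also have "\<dots> \<le> ennreal (K (real (n k))) * ennreal ((1 / 2) ^ k / K (real (n k)))"
      by (intro mult_left_mono tail) simp
    also have "\<dots> = ennreal ((1 / 2) ^ k)"
      using K_pos[of "real (n k)"] by (simp add: ennreal_mult'[symmetric])
    finally show ?thesis .
  qed
  let ?S = "(\<lambda>t. flow t (cls f)) ` {0..}"
  have close: "\<exists>G\<in>?S. G \<in> Lp_ball H e"
    if H: "H \<in> Lp_space E \<rho> p" and e: "e > 0" for H :: "('v, 'k) tree_fun set" and e
  proof -
    obtain g where g: "g \<in> LP" "H = cls g" using space_cls[OF H] by blast
    define c where "c = e powr p / (2 powr p * 2)"
    have c: "c > 0" "2 powr p * c + 2 powr p * c = e powr p" using e by (simp_all add: c_def)
    obtain z where z: "z \<in> D" "mass (\<lambda>i s. g i s - z i s) < ennreal c" using dense g(1) c(1) by blast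
    obtain a where a: "from_nat_into D a = z" using from_nat_into_surj[OF D(1) z(1)] by blast
    obtain b where b: "(1 / 2) ^ b < c" using real_arch_pow_inv[OF c(1), of "1 / 2"] by auto
    define k where "k = prod_encode (a, b)"
    have yk: "y k = z" by (simp add: y_def k_def a)
    have "(1 / 2 :: real) ^ k \<le> (1 / 2) ^ b"
      by (rule power_decreasing) (auto simp: k_def le_prod_encode_2)
    then have "ennreal ((1 / 2) ^ k) < ennreal c" using b c(1) by (intro ennreal_lessI) linarith+
    then have small: "mass (\<lambda>i s. shift (n k) f i s - z i s) < ennreal c"
      by (rule le_less_trans[OF orbit[of k, unfolded yk]])
    let ?T = "shift (n k) f"
    have T: "?T \<in> LP" by (rule left_translation_Lp_fun[OF f])
    have zL: "z \<in> LP" using z(1) D(2) by (intro tame_Lp_fun) blast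
    have "mass (\<lambda>i s. g i s - ?T i s) = mass (\<lambda>i s. (g i s - z i s) + (z i s - ?T i s))" by simp
    also have "\<dots> \<le> ennreal (2 powr p) * mass (\<lambda>i s. g i s - z i s) + ennreal (2 powr p) * mass (\<lambda>i s. z i s - ?T i s)"
      using Lp_fun_diff[OF g(1) zL] Lp_fun_diff[OF zL T] by (intro mass_add_le) (simp_all add: Lp_fun_iff)
    also have "mass (\<lambda>i s. z i s - ?T i s) = mass (\<lambda>i s. ?T i s - z i s)"
      using mass_uminus[of "\<lambda>i s. ?T i s - z i s"] by simp
    also have "ennreal (2 powr p) * mass (\<lambda>i s. g i s - z i s) + ennreal (2 powr p) * mass (\<lambda>i s. ?T i s - z i s)
        < ennreal (2 powr p) * ennreal c + ennreal (2 powr p) * ennreal c"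
      using z(2) small by (intro add_strict_mono ennreal_mult_strict_left_mono) auto
    also have "\<dots> = ennreal (e powr p)"
      using c by (simp add: ennreal_mult[symmetric] ennreal_plus[symmetric] del: ennreal_plus)
    finally have "Lp_dist E \<rho> p (cls g) (cls ?T) < e" using Lp_dist_less_iff[OF g(1) T e] by simp
    then have "cls ?T \<in> Lp_ball H e"
      using g T by (simp add: Metric_space.in_mball[OF Metric_space_Lp] cls_in_space)
    moreover have "cls ?T \<in> ?S"
      using flow_cls[OF f, of "n k"] by (intro image_eqI[of _ _ "real (n k)"]) auto
    ultimately show ?thesis by blast
  qed
  show ?thesis
    unfolding hypercyclic_def
  proof (rule bexI[of _ "cls f"])
    show "cls f \<in> topspace Xtop" unfolding topspace_Xtop by (rule cls_in_space[OF f])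
    show "Xtop closure_of ?S = topspace Xtop"
      unfolding topspace_Xtop unfolding Lp_topology_def Metric_space.metric_closure_of[OF Metric_space_Lp]
      using close by blast
  qed
qed

section \<open>From dynamics to small cost\<close>

lemma constant_tame:
  fixes a :: "'k::{real_normed_field,euclidean_space}"
  assumes "finite F" "F \<subseteq> E"
  shows "tame (\<lambda>i s. if i \<in> F then a else 0)"
proof -
  have "edge_measurable (\<lambda>i s. if i \<in> F then a else 0)" by (simp add: edge_measurable_def)
  moreover have "norm (if i \<in> F then a else 0) \<le> norm a" for i by simp
  ultimately show ?thesis unfolding tame_def using assms by (intro conjI exI[of _ "norm a"] exI[of _ F]) auto
qed

text \<open>As soon as the image of a class under the semigroup is an element of the space, some member of
  the class has a translate with finite mass, and the local estimate can be applied to it.\<close>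

lemma near_translate:
  assumes f: "f \<in> LP" and g: "g \<in> LP"
    and T: "flow t (cls f) \<in> Lp_ball (cls g) 1"
  obtains f' where "edge_measurable f'" "mass f' = mass f" "edge_measurable (left_translation E t f')"
    "mass (\<lambda>i s. left_translation E t f' i s - g i s) \<le> 1"
proof -
  let ?G = "flow t (cls f)"
  have G: "?G \<in> Lp_space E \<rho> p" "Lp_dist E \<rho> p (cls g) ?G < 1"
    using T by (simp_all add: Metric_space.in_mball[OF Metric_space_Lp])
  obtain h where h: "h \<in> LP" "?G = cls h" using space_cls[OF G(1)] by blast
  have "h \<in> ?G" unfolding h(2) using h(1) by (simp add: in_cls_iff)
  then obtain f' where f': "f' \<in> cls f" "(left_translation E t f', h) \<in> Lp_ae E \<rho> p"
    unfolding translation_semigroup_def by blast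
  then have L: "left_translation E t f' \<in> LP"
    and ae: "\<And>i. i \<in> E \<Longrightarrow> AE s in unit_leb. left_translation E t f' i s = h i s"
    by (auto simp: Lp_ae_def)
  have "mass (\<lambda>i s. left_translation E t f' i s - g i s) = mass (\<lambda>i s. h i s - g i s)"
  proof (rule mass_cong_AE)
    fix i assume "i \<in> E"
    from ae[OF this] show "AE s in unit_leb. left_translation E t f' i s - g i s = h i s - g i s"
      by eventually_elim simp
  qed
  also have "\<dots> = mass (\<lambda>i s. g i s - h i s)"
    using mass_uminus[of "\<lambda>i s. g i s - h i s"] by simp
  also have "\<dots> < ennreal (1 powr p)"
    using G(2) unfolding h(2) using Lp_dist_less_iff[OF g h(1), of 1] by simp
  finally have "mass (\<lambda>i s. left_translation E t f' i s - g i s) \<le> 1" by simp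
  moreover have "mass f' = mass f" using f'(1) by (intro mass_cong_AE) (auto simp: in_cls_iff eq_commute)
  moreover have "edge_measurable f'" "edge_measurable (left_translation E t f')"
    using f'(1) L by (auto simp: in_cls_iff Lp_fun_iff)
  ultimately show ?thesis using that by blast
qed

lemma hypercyclic_imp_reaches_large_constants:
  assumes hyp: "hypercyclic (Xtop :: ('v, 'k::{real_normed_field,euclidean_space}) tree_fun set topology)
    (flow)"
  shows "\<exists>R\<ge>0. reaches_large_constants TYPE('k) R"
proof -
  obtain X :: "('v, 'k) tree_fun set" where X: "X \<in> topspace Xtop"
    and closure: "Xtop closure_of ((\<lambda>t. flow t X) ` {0..}) = topspace Xtop"
    using hyp unfolding hypercyclic_def by blast
  obtain f where f: "f \<in> LP" "X = cls f" using X space_cls unfolding topspace_Xtop by blast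
  have "mass f < \<infinity>" using f(1) by (simp add: Lp_fun_iff)
  then obtain R where R: "mass f = ennreal R" "R \<ge> 0" by (cases "mass f") auto
  have "\<exists>(f :: ('v, 'k) tree_fun) t. t \<ge> 0 \<and> edge_measurable f \<and> edge_measurable (left_translation E t f) \<and>
        mass f \<le> ennreal R \<and>
        mass (\<lambda>i s. left_translation E t f i s - (if i \<in> F then of_real r else 0)) \<le> 1"
    if F: "finite F" "F \<subseteq> E" for F r
  proof -
    define g :: "('v, 'k) tree_fun" where "g = (\<lambda>i s. if i \<in> F then of_real r else 0)"
    have g: "g \<in> LP" unfolding g_def by (rule tame_Lp_fun[OF constant_tame[OF F]])
    have "cls g \<in> Xtop closure_of ((\<lambda>t. flow t X) ` {0..})"
      unfolding closure topspace_Xtop by (rule cls_in_space[OF g])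
    then have "\<exists>y\<in>(\<lambda>t. flow t X) ` {0..}.
        y \<in> Lp_ball (cls g) 1"
      unfolding Lp_topology_def Metric_space.metric_closure_of[OF Metric_space_Lp] by simp
    then obtain t where t: "t \<ge> 0"
      "flow t (cls f) \<in> Lp_ball (cls g) 1"
      unfolding f(2) by auto
    obtain f' where f': "edge_measurable f'" "mass f' = mass f" "edge_measurable (left_translation E t f')"
      "mass (\<lambda>i s. left_translation E t f' i s - g i s) \<le> 1"
      by (rule near_translate[OF f(1) g t(2)])
    then show ?thesis using t(1) R(1) unfolding g_def
      by (intro exI[of _ f'] exI[of _ t] conjI) simp_all
  qed
  then have "reaches_large_constants TYPE('k) R" unfolding reaches_large_constants_def by blast
  with R(2) show ?thesis by blast
qed

lemma weakly_mixing_imp_reaches_large_constants: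
  assumes mix: "weakly_mixing (Xtop :: ('v, 'k::{real_normed_field,euclidean_space}) tree_fun set topology)
    (flow)"
  shows "reaches_large_constants TYPE('k) 1"
  unfolding reaches_large_constants_def
proof (intro allI impI)
  fix F and r :: real assume "finite F \<and> F \<subseteq> E \<and> 0 < r"
  then have F: "finite F" "F \<subseteq> E" by auto
  define g :: "('v, 'k) tree_fun" where "g = (\<lambda>i s. if i \<in> F then of_real r else 0)"
  have g: "g \<in> LP" unfolding g_def by (rule tame_Lp_fun[OF constant_tame[OF F]])
  define z :: "('v, 'k) tree_fun" where "z = (\<lambda>i s. 0)"
  have z: "z \<in> LP" by (simp add: z_def Lp_fun_iff edge_measurable_def)
  let ?B = "\<lambda>h. Lp_ball (cls h) 1"
  have op: "openin Xtop (?B h)" for h :: "('v, 'k) tree_fun"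
    unfolding Lp_topology_def by (rule Metric_space.openin_mball[OF Metric_space_Lp])
  have mem: "cls h \<in> ?B h" if "h \<in> LP" for h :: "('v, 'k) tree_fun"
    using cls_in_space[OF that] by (simp add: Metric_space.centre_in_mball_iff[OF Metric_space_Lp])
  have "openin (prod_topology Xtop Xtop) (?B z \<times> ?B z)" "openin (prod_topology Xtop Xtop) (?B g \<times> ?B g)"
    using op by (simp_all add: openin_prod_Times_iff)
  moreover have "?B z \<times> ?B z \<noteq> {}" "?B g \<times> ?B g \<noteq> {}" using mem[OF z] mem[OF g] by blast+
  ultimately have "\<exists>t\<ge>0. map_prod (flow t) (flow t) `
      (?B z \<times> ?B z) \<inter> (?B g \<times> ?B g) \<noteq> {}"
    by (intro mix[unfolded weakly_mixing_def topologically_transitive_def, rule_format] conjI)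
  then obtain t where t: "t \<ge> 0"
    "map_prod (flow t) (flow t) ` (?B z \<times> ?B z) \<inter> (?B g \<times> ?B g) \<noteq> {}"
    by (elim exE conjE)
  then obtain X where X: "X \<in> ?B z" "flow t X \<in> ?B g" by auto
  have "X \<in> Lp_space E \<rho> p" using X(1) by (simp add: Metric_space.in_mball[OF Metric_space_Lp])
  then obtain f where f: "f \<in> LP" "X = cls f" by (rule space_cls)
  have "Lp_dist E \<rho> p (cls z) (cls f) < 1"
    using X(1) unfolding f(2) by (simp add: Metric_space.in_mball[OF Metric_space_Lp])
  then have "mass (\<lambda>i s. z i s - f i s) < ennreal (1 powr p)" using Lp_dist_less_iff[OF z f(1), of 1] by simp
  then have mf: "mass f \<le> 1" using mass_uminus[of f] by (simp add: z_def)
  obtain f' where f': "edge_measurable f'" "mass f' = mass f" "edge_measurable (left_translation E t f')"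
    "mass (\<lambda>i s. left_translation E t f' i s - g i s) \<le> 1"
    by (rule near_translate[OF f(1) g X(2)[unfolded f(2)]])
  then show "\<exists>(f :: ('v, 'k) tree_fun) t. t \<ge> 0 \<and> edge_measurable f \<and> edge_measurable (left_translation E t f) \<and>
        mass f \<le> ennreal 1 \<and>
        mass (\<lambda>i s. left_translation E t f i s - (if i \<in> F then of_real r else 0)) \<le> 1"
    using t(1) mf unfolding g_def by (intro exI[of _ f'] exI[of _ t] conjI) simp_all
qed

text \<open>Both dynamical properties imply the condition through large constants, and conversely the
  condition, passed from generation \<open>m + 1\<close> to generation \<open>m\<close>, yields small preimages.\<close>

lemma dynamics_iff_escape:
  fixes X defines "X \<equiv> (Xtop :: ('v, 'k::{real_normed_field,euclidean_space}) tree_fun set topology)"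
  defines "cond \<equiv> \<forall>F \<epsilon> N. finite F \<and> F \<subseteq> E \<and> \<epsilon> > 0 \<longrightarrow> (\<exists>n\<ge>N. \<forall>i\<in>F. escape n i \<epsilon>)"
  shows "hypercyclic X (flow) \<longleftrightarrow> cond"
    and "weakly_mixing X (flow) \<longleftrightarrow> cond"
proof -
  have "spreads" if c: cond
    unfolding spreads_def
  proof (intro allI impI)
    fix F \<epsilon> and N :: nat assume A: "finite F \<and> F \<subseteq> E \<and> (\<epsilon>::real) > 0"
    then have "\<epsilon> / K 2 > 0" using K_pos by simp
    then obtain n where n: "n \<ge> Suc N" "\<forall>i\<in>F. escape n i (\<epsilon> / K 2)"
      using c A unfolding cond_def by blast
    obtain m where m: "n = Suc m" "m \<ge> N" using n(1) by (cases n) auto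
    have "thin m i \<epsilon>" if "i \<in> F" for i
      using escape_Suc_imp_thin[of i m "\<epsilon> / K 2"] n(2) that A K_pos[of 2] unfolding m(1) by auto
    with m(2) show "\<exists>n\<ge>N. \<forall>i\<in>F. thin n i \<epsilon>" by blast
  qed
  moreover have "cond" if "reaches_large_constants TYPE('k) R" "R \<ge> 0" for R
    unfolding cond_def using reaches_large_constants_imp_escape[OF that] by blast
  ultimately show "hypercyclic X (flow) \<longleftrightarrow> cond"
    and "weakly_mixing X (flow) \<longleftrightarrow> cond"
    using spreads_imp_hypercyclic[where 'k = 'k] spreads_imp_weakly_mixing[where 'k = 'k]
      hypercyclic_imp_reaches_large_constants[where 'k = 'k]
      weakly_mixing_imp_reaches_large_constants[where 'k = 'k] zero_le_one
    unfolding X_def by blast+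
qed

end

section \<open>Admissible weights\<close>

text \<open>Hoelder's inequality for finite sums, as Jensen's inequality for \<open>x powr p\<close> at the points
  \<open>c j / w j\<close> with weights proportional to \<open>w j = a j powr (- 1 / (p - 1))\<close>.\<close>

lemma weighted_holder:
  fixes a c :: "'a \<Rightarrow> real"
  assumes p: "p > 1" and J: "finite J" and a: "\<And>j. j \<in> J \<Longrightarrow> a j > 0" and c: "\<And>j. j \<in> J \<Longrightarrow> c j \<ge> 0"
  shows "(\<Sum>j\<in>J. c j) powr p \<le>
    (\<Sum>j\<in>J. a j powr (- 1 / (p - 1))) powr (p - 1) * (\<Sum>j\<in>J. a j * c j powr p)"
proof (cases "J = {}")
  case False
  define w where "w j = a j powr (- 1 / (p - 1))" for j
  define W where "W = sum w J"
  have w: "w j > 0" if "j \<in> J" for j using a[OF that] by (simp add: w_def)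
  have W: "W > 0" unfolding W_def using J False w by (intro sum_pos) auto
  have "(\<Sum>j\<in>J. (w j / W) *\<^sub>R (c j / w j)) powr p \<le> (\<Sum>j\<in>J. (w j / W) * (c j / w j) powr p)"
  proof (rule convex_on_sum[OF J False powr_convex_nonneg])
    show "(\<Sum>j\<in>J. w j / W) = 1" using W by (simp add: sum_divide_distrib[symmetric] W_def[symmetric])
    show "0 \<le> w j / W" "c j / w j \<in> {0..}" if "j \<in> J" for j using w[OF that] W c[OF that] by auto
  qed (use p in auto)
  also have "(\<Sum>j\<in>J. (w j / W) *\<^sub>R (c j / w j)) = (\<Sum>j\<in>J. c j) / W"
    unfolding sum_divide_distrib using w by (intro sum.cong) (auto simp: less_imp_neq[symmetric])
  also have "(\<Sum>j\<in>J. (w j / W) * (c j / w j) powr p) = (\<Sum>j\<in>J. a j * c j powr p) / W"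
    unfolding sum_divide_distrib
  proof (rule sum.cong)
    fix j assume j: "j \<in> J"
    have "w j powr (1 - p) = a j powr (- 1 / (p - 1) * (1 - p))"
      unfolding w_def by (rule powr_powr)
    also have "- 1 / (p - 1) * (1 - p) = 1" using p by (simp add: field_simps)
    finally have aj: "w j powr (1 - p) = a j" using a[OF j] by simp
    have "w j * (c j / w j) powr p = w j powr (1 - p) * c j powr p"
      using w[OF j] c[OF j] by (simp add: powr_divide powr_diff)
    then show "(w j / W) * (c j / w j) powr p = a j * c j powr p / W" unfolding aj by simp
  qed simp
  finally have "(\<Sum>j\<in>J. c j) powr p / W powr p \<le> (\<Sum>j\<in>J. a j * c j powr p) / W"
    using W c by (simp add: powr_divide sum_nonneg)
  then have "(\<Sum>j\<in>J. c j) powr p \<le> W powr p / W * (\<Sum>j\<in>J. a j * c j powr p)"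
    using W by (simp add: field_simps)
  then show ?thesis using W by (simp add: powr_diff W_def w_def)
qed simp

text \<open>For \<open>p > 1\<close> the bound on the dual weights is converted by Hoelder's inequality; for \<open>p = 1\<close> the
  bound by the infimum is multiplied by \<open>c j\<close> and summed.\<close>

lemma admissible_controlled_weight:
  assumes E: "rooted_edges E" and p: "p \<ge> 1" and adm: "admissible E p \<rho>"
  shows "\<exists>K. controlled_weight E p \<rho> K"
proof -
  interpret rooted_edges E by (rule E)
  have weight: "\<And>i. i \<in> E \<Longrightarrow> integrable unit_leb (\<rho> i)"
    and pos: "\<And>i s. i \<in> E \<Longrightarrow> s \<in> {0..<1} \<Longrightarrow> \<rho> i s > 0"
    using adm unfolding admissible_def weight_def by auto
  from adm obtain C w where C: "C \<ge> 1" and bound: "\<And>i s t. i \<in> E \<Longrightarrow> s \<in> {0..<1} \<Longrightarrow> t \<ge> 0 \<Longrightarrow>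
        (let n = steps t s; r = s + t - real n in
        if p = 1
        then ennreal (\<rho> i s) \<le> ennreal (C * exp (w * t)) * (INF j\<in>reach E n i. ennreal (\<rho> j r))
        else (\<lambda>j. \<rho> j r powr (- 1 / (p - 1))) summable_on reach E n i \<and>
             (\<Sum>\<^sub>\<infinity>j\<in>reach E n i. \<rho> j r powr (- 1 / (p - 1))) powr (p - 1)
               \<le> C powr p * exp (p * w * t) * (1 / \<rho> i s))"
    unfolding admissible_def by blast
  define K where "K t = C powr p * exp (p * \<bar>w\<bar> * t)" for t
  have K_ge: "C powr p * exp (p * w * t) \<le> K t" if "t \<ge> 0" for t
    unfolding K_def using that p by (intro mult_left_mono) (auto intro!: mult_right_mono mult_left_mono)
  have "controlled_weight E p \<rho> K"
  proof
    show "countable E" by (rule countable_edges)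
    show "1 \<le> p" by (rule p)
    show "\<rho> i \<in> borel_measurable unit_leb" if "i \<in> E" for i
      using weight[OF that] by (rule borel_measurable_integrable)
    show "(\<integral>\<^sup>+ s. ennreal (\<rho> i s) \<partial>unit_leb) < \<infinity>" if "i \<in> E" for i
    proof -
      have "(\<integral>\<^sup>+ s. ennreal (\<rho> i s) \<partial>unit_leb) \<le> (\<integral>\<^sup>+ s. ennreal (norm (\<rho> i s)) \<partial>unit_leb)"
        by (intro nn_integral_mono ennreal_leI) simp
      also have "\<dots> < \<infinity>" using weight[OF that] by (simp add: integrable_iff_bounded)
      finally show ?thesis .
    qed
    show "0 < \<rho> i s" if "i \<in> E" "s \<in> {0..<1}" for i s using pos that .
    show "0 < K t" for t using C by (simp add: K_def)
    show "K t \<le> K t'" if "0 \<le> t" "t \<le> t'" for t t'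
      unfolding K_def using that p by (intro mult_left_mono) (auto intro!: mult_left_mono)
    fix i s t J and c :: "'a \<times> 'a \<Rightarrow> real"
    assume i: "i \<in> E" and s: "s \<in> {0..<1}" and t: "0 \<le> t" and J: "finite J" "J \<subseteq> reach E (steps t s) i"
      and c: "\<forall>j\<in>J. 0 \<le> c j"
    define r where "r = s + t - real (steps t s)"
    have "real (steps t s) = of_int \<lfloor>s + t\<rfloor>" using s t by (simp add: steps_def)
    then have r: "r \<in> {0..<1}" unfolding r_def atLeastLessThan_iff by linarith
    have rpos: "\<rho> j r > 0" if "j \<in> J" for j using that J(2) reach_subset by (intro pos r) blast
    have nonneg: "0 \<le> (\<Sum>j\<in>J. \<rho> j r * c j powr p)"
      using rpos c by (intro sum_nonneg mult_nonneg_nonneg) (auto intro: less_imp_le)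
    have "\<rho> i s * (\<Sum>j\<in>J. c j) powr p \<le> C powr p * exp (p * w * t) * (\<Sum>j\<in>J. \<rho> j r * c j powr p)"
    proof (cases "p = 1")
      case True
      have each: "\<rho> i s \<le> C * exp (w * t) * \<rho> j r" if j: "j \<in> J" for j
      proof -
        have "ennreal (\<rho> i s) \<le> ennreal (C * exp (w * t)) * (INF j\<in>reach E (steps t s) i. ennreal (\<rho> j r))"
          using bound[OF i s t] True by (simp add: Let_def r_def)
        also have "\<dots> \<le> ennreal (C * exp (w * t)) * ennreal (\<rho> j r)"
          using j J(2) by (intro mult_left_mono INF_lower) auto
        also have "\<dots> = ennreal (C * exp (w * t) * \<rho> j r)"
          using C rpos[OF j] by (intro ennreal_mult[symmetric]) auto
        finally show ?thesis using C rpos[OF j] by (subst (asm) ennreal_le_iff) auto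
      qed
      have "\<rho> i s * (\<Sum>j\<in>J. c j) = (\<Sum>j\<in>J. \<rho> i s * c j)" by (rule sum_distrib_left)
      also have "\<dots> \<le> (\<Sum>j\<in>J. C * exp (w * t) * \<rho> j r * c j)"
        using each c by (intro sum_mono mult_right_mono) auto
      also have "\<dots> = C * exp (w * t) * (\<Sum>j\<in>J. \<rho> j r * c j)"
        by (simp add: sum_distrib_left mult.assoc)
      finally show ?thesis using True C c by (simp add: sum_nonneg)
    next
      case False
      then have p1: "p > 1" using p by simp
      let ?w = "\<lambda>j. \<rho> j r powr (- 1 / (p - 1))"
      have sum: "?w summable_on reach E (steps t s) i"
        and le: "(\<Sum>\<^sub>\<infinity>j\<in>reach E (steps t s) i. ?w j) powr (p - 1) \<le> C powr p * exp (p * w * t) * (1 / \<rho> i s)"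
        using bound[OF i s t] False by (simp_all add: Let_def r_def)
      have "sum ?w J \<le> (\<Sum>\<^sub>\<infinity>j\<in>reach E (steps t s) i. ?w j)"
        by (rule finite_sum_le_infsum[OF sum J]) simp
      then have "sum ?w J powr (p - 1) \<le> (\<Sum>\<^sub>\<infinity>j\<in>reach E (steps t s) i. ?w j) powr (p - 1)"
        using p1 by (intro powr_mono2) (auto intro: sum_nonneg)
      also note le
      finally have "sum ?w J powr (p - 1) \<le> C powr p * exp (p * w * t) * (1 / \<rho> i s)" .
      then have "(\<Sum>j\<in>J. c j) powr p \<le> C powr p * exp (p * w * t) * (1 / \<rho> i s) * (\<Sum>j\<in>J. \<rho> j r * c j powr p)"
        using weighted_holder[OF p1 J(1), of "\<lambda>j. \<rho> j r" c] rpos c nonneg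
        by (meson mult_right_mono order_trans)
      then show ?thesis using pos[OF i s] by (simp add: field_simps)
    qed
    also have "\<dots> \<le> K t * (\<Sum>j\<in>J. \<rho> j r * c j powr p)"
      by (intro mult_right_mono K_ge t nonneg)
    finally show "\<rho> i s * (\<Sum>j\<in>J. c j) powr p \<le> K t * (\<Sum>j\<in>J. \<rho> j (s + t - real (steps t s)) * c j powr p)"
      unfolding r_def .
  qed
  then show ?thesis by blast
qed

section \<open>The conditions on the weight\<close>

text \<open>From right to left, \<open>n h\<close> is chosen for the finite set of the first edges in an enumeration and
  for the accuracy \<open>1 / (h + 1)\<close>.\<close>

lemma exists_common_subsequence_iff:
  fixes Q :: "nat \<Rightarrow> 'a \<Rightarrow> real \<Rightarrow> bool"
  assumes E: "countable E" and mono: "\<And>n i e e'. Q n i e \<Longrightarrow> e \<le> e' \<Longrightarrow> Q n i e'"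
  shows "(\<exists>n. strict_mono n \<and> (\<forall>i\<in>E. \<forall>e>0. eventually (\<lambda>h. Q (n h) i e) sequentially)) \<longleftrightarrow>
    (\<forall>F e N. finite F \<and> F \<subseteq> E \<and> e > 0 \<longrightarrow> (\<exists>n\<ge>N. \<forall>i\<in>F. Q n i e))"
proof
  assume "\<exists>n. strict_mono n \<and> (\<forall>i\<in>E. \<forall>e>0. eventually (\<lambda>h. Q (n h) i e) sequentially)"
  then obtain n where n: "strict_mono n" "\<forall>i\<in>E. \<forall>e>0. eventually (\<lambda>h. Q (n h) i e) sequentially" by blast
  show "\<forall>F e N. finite F \<and> F \<subseteq> E \<and> e > 0 \<longrightarrow> (\<exists>n\<ge>N. \<forall>i\<in>F. Q n i e)"
  proof (intro allI impI)
    fix F and e :: real and N :: nat assume F: "finite F \<and> F \<subseteq> E \<and> e > 0"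
    then have "eventually (\<lambda>h. \<forall>i\<in>F. Q (n h) i e) sequentially"
      using n(2) by (intro eventually_ball_finite) auto
    then have "eventually (\<lambda>h. (\<forall>i\<in>F. Q (n h) i e) \<and> h \<ge> N) sequentially"
      using eventually_ge_at_top by (rule eventually_conj)
    then obtain h where h: "\<forall>i\<in>F. Q (n h) i e" "h \<ge> N"
      using eventually_happens'[OF sequentially_bot] by blast
    have "n h \<ge> N" using strict_mono_imp_increasing[OF n(1), of h] h(2) by linarith
    with h(1) show "\<exists>n\<ge>N. \<forall>i\<in>F. Q n i e" by blast
  qed
next
  assume R: "\<forall>F e N. finite F \<and> F \<subseteq> E \<and> e > 0 \<longrightarrow> (\<exists>n\<ge>N. \<forall>i\<in>F. Q n i e)"
  define F where "F h = {i \<in> E. to_nat_on E i \<le> h}" for h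
  have F: "finite (F h)" "F h \<subseteq> E" for h
  proof -
    have "inj_on (to_nat_on E) (F h)" using inj_on_to_nat_on[OF E] by (rule inj_on_subset) (auto simp: F_def)
    moreover have "to_nat_on E ` F h \<subseteq> {..h}" by (auto simp: F_def)
    ultimately show "finite (F h)" by (meson finite_atMost finite_imageD finite_subset)
    show "F h \<subseteq> E" by (auto simp: F_def)
  qed
  have ex: "\<exists>n\<ge>N. \<forall>i\<in>F h. Q n i (inverse (real (Suc h)))" for h N
    using R F[of h] by (metis inverse_positive_iff_positive of_nat_0_less_iff zero_less_Suc)
  have "\<exists>n. \<forall>h. (\<forall>i\<in>F h. Q (n h) i (inverse (real (Suc h)))) \<and> n h < n (Suc h)"
  proof (rule dependent_nat_choice)
    show "\<exists>n. \<forall>i\<in>F 0. Q n i (inverse (real (Suc 0)))" using ex by blast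
    show "\<exists>m. (\<forall>i\<in>F (Suc h). Q m i (inverse (real (Suc (Suc h))))) \<and> n < m" for n h
      using ex[of "Suc n" "Suc h"] by (auto simp: Suc_le_eq)
  qed
  then obtain n where n: "\<And>h i. i \<in> F h \<Longrightarrow> Q (n h) i (inverse (real (Suc h)))" "\<And>h. n h < n (Suc h)" by blast
  have "eventually (\<lambda>h. Q (n h) i e) sequentially" if i: "i \<in> E" and e: "e > 0" for i e
  proof -
    have "eventually (\<lambda>h. inverse (real (Suc h)) < e) sequentially"
      by (rule order_tendstoD(2)[OF LIMSEQ_inverse_real_of_nat e])
    then show ?thesis using eventually_ge_at_top[of "to_nat_on E i"]
    proof eventually_elim
      fix h assume h: "inverse (real (Suc h)) < e" "to_nat_on E i \<le> h"
      have "i \<in> F h" using h(2) i by (simp add: F_def)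
      then show "Q (n h) i e" using mono[OF n(1)] h(1) by (meson less_imp_le)
    qed
  qed
  then show "\<exists>n. strict_mono n \<and> (\<forall>i\<in>E. \<forall>e>0. eventually (\<lambda>h. Q (n h) i e) sequentially)"
    using n(2) by (intro exI[of _ n]) (auto intro: strict_monoI_Suc)
qed

lemma ennreal_tendsto_0_iff:
  fixes f :: "nat \<Rightarrow> ennreal"
  shows "f \<longlonglongrightarrow> 0 \<longleftrightarrow> (\<forall>e>0. eventually (\<lambda>h. f h < ennreal e) sequentially)"
proof
  assume "f \<longlonglongrightarrow> 0"
  then show "\<forall>e>0. eventually (\<lambda>h. f h < ennreal e) sequentially"
    by (auto intro: order_tendstoD)
next
  assume R: "\<forall>e>0. eventually (\<lambda>h. f h < ennreal e) sequentially"
  show "f \<longlonglongrightarrow> 0"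
  proof (rule order_tendstoI)
    fix a :: ennreal assume a: "0 < a"
    obtain e where e: "e > 0" "ennreal e \<le> a"
    proof (cases a)
      case (real x)
      with a show ?thesis by (intro that[of x]) auto
    next
      case top
      then show ?thesis by (intro that[of 1]) auto
    qed
    with R have "eventually (\<lambda>h. f h < ennreal e) sequentially" by blast
    then show "eventually (\<lambda>h. f h < a) sequentially"
      by eventually_elim (use e(2) in auto)
  qed simp
qed

lemma ennreal_tendsto_infinity_iff:
  fixes f :: "nat \<Rightarrow> ennreal"
  shows "f \<longlonglongrightarrow> \<infinity> \<longleftrightarrow> (\<forall>l>0. eventually (\<lambda>h. ennreal l < f h) sequentially)"
proof -
  have "eventually (\<lambda>h. ennreal l < f h) sequentially"
    if R: "\<forall>l>0. eventually (\<lambda>h. ennreal l < f h) sequentially" and l: "l \<ge> 0" for l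
  proof -
    have "eventually (\<lambda>h. ennreal (l + 1) < f h) sequentially" using R l by (auto simp del: ennreal_plus)
    then show ?thesis
      by eventually_elim (rule le_less_trans[rotated], assumption, simp add: ennreal_leI del: ennreal_plus)
  qed
  then show ?thesis unfolding infinity_ennreal_def tendsto_top_iff_ennreal by auto
qed

context controlled_weight
begin

text \<open>For \<open>p = 1\<close> the cost is a weighted mean of the weights, so all mass may as well be put on one
  edge.\<close>

lemma escape_iff_INF:
  assumes p: "p = 1"
  shows "escape n i \<epsilon> \<longleftrightarrow> (INF j\<in>reach E n i. INF s\<in>{0..<1}. ennreal (\<rho> j s)) < ennreal \<epsilon>"
proof
  assume "escape n i \<epsilon>"
  then obtain s J c where s: "s \<in> {0..<1}" and J: "finite J" "J \<subseteq> reach E n i"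
    and c: "\<forall>j\<in>J. c j \<ge> (0::real)" "sum c J = 1" and small: "(\<Sum>j\<in>J. \<rho> j s * c j powr p) < \<epsilon>"
    unfolding escape_def distribution_def by blast
  have "\<exists>j\<in>J. \<rho> j s < \<epsilon>"
  proof (rule ccontr)
    assume "\<not> (\<exists>j\<in>J. \<rho> j s < \<epsilon>)"
    then have "(\<Sum>j\<in>J. \<epsilon> * c j) \<le> (\<Sum>j\<in>J. \<rho> j s * c j powr p)"
      using c(1) p by (intro sum_mono) (auto simp: not_less intro!: mult_right_mono)
    then show False using small c(2) by (simp add: sum_distrib_left[symmetric])
  qed
  then obtain j where j: "j \<in> J" "\<rho> j s < \<epsilon>" by blast
  then have "j \<in> reach E n i" using J(2) by blast
  moreover have "ennreal (\<rho> j s) < ennreal \<epsilon>"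
    using j(2) weight_nonneg_reach[OF s \<open>j \<in> reach E n i\<close>] by (intro ennreal_lessI) auto
  ultimately show "(INF j\<in>reach E n i. INF s\<in>{0..<1}. ennreal (\<rho> j s)) < ennreal \<epsilon>"
    unfolding INF_less_iff using s by blast
next
  assume "(INF j\<in>reach E n i. INF s\<in>{0..<1}. ennreal (\<rho> j s)) < ennreal \<epsilon>"
  then obtain j s where j: "j \<in> reach E n i" and s: "s \<in> {0..<1}" and less: "ennreal (\<rho> j s) < ennreal \<epsilon>"
    unfolding INF_less_iff by blast
  have "\<rho> j s < \<epsilon>" using less weight_nonneg_reach[OF s j] by (simp add: ennreal_less_iff)
  then show "escape n i \<epsilon>"
    unfolding escape_def distribution_def using j s p by (intro bexI[of _ s] exI[of _ "{j}"] exI[of _ "\<lambda>_. 1"]) auto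
qed

text \<open>The cost is least for coefficients proportional to \<open>w j = \<rho> j powr (- 1 / (p - 1))\<close>, where it
  equals \<open>W powr (1 - p)\<close> for the sum \<open>W\<close> of these numbers; that it cannot be smaller is Hoelder's
  inequality.\<close>

lemma escape_iff_SUP:
  assumes p: "p > 1" and eps: "\<epsilon> > 0"
  shows "escape n i \<epsilon> \<longleftrightarrow> ennreal (\<epsilon> powr (- 1 / (p - 1))) <
    (SUP s\<in>{0..<1}. \<Sum>\<^sub>\<infinity>j\<in>reach E n i. ennreal (1 / \<rho> j s powr (1 / (p - 1))))"
proof -
  define w where "w j s = \<rho> j s powr (- 1 / (p - 1))" for j s
  have w_pos: "w j s > 0" if "j \<in> reach E n i" "s \<in> {0..<1}" for j s
    using weight_pos[OF reachD[OF that(1)] that(2)] by (simp add: w_def)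
  have w_eq: "1 / \<rho> j s powr (1 / (p - 1)) = w j s" for j s
    by (simp add: w_def powr_minus_divide)
  have level: "\<epsilon> powr (- 1 / (p - 1)) < W \<longleftrightarrow> W powr (1 - p) < \<epsilon>" if W: "W > 0" for W
  proof -
    have e: "(\<epsilon> powr (- 1 / (p - 1))) powr (1 - p) = \<epsilon>"
    proof -
      have "- 1 / (p - 1) * (1 - p) = 1" using p by (simp add: field_simps)
      then show ?thesis using eps unfolding powr_powr by simp
    qed
    have "\<epsilon> powr (- 1 / (p - 1)) < W \<longleftrightarrow> W powr (1 - p) < (\<epsilon> powr (- 1 / (p - 1))) powr (1 - p)"
      using powr_less_mono2_neg[of "1 - p" "\<epsilon> powr (- 1 / (p - 1))" W]
        powr_mono2'[of "1 - p" W "\<epsilon> powr (- 1 / (p - 1))"] p eps W by force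
    then show ?thesis unfolding e .
  qed
  have "escape n i \<epsilon> \<longleftrightarrow> (\<exists>s\<in>{0..<1}. \<exists>J. finite J \<and> J \<subseteq> reach E n i \<and> \<epsilon> powr (- 1 / (p - 1)) < (\<Sum>j\<in>J. w j s))"
  proof
    assume "escape n i \<epsilon>"
    then obtain s J c where s: "s \<in> {0..<1}" and J: "finite J" "J \<subseteq> reach E n i"
      and c: "\<forall>j\<in>J. c j \<ge> (0::real)" "sum c J = 1" and small: "(\<Sum>j\<in>J. \<rho> j s * c j powr p) < \<epsilon>"
      unfolding escape_def distribution_def by blast
    define W where "W = (\<Sum>j\<in>J. w j s)"
    have "J \<noteq> {}" using c(2) by auto
    then have W: "W > 0" unfolding W_def using J w_pos s by (intro sum_pos) auto
    have pos: "\<rho> j s > 0" if "j \<in> J" for j using J(2) that reachD by (intro weight_pos[OF _ s]) blast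
    have "1 \<le> W powr (p - 1) * (\<Sum>j\<in>J. \<rho> j s * c j powr p)"
      using weighted_holder[OF p J(1), of "\<lambda>j. \<rho> j s" c] pos c unfolding W_def w_def by simp
    also have "\<dots> < W powr (p - 1) * \<epsilon>" using small W by (intro mult_strict_left_mono) auto
    finally have "1 / W powr (p - 1) < \<epsilon>" using W by (simp add: field_simps)
    moreover have "W powr (1 - p) = 1 / W powr (p - 1)" using powr_minus_divide[of W "p - 1"] by simp
    ultimately have "\<epsilon> powr (- 1 / (p - 1)) < W" using level[OF W] by simp
    then show "\<exists>s\<in>{0..<1}. \<exists>J. finite J \<and> J \<subseteq> reach E n i \<and> \<epsilon> powr (- 1 / (p - 1)) < (\<Sum>j\<in>J. w j s)"
      using s J unfolding W_def by blast
  next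
    assume "\<exists>s\<in>{0..<1}. \<exists>J. finite J \<and> J \<subseteq> reach E n i \<and> \<epsilon> powr (- 1 / (p - 1)) < (\<Sum>j\<in>J. w j s)"
    then obtain s J where s: "s \<in> {0..<1}" and J: "finite J" "J \<subseteq> reach E n i"
      and large: "\<epsilon> powr (- 1 / (p - 1)) < (\<Sum>j\<in>J. w j s)" by blast
    define W where "W = (\<Sum>j\<in>J. w j s)"
    have W: "W > 0" using large eps unfolding W_def[symmetric] by (smt (verit) powr_ge_zero)
    have "(\<Sum>j\<in>J. \<rho> j s * (w j s / W) powr p) = (\<Sum>j\<in>J. w j s / W powr p)"
    proof (rule sum.cong)
      fix j assume "j \<in> J"
      then have j: "j \<in> reach E n i" using J(2) by blast
      have r: "\<rho> j s > 0" by (rule weight_pos[OF reachD[OF j] s])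
      have "1 + - 1 / (p - 1) * p = - 1 / (p - 1)" using p by (simp add: field_simps)
      then have "\<rho> j s * w j s powr p = w j s"
        unfolding w_def powr_powr using r powr_add[of "\<rho> j s" 1 "- 1 / (p - 1) * p"] by simp
      then show "\<rho> j s * (w j s / W) powr p = w j s / W powr p"
        using w_pos[OF j s] W by (simp add: powr_divide)
    qed simp
    also have "\<dots> = W powr (1 - p)"
      using W by (simp add: sum_divide_distrib[symmetric] W_def[symmetric] powr_diff)
    also have "\<dots> < \<epsilon>" using level[OF W] large by (simp add: W_def)
    finally have "(\<Sum>j\<in>J. \<rho> j s * (w j s / W) powr p) < \<epsilon>" .
    moreover have "(\<Sum>j\<in>J. w j s / W) = 1"
      using W by (simp add: sum_divide_distrib[symmetric] W_def[symmetric])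
    moreover have "\<forall>j\<in>J. 0 \<le> w j s / W" using W by (simp add: w_def)
    ultimately show "escape n i \<epsilon>"
      unfolding escape_def distribution_def using s J
      by (intro bexI[of _ s] exI[of _ J] exI[of _ "\<lambda>j. w j s / W"] conjI)
  qed
  also have "\<dots> \<longleftrightarrow> ennreal (\<epsilon> powr (- 1 / (p - 1))) < (SUP s\<in>{0..<1}. \<Sum>\<^sub>\<infinity>j\<in>reach E n i. ennreal (w j s))"
  proof -
    have "(\<Sum>j\<in>J. ennreal (w j s)) = ennreal (\<Sum>j\<in>J. w j s)" for J s
      by (rule sum_ennreal) (simp add: w_def)
    moreover have "(ennreal (\<epsilon> powr (- 1 / (p - 1))) < ennreal (\<Sum>j\<in>J. w j s)) \<longleftrightarrow>
        \<epsilon> powr (- 1 / (p - 1)) < (\<Sum>j\<in>J. w j s)" for J s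
      by (rule ennreal_less_iff) simp
    ultimately show ?thesis
      unfolding less_SUP_iff infsum_ennreal_SUP by auto
  qed
  finally show ?thesis unfolding w_eq .
qed

lemma exists_common_escape_iff:
  "(\<exists>n. strict_mono n \<and> (\<forall>i\<in>E. \<forall>\<epsilon>>0. eventually (\<lambda>h. escape (n h) i \<epsilon>) sequentially)) \<longleftrightarrow>
    (\<forall>F \<epsilon> N. finite F \<and> F \<subseteq> E \<and> \<epsilon> > 0 \<longrightarrow> (\<exists>n\<ge>N. \<forall>i\<in>F. escape n i \<epsilon>))"
  by (rule exists_common_subsequence_iff[OF countable_edges escape_mono])

lemma tendsto_iff_escape_1:
  assumes p: "p = 1"
  shows "(\<lambda>h. INF j\<in>reach E (n h) i. INF s\<in>{0..<1}. ennreal (\<rho> j s)) \<longlonglongrightarrow> 0 \<longleftrightarrow>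
    (\<forall>\<epsilon>>0. eventually (\<lambda>h. escape (n h) i \<epsilon>) sequentially)"
  unfolding ennreal_tendsto_0_iff escape_iff_INF[OF p] ..

lemma tendsto_iff_escape:
  assumes p: "p > 1"
  shows "(\<lambda>h. SUP s\<in>{0..<1}. \<Sum>\<^sub>\<infinity>j\<in>reach E (n h) i. ennreal (1 / \<rho> j s powr (1 / (p - 1)))) \<longlonglongrightarrow> \<infinity> \<longleftrightarrow>
    (\<forall>\<epsilon>>0. eventually (\<lambda>h. escape (n h) i \<epsilon>) sequentially)"
  (is "?f \<longlonglongrightarrow> \<infinity> \<longleftrightarrow> ?R")
proof -
  have "?R \<longleftrightarrow> (\<forall>\<epsilon>>0. eventually (\<lambda>h. ennreal (\<epsilon> powr (- 1 / (p - 1))) < ?f h) sequentially)"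
    using escape_iff_SUP[OF p] by simp
  also have "\<dots> \<longleftrightarrow> (\<forall>l>0. eventually (\<lambda>h. ennreal l < ?f h) sequentially)"
  proof (intro iffI allI impI)
    fix l :: real
    assume R: "\<forall>\<epsilon>>0. eventually (\<lambda>h. ennreal (\<epsilon> powr (- 1 / (p - 1))) < ?f h) sequentially" and l: "l > 0"
    have "(1 - p) * (- 1 / (p - 1)) = 1" using p by (simp add: field_simps)
    then have "(l powr (1 - p)) powr (- 1 / (p - 1)) = l" using l unfolding powr_powr by simp
    moreover have "l powr (1 - p) > 0" using l by simp
    ultimately show "eventually (\<lambda>h. ennreal l < ?f h) sequentially" using R by metis
  qed simp
  finally show ?thesis unfolding ennreal_tendsto_infinity_iff by blast
qed

end

theorem theorem3p1:
  fixes V :: "'v set" and E :: "('v \<times> 'v) set"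
  assumes "directed_tree V E" and "rooted V E" and "\<not> (\<exists>v. is_leaf V E v)"
  shows
    "(\<forall>\<rho>. admissible E 1 \<rho> \<longrightarrow>
        (let X = (Lp_topology E \<rho> 1 ::
                   ('v, 'k::{real_normed_field,euclidean_space}) tree_fun set topology);
             T = translation_semigroup E \<rho> 1;
             iii = (\<exists>n :: nat \<Rightarrow> nat. strict_mono n \<and>
                     (\<forall>i\<in>E. (\<lambda>h. INF j\<in>reach E (n h) i. INF s\<in>{0..<1}. ennreal (\<rho> j s))
                              \<longlonglongrightarrow> 0))
         in (hypercyclic X T \<longleftrightarrow> weakly_mixing X T) \<and> (weakly_mixing X T \<longleftrightarrow> iii)))
     \<and>
     (\<forall>p \<rho>. 1 < p \<and> admissible E p \<rho> \<longrightarrow>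
        (let X = (Lp_topology E \<rho> p :: ('v, 'k) tree_fun set topology);
             T = translation_semigroup E \<rho> p;
             iii = (\<exists>n :: nat \<Rightarrow> nat. strict_mono n \<and>
                     (\<forall>i\<in>E. (\<lambda>h. SUP s\<in>{0..<1}. \<Sum>\<^sub>\<infinity>j\<in>reach E (n h) i.
                                  ennreal (1 / \<rho> j s powr (1 / (p - 1))))
                              \<longlonglongrightarrow> \<infinity>))
         in (hypercyclic X T \<longleftrightarrow> weakly_mixing X T) \<and> (weakly_mixing X T \<longleftrightarrow> iii)))"
proof (intro conjI allI impI)
  note E = directed_tree_rooted_edges[OF assms(1,2)]
  show "let X = (Lp_topology E \<rho> 1 :: ('v, 'k) tree_fun set topology);
             T = translation_semigroup E \<rho> 1;
             iii = (\<exists>n :: nat \<Rightarrow> nat. strict_mono n \<and>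
                     (\<forall>i\<in>E. (\<lambda>h. INF j\<in>reach E (n h) i. INF s\<in>{0..<1}. ennreal (\<rho> j s))
                              \<longlonglongrightarrow> 0))
         in (hypercyclic X T \<longleftrightarrow> weakly_mixing X T) \<and> (weakly_mixing X T \<longleftrightarrow> iii)"
    if adm: "admissible E 1 \<rho>" for \<rho>
  proof -
    obtain K where "controlled_weight E 1 \<rho> K" using admissible_controlled_weight[OF E order_refl adm] by blast
    then interpret controlled_weight E 1 \<rho> K .
    show ?thesis
      unfolding Let_def dynamics_iff_escape tendsto_iff_escape_1[OF refl] exists_common_escape_iff by simp
  qed
  show "let X = (Lp_topology E \<rho> p :: ('v, 'k) tree_fun set topology);
             T = translation_semigroup E \<rho> p;
             iii = (\<exists>n :: nat \<Rightarrow> nat. strict_mono n \<and>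
                     (\<forall>i\<in>E. (\<lambda>h. SUP s\<in>{0..<1}. \<Sum>\<^sub>\<infinity>j\<in>reach E (n h) i.
                                  ennreal (1 / \<rho> j s powr (1 / (p - 1))))
                              \<longlonglongrightarrow> \<infinity>))
         in (hypercyclic X T \<longleftrightarrow> weakly_mixing X T) \<and> (weakly_mixing X T \<longleftrightarrow> iii)"
    if "1 < p \<and> admissible E p \<rho>" for p \<rho>
  proof -
    have p: "1 < p" "1 \<le> p" and adm: "admissible E p \<rho>" using that by auto
    obtain K where "controlled_weight E p \<rho> K" using admissible_controlled_weight[OF E p(2) adm] by blast
    then interpret controlled_weight E p \<rho> K .
    show ?thesis
      unfolding Let_def dynamics_iff_escape tendsto_iff_escape[OF p(1)] exists_common_escape_iff by simp
  qed
qed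

end
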